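(* Consider the two-queue $k$-limited polling model with switch-over times described in the context, with stationary queue lengths $N_1,N_2$. Suppose $\lambda_1/k_1<\lambda_2/k_2$ and $\lambda_2=(1-\rho_1-\delta)/\mathbb{E}[B_2']$ with $\delta>0$, all other parameters being fixed. Then for every integer $n_1\ge0$ and every real $\xi\ge0$, $$\lim_{\delta\downarrow0}\mathbb{P}[N_1\le n_1,\ \delta N_2\le\xi]=\mathcal{L}(n_1)\left(1-\mathrm{e}^{-\eta\xi}\right),$$ where $$\eta=\frac{2\,\mathbb{E}[B_2']}{2\frac{\lambda_1}{\mu_1^2}+\frac{1}{\mathbb{E}[B_2']}\left(1-\frac{\lambda_1}{\mu_1}\right)\mathbb{E}[B_2'^2]},$$ and $\mathcal{L}(\cdot)$ is the cumulative distribution function of the steady-state queue length of the single-server multiple-vacation queue with Poisson($\lambda_1$) arrivals, exponential($\mu_1$) service times and $k_1$-limited service, whose vacations are distributed as the sum of $k_2$ exponential($\mu_2$) service times, one exponential($\sigma_1$) time and one exponential($\sigma_2$) time, all independent.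
   Context: Polling model. Parameters: $\lambda_i,\mu_i,\sigma_i>0$ and integers $k_i\ge 1$ ($i=1,2$). A single server alternately visits two queues $Q_1,Q_2$. Customers arrive at $Q_i$ according to independent Poisson processes of rate $\lambda_i$; service times at $Q_i$ are exponential with parameter $\mu_i$. A visit to $Q_i$ ends when $k_i$ customers have been served during this visit or $Q_i$ becomes empty, whichever occurs first (in particular customers arriving during the visit may be served in it). The server then switches to the other queue, which takes an exponential switch-over time $S_i$ with parameter $\sigma_i$. If at the end of the switch-over time that queue is empty, the server immediately starts switching back. Exception: if at the end of a switch-over time both queues are empty, the server waits until the first arrival, and then goes to the queue $Q_j$ of that arrival (incurring the switch-over time if it is at the other queue) to start a visit of at most $k_j$ services. All random variables are independent. $N_i$ is the stationary (continuous-time) number of customers in $Q_i$, including any customer in service. Notation. $\rho_i=\lambda_i/\mu_i$; $S=S_1+S_2$ with independent summands, so $\mathbb{E}[S]=\frac1{\sigma_1}+\frac1{\sigma_2}$ and $\mathrm{Var}[S]=\frac1{\sigma_1^2}+\frac1{\sigma_2^2}$. Define $$\mathbb{E}[B_2']=\frac1{\mu_2}+\frac{\mathbb{E}[S]}{k_2},\quad \mathrm{Var}[B_2']=\frac1{\mu_2^2}+\frac{\mathrm{Var}[S]}{k_2},\quad \mathbb{E}[B_2'^2]=\mathrm{Var}[B_2']+\mathbb{E}[B_2']^2.$$ Queue $i$ is stable if and only if its utilization $u_i=\rho_1+\rho_2+\lambda_i\mathbb{E}[S]/k_i$ is less than $1$; under the stated choice of $\lambda_2$ one has $u_2=1-\delta$,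 and the condition $\lambda_1/k_1<\lambda_2/k_2$ (to hold for all sufficiently small $\delta>0$) gives $u_1<u_2$. Vacation queue. In a single-server multiple-vacation queue with $k_1$-limited service the server serves customers until $k_1$ have been served or the queue is empty, then takes a vacation; if the queue is empty on return, it takes another, independent vacation, and so on. The queue length is the time-stationary number of customers present, including any customer in service. *)

theory Defs
  imports "HOL-Probability.Probability"
begin

section \<open>Stationary laws of continuous-time Markov chains\<close>

text \<open>A chain is given by a state space \<open>S\<close> and, for every state, the finite list of its
  transitions \<open>(rate, target)\<close>. The rates of several transitions with the same target add up.
  A stationary law is a probability distribution on \<open>S\<close> that solves the global balance
  equations, that is, \<open>pi Q = 0\<close> for the generator \<open>Q\<close>.\<close>

definition trans_rate :: "('s \<Rightarrow> (real \<times> 's) list) \<Rightarrow> 's \<Rightarrow> 's \<Rightarrow> real" where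
  "trans_rate T x y = (\<Sum>(r, z)\<leftarrow>T x. if z = y then r else 0)"

definition exit_rate :: "('s \<Rightarrow> (real \<times> 's) list) \<Rightarrow> 's \<Rightarrow> real" where
  "exit_rate T x = (\<Sum>(r, z)\<leftarrow>T x. r)"

definition stationary_law :: "'s set \<Rightarrow> ('s \<Rightarrow> (real \<times> 's) list) \<Rightarrow> 's pmf \<Rightarrow> bool" where
  "stationary_law S T p \<longleftrightarrow> set_pmf p \<subseteq> S \<and>
     (\<forall>y\<in>S. ((\<lambda>x. pmf p x * trans_rate T x y) has_sum (pmf p y * exit_rate T y)) S)"


section \<open>The two-queue k-limited polling model\<close>

datatype queue = Q1 | Q2

fun other :: "queue \<Rightarrow> queue" where
  "other Q1 = Q2"
| "other Q2 = Q1"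

text \<open>\<open>Serving q c\<close>: a customer of queue \<open>q\<close> is in service and \<open>c\<close> customers have already been
  served during the current visit. \<open>Switching q\<close>: the server is on its way from \<open>q\<close> to
  \<open>other q\<close>, which takes an exponential time with parameter \<open>sig q\<close>. \<open>Waiting q\<close>: the
  server is at \<open>q\<close>, both queues being empty, and waits for the first arrival.\<close>

datatype activity = Serving queue nat | Switching queue | Waiting queue

text \<open>The first component of a state gives the number of customers in each queue, including the
  customer in service.\<close>

type_synonym polling_state = "(queue \<Rightarrow> nat) \<times> activity"

definition on_reaching :: "(queue \<Rightarrow> nat) \<Rightarrow> queue \<Rightarrow> activity" where
  "on_reaching n q =
     (if n q > 0 then Serving q 0 else if n (other q) > 0 then Switching q else Waiting q)"

definition polling_states :: "(queue \<Rightarrow> nat) \<Rightarrow> polling_state set" where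
  "polling_states k = {(n, a). case a of
      Serving q c \<Rightarrow> n q > 0 \<and> c < k q
    | Switching q \<Rightarrow> True
    | Waiting q \<Rightarrow> n Q1 = 0 \<and> n Q2 = 0}"

fun polling_trans ::
  "(queue \<Rightarrow> real) \<Rightarrow> (queue \<Rightarrow> real) \<Rightarrow> (queue \<Rightarrow> real) \<Rightarrow> (queue \<Rightarrow> nat) \<Rightarrow>
   polling_state \<Rightarrow> (real \<times> polling_state) list" where
  "polling_trans lam mu sig k (n, Serving q c) =
     [(lam Q1, (n(Q1 := n Q1 + 1), Serving q c)),
      (lam Q2, (n(Q2 := n Q2 + 1), Serving q c)),
      (mu q, (n(q := n q - 1),
         if n q - 1 = 0 \<or> c + 1 = k q then Switching q else Serving q (c + 1)))]"
| "polling_trans lam mu sig k (n, Switching q) =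
     [(lam Q1, (n(Q1 := n Q1 + 1), Switching q)),
      (lam Q2, (n(Q2 := n Q2 + 1), Switching q)),
      (sig q, (n, on_reaching n (other q)))]"
| "polling_trans lam mu sig k (n, Waiting q) =
     [(lam q, (n(q := n q + 1), Serving q 0)),
      (lam (other q), (n(other q := n (other q) + 1), Switching q))]"

definition polling_stationary ::
  "(queue \<Rightarrow> real) \<Rightarrow> (queue \<Rightarrow> real) \<Rightarrow> (queue \<Rightarrow> real) \<Rightarrow> (queue \<Rightarrow> nat) \<Rightarrow>
   polling_state pmf \<Rightarrow> bool" where
  "polling_stationary lam mu sig k p \<longleftrightarrow>
     stationary_law (polling_states k) (polling_trans lam mu sig k) p"

definition queue_length :: "queue \<Rightarrow> polling_state \<Rightarrow> nat" where
  "queue_length q s = fst s q"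


section \<open>The multiple-vacation queue with k-limited service\<close>

text \<open>A vacation is the sum of independent exponential times whose parameters are listed in
  \<open>rs\<close>. These times elapse one after the other: \<open>Vacation j\<close> means that the one with
  parameter \<open>rs ! j\<close> is running.\<close>

datatype vac_activity = VServing nat | Vacation nat

type_synonym vac_state = "nat \<times> vac_activity"

definition vac_states :: "nat \<Rightarrow> real list \<Rightarrow> vac_state set" where
  "vac_states k rs = {(n, a). case a of
      VServing c \<Rightarrow> n > 0 \<and> c < k
    | Vacation j \<Rightarrow> j < length rs}"

fun vac_trans ::
  "real \<Rightarrow> real \<Rightarrow> nat \<Rightarrow> real list \<Rightarrow> vac_state \<Rightarrow> (real \<times> vac_state) list" where
  "vac_trans lam mu k rs (n, VServing c) =
     [(lam, (n + 1, VServing c)),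
      (mu, (n - 1, if n - 1 = 0 \<or> c + 1 = k then Vacation 0 else VServing (c + 1)))]"
| "vac_trans lam mu k rs (n, Vacation j) =
     [(lam, (n + 1, Vacation j)),
      (rs ! j, (n,
         if j + 1 < length rs then Vacation (j + 1)
         else if n > 0 then VServing 0
         else Vacation 0))]"

definition vac_stationary :: "real \<Rightarrow> real \<Rightarrow> nat \<Rightarrow> real list \<Rightarrow> vac_state pmf \<Rightarrow> bool" where
  "vac_stationary lam mu k rs p \<longleftrightarrow>
     stationary_law (vac_states k rs) (vac_trans lam mu k rs) p"

definition vac_length_cdf :: "vac_state pmf \<Rightarrow> nat \<Rightarrow> real" where
  "vac_length_cdf p m = measure_pmf.prob p {s. fst s \<le> m}"


section \<open>The parameters of the limit\<close>

text \<open>\<open>S\<close> is the total switch-over time of a cycle, the sum of two independent exponential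
  times; \<open>B2'\<close> is a service time at \<open>Q2\<close> inflated by a \<open>1 / k Q2\<close> share of \<open>S\<close>.\<close>

definition mean_S :: "(queue \<Rightarrow> real) \<Rightarrow> real" where
  "mean_S sig = 1 / sig Q1 + 1 / sig Q2"

definition var_S :: "(queue \<Rightarrow> real) \<Rightarrow> real" where
  "var_S sig = 1 / (sig Q1)\<^sup>2 + 1 / (sig Q2)\<^sup>2"

definition mean_B2' :: "(queue \<Rightarrow> real) \<Rightarrow> (queue \<Rightarrow> real) \<Rightarrow> (queue \<Rightarrow> nat) \<Rightarrow> real" where
  "mean_B2' mu sig k = 1 / mu Q2 + mean_S sig / real (k Q2)"

definition var_B2' :: "(queue \<Rightarrow> real) \<Rightarrow> (queue \<Rightarrow> real) \<Rightarrow> (queue \<Rightarrow> nat) \<Rightarrow> real" where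
  "var_B2' mu sig k = 1 / (mu Q2)\<^sup>2 + var_S sig / real (k Q2)"

definition second_moment_B2' ::
  "(queue \<Rightarrow> real) \<Rightarrow> (queue \<Rightarrow> real) \<Rightarrow> (queue \<Rightarrow> nat) \<Rightarrow> real" where
  "second_moment_B2' mu sig k = var_B2' mu sig k + (mean_B2' mu sig k)\<^sup>2"

definition eta :: "real \<Rightarrow> (queue \<Rightarrow> real) \<Rightarrow> (queue \<Rightarrow> real) \<Rightarrow> (queue \<Rightarrow> nat) \<Rightarrow> real" where
  "eta lam1 mu sig k =
     2 * mean_B2' mu sig k /
     (2 * (lam1 / (mu Q1)\<^sup>2) +
      1 / mean_B2' mu sig k * (1 - lam1 / mu Q1) * second_moment_B2' mu sig k)"

text \<open>The arrival rates in the heavy-traffic limit: the second one is chosen such that the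
  utilization of \<open>Q2\<close>, which is \<open>rho1 + rho2 + lam Q2 * mean_S sig / k Q2\<close> with
  \<open>rho = lam / mu\<close>, equals \<open>1 - \<delta>\<close>.\<close>

definition ht_lam ::
  "real \<Rightarrow> (queue \<Rightarrow> real) \<Rightarrow> (queue \<Rightarrow> real) \<Rightarrow> (queue \<Rightarrow> nat) \<Rightarrow> real \<Rightarrow> queue \<Rightarrow> real" where
  "ht_lam lam1 mu sig k \<delta> q =
     (case q of Q1 \<Rightarrow> lam1 | Q2 \<Rightarrow> (1 - lam1 / mu Q1 - \<delta>) / mean_B2' mu sig k)"

end

(* Write G for the generator of the polling chain; stationarity gives E[G f] = 0 for bounded f.

   The workload w = n1 / mu1 + n2 E[B2'] + (correction by the activity of the server) has drift
   exactly -\<delta>, except at the few states where the server finds queue 2 empty; there the drift is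
   larger by at least a constant, and the mean excess is \<delta>, so these states have mass O(\<delta>).
   Expanding E[G exp (- s \<delta> w)] = 0 to second order, with w corrected by the solution of the Poisson
   equation for its local variance, gives the Laplace transform of an exponential law for \<delta> n2. The
   remaining boundary term is controlled by a second moment of n1 that is uniform in \<delta>; it comes from
   an exponential Lyapunov function for queue 1, whose drift is negative whatever queue 2 does.

   To first order, the measure exp (- s \<delta> n2) dP on the pairs (n1, activity) is invariant for the
   vacation queue. By tightness and uniqueness of invariant measures it converges to a multiple of the
   stationary law of that queue, so in the limit the two queue lengths are independent. *)
theory Submission
  imports Defs "HOL-Complex_Analysis.Great_Picard" "HOL-Real_Asymp.Real_Asymp"
begin

section \<open>Expectations and generators under a stationary law\<close>

text \<open>No moment of queue 2 is known in advance, while E[G f] = 0 is available for bounded f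
  only. Queue 2 therefore enters through bounded weights exp (- s \<delta> n2), and moments of queue
  1 through truncations. A customer of queue 2 weighs E[B2'] because near saturation each visit
  serves k2 customers, who share the switch-over times of the cycle. Where a visit falls short of k2
  services, this account breaks; the positive excess drift acts like the local time at a reflecting
  boundary. In the limit the load condition says that a cycle with k1 and k2 services brings fewer
  than k1 arrivals to queue 1; hence the uniform Lyapunov function. A second obstacle is the order
  of phases: the server switches before it serves queue 2, whereas the vacation of the theorem
  starts with the k2 services. The order does not matter for the queue length, but the two chains
  have different states. They are related by an intertwining operator whose weights may be negative,
  so the limits to be identified are signed measures, and uniqueness is needed for these.\<close>

abbreviation mean :: "'s pmf \<Rightarrow> ('s \<Rightarrow> real) \<Rightarrow> real" where
  "mean p f \<equiv> measure_pmf.expectation p f"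

lemma pmf_finite_approx:
  fixes p :: "'s pmf"
  assumes "e > 0"
  obtains X where "finite X" "X \<subseteq> set_pmf p" "measure_pmf.prob p X > 1 - e"
proof -
  define A where "A n = from_nat_into (set_pmf p) ` {..n}" for n :: nat
  have "(\<Union>n. A n) = from_nat_into (set_pmf p) ` (\<Union>n. {..n})"
    unfolding A_def by (rule image_UN[symmetric])
  also have "(\<Union>n. {..n}) = (UNIV :: nat set)" by auto
  also have "from_nat_into (set_pmf p) ` UNIV = set_pmf p"
    by (rule range_from_nat_into[OF set_pmf_not_empty countable_set_pmf])
  finally have "set_pmf p = (\<Union>n. A n)" by (rule sym)
  moreover have "(\<lambda>n. measure_pmf.prob p (A n)) \<longlonglongrightarrow> measure_pmf.prob p (\<Union>n. A n)"
    by (rule measure_pmf.finite_Lim_measure_incseq) (force simp: A_def incseq_def)+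
  ultimately have "(\<lambda>n. measure_pmf.prob p (A n)) \<longlonglongrightarrow> 1"
    using measure_pmf.prob_eq_1[of "set_pmf p" p] AE_measure_pmf[of p] by auto
  from order_tendstoD(1)[OF this, of "1 - e"] assms
  obtain n where "measure_pmf.prob p (A n) > 1 - e"
    by (auto simp: eventually_sequentially)
  moreover have "finite (A n)" "A n \<subseteq> set_pmf p"
    using from_nat_into[OF set_pmf_not_empty] by (auto simp: A_def)
  ultimately show ?thesis using that by blast
qed

lemma integrable_pmf_bounded:
  fixes f :: "'s \<Rightarrow> real"
  assumes "\<And>x. x \<in> set_pmf p \<Longrightarrow> \<bar>f x\<bar> \<le> C"
  shows "integrable (measure_pmf p) f"
  by (rule measure_pmf.integrable_const_bound[where B = C]) (use assms in \<open>auto simp: AE_measure_pmf_iff\<close>)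

lemma pmf_expectation_bounded:
  fixes f :: "'s \<Rightarrow> real"
  assumes "\<And>x. x \<in> set_pmf p \<Longrightarrow> \<bar>f x\<bar> \<le> C"
  shows "\<bar>mean p f\<bar> \<le> C"
proof -
  have "\<bar>mean p f\<bar> \<le> mean p (\<lambda>x. \<bar>f x\<bar>)"
    by (rule integral_abs_bound)
  also have "\<dots> \<le> mean p (\<lambda>x. C)"
    by (intro integral_mono_AE integrable_pmf_bounded[of _ _ C])
      (use assms in \<open>auto simp: AE_measure_pmf_iff intro: order_trans[OF abs_ge_zero]\<close>)
  finally show ?thesis by simp
qed

lemma pmf_expectation_mono:
  fixes f g :: "'s \<Rightarrow> real"
  assumes "integrable (measure_pmf p) f" "integrable (measure_pmf p) g"
    and "\<And>x. x \<in> set_pmf p \<Longrightarrow> f x \<le> g x"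
  shows "mean p f \<le> mean p g"
  by (intro integral_mono_AE) (use assms in \<open>auto simp: AE_measure_pmf_iff\<close>)

lemma pmf_expectation_cong:
  assumes "\<And>x. x \<in> set_pmf p \<Longrightarrow> f x = g x"
  shows "mean p f = mean p g"
  by (intro integral_cong_AE) (use assms in \<open>auto simp: AE_measure_pmf_iff\<close>)

text \<open>The balance equations are unordered sums, the estimates are integrals; this is the
  bridge. A finite set carrying almost all mass leaves a remainder of at most \<open>C\<close> times
  the missing mass.\<close>

lemma pmf_expectation_has_sum:
  fixes f :: "'s \<Rightarrow> real"
  assumes S: "set_pmf p \<subseteq> S" and f: "\<And>x. x \<in> S \<Longrightarrow> \<bar>f x\<bar> \<le> C"
  shows "((\<lambda>x. pmf p x * f x) has_sum mean p f) S"
  unfolding has_sum_def tendsto_iff eventually_finite_subsets_at_top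
proof (intro allI impI)
  fix e :: real assume e: "e > 0"
  have C: "C \<ge> 0" using f S set_pmf_not_empty[of p] by fastforce
  obtain X where X: "finite X" "X \<subseteq> set_pmf p" "measure_pmf.prob p X > 1 - e / (C + 1)"
    using pmf_finite_approx[of "e / (C + 1)" p] e C by auto
  show "\<exists>X. finite X \<and> X \<subseteq> S \<and> (\<forall>Y. finite Y \<and> X \<subseteq> Y \<and> Y \<subseteq> S \<longrightarrow>
      dist (\<Sum>x\<in>Y. pmf p x * f x) (mean p f) < e)"
  proof (intro exI[of _ X] conjI allI impI)
    fix Y assume Y: "finite Y \<and> X \<subseteq> Y \<and> Y \<subseteq> S"
    have int: "integrable (measure_pmf p) (\<lambda>x. f x * indicator A x)" for A :: "'s set"
      by (rule integrable_pmf_bounded[of _ _ C]) (use f S C in \<open>auto simp: indicator_def\<close>)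
    have "mean p (\<lambda>x. f x * indicator Y x) = (\<Sum>x\<in>Y. (f x * indicator Y x) * pmf p x)"
      by (rule integral_measure_pmf_real) (use Y in \<open>auto simp: indicator_def split: if_splits\<close>)
    then have 1: "(\<Sum>x\<in>Y. pmf p x * f x) = mean p (\<lambda>x. f x * indicator Y x)"
      by (auto simp: mult_ac intro!: sum.cong)
    have "mean p f = mean p (\<lambda>x. f x * indicator Y x + f x * indicator (-Y) x)"
      by (rule pmf_expectation_cong) (auto simp: indicator_def)
    also have "\<dots> = mean p (\<lambda>x. f x * indicator Y x)
        + mean p (\<lambda>x. f x * indicator (-Y) x)"
      by (intro Bochner_Integration.integral_add int)
    finally have 2: "mean p f - (\<Sum>x\<in>Y. pmf p x * f x)
        = mean p (\<lambda>x. f x * indicator (-Y) x)" using 1 by simp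
    have "\<bar>mean p (\<lambda>x. f x * indicator (-Y) x)\<bar>
        \<le> mean p (\<lambda>x. \<bar>f x * indicator (-Y) x\<bar>)" by (rule integral_abs_bound)
    also have "\<dots> \<le> mean p (\<lambda>x. C * indicator (-Y) x)"
      by (intro pmf_expectation_mono integrable_abs int integrable_pmf_bounded[of _ _ C])
        (use f S C in \<open>auto simp: indicator_def\<close>)
    also have "\<dots> = C * (1 - measure_pmf.prob p Y)"
      using measure_pmf.prob_compl[of Y p] by (simp add: Compl_eq_Diff_UNIV)
    also have "\<dots> \<le> C * (e / (C + 1))"
      using X(3) Y C measure_pmf.finite_measure_mono[of X Y p] by (intro mult_left_mono) auto
    also have "\<dots> < e" using e C by (simp add: field_simps)
    finally show "dist (\<Sum>x\<in>Y. pmf p x * f x) (mean p f) < e"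
      using 2 by (simp add: dist_real_def abs_minus_commute)
  qed (use X S in auto)
qed

definition gen :: "('s \<Rightarrow> (real \<times> 's) list) \<Rightarrow> ('s \<Rightarrow> real) \<Rightarrow> 's \<Rightarrow> real" where
  "gen T f x = (\<Sum>(r, z)\<leftarrow>T x. r * (f z - f x))"

lemma gen_eq: "gen T f x = (\<Sum>(r, z)\<leftarrow>T x. r * f z) - exit_rate T x * f x"
proof -
  have "(\<Sum>(r, z)\<leftarrow>xs. r * (f z - c)) = (\<Sum>(r, z)\<leftarrow>xs. r * f z) - (\<Sum>(r, z)\<leftarrow>xs. r) * c" for xs c
    by (induction xs) (auto simp: algebra_simps)
  then show ?thesis unfolding gen_def exit_rate_def .
qed

lemma trans_rate_has_sum:
  assumes "\<And>r z. (r, z) \<in> set (T x) \<Longrightarrow> z \<in> S"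
  shows "((\<lambda>y. trans_rate T x y * h y) has_sum (\<Sum>(r, z)\<leftarrow>T x. r * h z)) S"
proof -
  have "((\<lambda>y. (\<Sum>(r, z)\<leftarrow>xs. if z = y then r else 0) * h y) has_sum (\<Sum>(r, z)\<leftarrow>xs. r * h z)) S"
    if "\<And>r z. (r, z) \<in> set xs \<Longrightarrow> z \<in> S" for xs :: "(real \<times> 'a) list"
    using that
  proof (induction xs)
    case (Cons a xs)
    obtain r z where a: "a = (r, z)" by force
    have z: "z \<in> S" using Cons.prems a by auto
    have "((\<lambda>y. (if z = y then r else 0) * h y) has_sum (r * h z)) S"
      by (rule has_sum_finite_neutralI[where B = "{z}"]) (use z in auto)
    moreover have "((\<lambda>y. (\<Sum>(r, z)\<leftarrow>xs. if z = y then r else 0) * h y) has_sum (\<Sum>(r, z)\<leftarrow>xs. r * h z)) S"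
      using Cons by auto
    ultimately show ?case
      using has_sum_add by (fastforce simp: a distrib_right)
  qed simp
  with assms show ?thesis unfolding trans_rate_def by blast
qed

lemma rate_sum_const: "(\<Sum>(r, z)\<leftarrow>T x. r * c) = exit_rate T x * c"
proof -
  have "(\<Sum>(r, z)\<leftarrow>xs. r * c) = (\<Sum>(r, z)\<leftarrow>xs. r) * c" for xs :: "(real \<times> 'a) list"
    by (induction xs) (auto simp: distrib_right)
  then show ?thesis unfolding exit_rate_def .
qed

text \<open>The uniform bound \<open>R\<close> on the exit rates makes the generator map bounded
  functions to bounded functions. In the application \<open>R\<close> is chosen independent of
  \<delta>.\<close>

locale bounded_chain =
  fixes S :: "'s set" and T :: "'s \<Rightarrow> (real \<times> 's) list" and R :: real
  assumes closed: "x \<in> S \<Longrightarrow> (r, z) \<in> set (T x) \<Longrightarrow> z \<in> S"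
    and rate_nonneg: "x \<in> S \<Longrightarrow> (r, z) \<in> set (T x) \<Longrightarrow> r \<ge> 0"
    and exit_le: "x \<in> S \<Longrightarrow> exit_rate T x \<le> R"
    and R_nonneg: "R \<ge> 0"
begin

lemma exit_nonneg: "x \<in> S \<Longrightarrow> exit_rate T x \<ge> 0"
  unfolding exit_rate_def using rate_nonneg by (intro sum_list_nonneg) auto

lemma trans_nonneg: "x \<in> S \<Longrightarrow> trans_rate T x y \<ge> 0"
  unfolding trans_rate_def using rate_nonneg by (intro sum_list_nonneg) auto

lemma rate_sum_mono:
  assumes x: "x \<in> S" and g: "\<And>r z. (r, z) \<in> set (T x) \<Longrightarrow> z \<in> S \<Longrightarrow> g z \<le> h z"
  shows "(\<Sum>(r, z)\<leftarrow>T x. r * g z) \<le> (\<Sum>(r, z)\<leftarrow>T x. r * h z)"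
  by (rule sum_list_mono) (use rate_nonneg[OF x] closed[OF x] g in \<open>auto intro!: mult_left_mono\<close>)

lemma rate_sum_bound:
  assumes x: "x \<in> S" and g: "\<And>r z. (r, z) \<in> set (T x) \<Longrightarrow> z \<in> S \<Longrightarrow> \<bar>g z\<bar> \<le> J" and J: "J \<ge> 0"
  shows "\<bar>\<Sum>(r, z)\<leftarrow>T x. r * g z\<bar> \<le> R * J"
proof -
  have "(\<Sum>(r, z)\<leftarrow>T x. r * g z) \<le> exit_rate T x * J"
    unfolding rate_sum_const[symmetric] by (rule rate_sum_mono[OF x]) (use g in force)
  moreover have "exit_rate T x * (- J) \<le> (\<Sum>(r, z)\<leftarrow>T x. r * g z)"
    unfolding rate_sum_const[symmetric] by (rule rate_sum_mono[OF x]) (use g in force)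
  moreover have "exit_rate T x * J \<le> R * J" using exit_le[OF x] J by (intro mult_right_mono)
  ultimately show ?thesis by (simp add: abs_le_iff)
qed

lemma gen_bound:
  assumes "x \<in> S" "\<And>r z. (r, z) \<in> set (T x) \<Longrightarrow> z \<in> S \<Longrightarrow> \<bar>f z - f x\<bar> \<le> J" "J \<ge> 0"
  shows "\<bar>gen T f x\<bar> \<le> R * J"
  unfolding gen_def using rate_sum_bound[OF assms(1), of "\<lambda>z. f z - f x" J] assms by auto

lemma gen_bounded:
  assumes x: "x \<in> S" and f: "\<And>x. x \<in> S \<Longrightarrow> \<bar>f x\<bar> \<le> C"
  shows "\<bar>gen T f x\<bar> \<le> R * (2 * C)"
proof (rule gen_bound[OF x])
  show "\<bar>f z - f x\<bar> \<le> 2 * C" if "z \<in> S" for z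
    using f[OF that] f[OF x] abs_triangle_ineq4[of "f z" "f x"] by linarith
  show "2 * C \<ge> 0" using f[OF x] abs_ge_zero[of "f x"] by linarith
qed

text \<open>Fubini for the family \<open>pmf p x * trans_rate T x y * f y\<close>, absolutely
  summable because its rows have mass at most \<open>R * C\<close> times \<open>pmf p x\<close>. Row
  sums give the inflow part of \<open>gen\<close>, and column sums, by global balance, the outflow
  part.\<close>

lemma stationary_expectation_gen:
  assumes stat: "stationary_law S T p" and f: "\<And>x. x \<in> S \<Longrightarrow> \<bar>f x\<bar> \<le> C"
  shows "mean p (gen T f) = 0"
proof -
  have supp: "set_pmf p \<subseteq> S" and
    bal: "\<And>y. y \<in> S \<Longrightarrow> ((\<lambda>x. pmf p x * trans_rate T x y) has_sum (pmf p y * exit_rate T y)) S"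
    using stat by (auto simp: stationary_law_def)
  have C: "C \<ge> 0" using f supp set_pmf_not_empty[of p] by fastforce
  have p_sum: "(pmf p has_sum 1) S"
    using pmf_expectation_has_sum[OF supp, of "\<lambda>_. 1" 1] by simp
  have row: "((\<lambda>y. pmf p x * (trans_rate T x y * h y)) has_sum (pmf p x * (\<Sum>(r, z)\<leftarrow>T x. r * h z))) S"
    if "x \<in> S" for x h
    using closed[OF that] by (intro has_sum_cmult_right trans_rate_has_sum)
  have "(\<lambda>x. pmf p x * (exit_rate T x * C)) summable_on S"
  proof (rule summable_on_comparison_test)
    show "(\<lambda>x. pmf p x * (R * C)) summable_on S"
      by (intro summable_on_cmult_left has_sum_imp_summable[OF p_sum])
  qed (use exit_le exit_nonneg C in \<open>auto intro!: mult_left_mono mult_right_mono\<close>)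
  then have "(\<lambda>(x, y). pmf p x * (trans_rate T x y * C)) summable_on S \<times> S"
    using row[of _ "\<lambda>_. C"] trans_nonneg C unfolding rate_sum_const
    by (intro summable_on_SigmaI[where g = "\<lambda>x. pmf p x * (exit_rate T x * C)"]) auto
  then have "(\<lambda>z. norm ((\<lambda>(x, y). pmf p x * (trans_rate T x y * f y)) z)) summable_on S \<times> S"
    by (rule Infinite_Sum.abs_summable_on_comparison_test')
      (use f trans_nonneg in \<open>auto simp: abs_mult intro!: mult_left_mono\<close>)
  from abs_summable_summable[OF this] obtain a where
    a: "((\<lambda>(x, y). pmf p x * (trans_rate T x y * f y)) has_sum a) (S \<times> S)"
    by (auto simp: summable_on_def)
  have 1: "((\<lambda>x. pmf p x * (\<Sum>(r, z)\<leftarrow>T x. r * f z)) has_sum a) S"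
    by (rule has_sum_SigmaD[OF a]) (use row in auto)
  have 2: "((\<lambda>y. pmf p y * exit_rate T y * f y) has_sum a) S"
  proof (rule has_sum_SigmaD)
    show "((\<lambda>(y, x). pmf p x * (trans_rate T x y * f y)) has_sum a) (S \<times> S)"
      using a by (subst (asm) has_sum_swap) simp
    fix y assume "y \<in> S"
    from has_sum_cmult_left[OF bal[OF this], of "f y"]
    show "((\<lambda>x. (\<lambda>(y, x). pmf p x * (trans_rate T x y * f y)) (y, x)) has_sum
        pmf p y * exit_rate T y * f y) S" by (simp add: mult.assoc)
  qed
  have "((\<lambda>x. pmf p x * gen T f x) has_sum (a - a)) S"
    using has_sum_add[OF 1 has_sum_uminusI[OF 2]] by (simp add: gen_eq algebra_simps)
  moreover have "((\<lambda>x. pmf p x * gen T f x) has_sum mean p (gen T f)) S"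
    by (rule pmf_expectation_has_sum[OF supp gen_bounded[OF _ f]])
  ultimately have "a - a = mean p (gen T f)" by (rule has_sum_unique)
  then show ?thesis by simp
qed

end

section \<open>Moment bounds and expansions of exponential test functions\<close>

lemma exp_taylor2:
  fixes y :: real
  assumes "\<bar>y\<bar> \<le> 1"
  shows "\<bar>exp y - 1 - y - y\<^sup>2 / 2\<bar> \<le> \<bar>y\<bar> ^ 3 / 2"
proof -
  obtain t where t: "\<bar>t\<bar> \<le> \<bar>y\<bar>" "exp y = (\<Sum>m<3. y ^ m / fact m) + exp t / fact 3 * y ^ 3"
    using Maclaurin_exp_le by blast
  have "exp t \<le> exp 1" using t assms by simp
  then have et: "exp t \<le> 3" using exp_le by linarith
  have "exp y - 1 - y - y\<^sup>2 / 2 = exp t / 6 * y ^ 3"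
    unfolding t(2) by (simp add: numeral_3_eq_3 fact_numeral eval_nat_numeral)
  also have "\<bar>\<dots>\<bar> = exp t / 6 * \<bar>y\<bar> ^ 3" by (simp add: abs_mult power_abs)
  also have "\<dots> \<le> 3 / 6 * \<bar>y\<bar> ^ 3" using et by (intro mult_right_mono) auto
  finally show ?thesis by simp
qed

lemma exp_upper_quadratic:
  fixes y :: real
  assumes "\<bar>y\<bar> \<le> 1"
  shows "exp y - 1 \<le> y + y\<^sup>2"
proof -
  have "\<bar>y\<bar> ^ 3 = y\<^sup>2 * \<bar>y\<bar>" by (simp add: power3_eq_cube power2_eq_square abs_mult_self_eq)
  also have "\<dots> \<le> y\<^sup>2 * 1" using assms by (intro mult_left_mono) auto
  finally show ?thesis using exp_taylor2[OF assms] by linarith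
qed

lemma exp_minus_lipschitz:
  fixes a b :: real
  assumes "a \<ge> 0" "b \<ge> 0"
  shows "\<bar>exp (- a) - exp (- b)\<bar> \<le> \<bar>a - b\<bar>"
proof -
  have *: "exp (- x) - exp (- y) \<le> y - x" if "0 \<le> x" "x \<le> y" for x y :: real
  proof -
    have "exp (- x) - exp (- y) = exp (- x) * (1 - exp (- (y - x)))"
      by (simp add: right_diff_distrib exp_diff exp_minus field_simps)
    also have "\<dots> \<le> 1 * (1 - exp (- (y - x)))" using that by (intro mult_right_mono) auto
    also have "\<dots> \<le> y - x" using exp_ge_add_one_self[of "- (y - x)"] unfolding mult_1_left by linarith
    finally show ?thesis .
  qed
  show ?thesis
    by (cases "a \<le> b") (use *[of a b] *[of b a] assms in \<open>auto simp: abs_if\<close>)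
qed

text \<open>Monotone convergence. Bounded test functions yield bounds for truncated moments only;
  this removes the truncation.\<close>

lemma pmf_integrable_bounded_truncation:
  fixes f :: "'s \<Rightarrow> real"
  assumes f: "\<And>x. f x \<ge> 0"
    and le: "\<And>N. mean p (\<lambda>x. f x * indicator {x. f x \<le> N} x) \<le> C"
  shows "integrable (measure_pmf p) f" "mean p f \<le> C"
proof -
  define g where "g n x = f x * indicator {x. f x \<le> real n} x" for n :: nat and x
  have int: "integrable (measure_pmf p) (g n)" for n
    by (rule integrable_pmf_bounded[of _ _ "real n"]) (use f in \<open>auto simp: g_def indicator_def\<close>)
  have mono: "mono (\<lambda>n. g n x)" for x
    using f by (auto simp: mono_def g_def indicator_def)
  have lim: "(\<lambda>n. g n x) \<longlonglongrightarrow> f x" for x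
  proof (rule tendsto_eventually)
    show "\<forall>\<^sub>F n in sequentially. g n x = f x"
      unfolding eventually_sequentially
      by (rule exI[of _ "nat \<lceil>f x\<rceil>"]) (auto simp: g_def indicator_def nat_ceiling_le_eq)
  qed
  have "incseq (\<lambda>n. mean p (g n))"
    using mono by (auto simp: incseq_def monoD intro!: pmf_expectation_mono int)
  moreover have bd: "mean p (g n) \<le> C" for n
    using le[of "real n"] by (simp add: g_def[abs_def])
  ultimately obtain c where c: "(\<lambda>n. mean p (g n)) \<longlonglongrightarrow> c"
    using incseq_convergent[of _ C] by metis
  show "integrable (measure_pmf p) f"
    by (rule integrable_monotone_convergence[OF int _ _ c]) (use mono lim in auto)
  have "mean p f = c"
    by (rule integral_monotone_convergence[OF int _ _ c]) (use mono lim in auto)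
  then show "mean p f \<le> C"
    using bd c by (auto intro: LIMSEQ_le_const2)
qed

text \<open>The carre du champ of \<open>f\<close>, that is, the local variance of \<open>f\<close>
  along the chain.\<close>

definition quad :: "('s \<Rightarrow> (real \<times> 's) list) \<Rightarrow> ('s \<Rightarrow> real) \<Rightarrow> 's \<Rightarrow> real" where
  "quad T f x = (\<Sum>(r, z)\<leftarrow>T x. r * (f z - f x)\<^sup>2)"

context bounded_chain
begin

lemma rate_sum_bound_above:
  assumes x: "x \<in> S" and g: "\<And>r z. (r, z) \<in> set (T x) \<Longrightarrow> z \<in> S \<Longrightarrow> g z \<le> J" and J: "J \<ge> 0"
  shows "(\<Sum>(r, z)\<leftarrow>T x. r * g z) \<le> R * J"
proof -
  have "(\<Sum>(r, z)\<leftarrow>T x. r * g z) \<le> exit_rate T x * J"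
    unfolding rate_sum_const[symmetric] by (rule rate_sum_mono[OF x]) (use g in force)
  also have "\<dots> \<le> R * J" using exit_le[OF x] J by (intro mult_right_mono)
  finally show ?thesis .
qed

text \<open>If \<open>d\<close> is invariant, then \<open>\<bar>d\<bar>\<close> is subinvariant, and summing over all states shows that it is
  invariant. So the positive part of \<open>d\<close> is invariant, and its zero set is closed under predecessors.\<close>

lemma invariant_vanishes_aux:
  assumes sum: "(d has_sum 0) S"
    and bal: "\<And>y. y \<in> S \<Longrightarrow> ((\<lambda>x. d x * trans_rate T x y) has_sum (d y * exit_rate T y)) S"
    and z0: "z0 \<in> S" "d z0 \<le> 0"
    and reach: "\<forall>Z. z0 \<in> Z \<longrightarrow>
      (\<forall>x\<in>S. \<forall>y\<in>S. y \<in> Z \<longrightarrow> trans_rate T x y > 0 \<longrightarrow> x \<in> Z) \<longrightarrow> S \<subseteq> Z"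
    and x: "x \<in> S"
  shows "d x = 0"
proof -
  have abs: "(\<lambda>x. \<bar>d x\<bar>) summable_on S"
    using summable_on_iff_abs_summable_on_real[THEN iffD1, OF has_sum_imp_summable[OF sum]]
    unfolding real_norm_def .
  have row: "((\<lambda>y. \<bar>d x\<bar> * trans_rate T x y) has_sum (\<bar>d x\<bar> * exit_rate T x)) S" if "x \<in> S" for x
  proof (rule has_sum_cmult_right)
    have "((\<lambda>y. trans_rate T x y * 1) has_sum (\<Sum>(r, z)\<leftarrow>T x. r * 1)) S"
      using closed[OF that] by (rule trans_rate_has_sum)
    then show "(trans_rate T x has_sum exit_rate T x) S" unfolding rate_sum_const by simp
  qed
  have "(\<lambda>x. \<bar>d x\<bar> * exit_rate T x) summable_on S"
  proof (rule summable_on_comparison_test)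
    show "(\<lambda>x. \<bar>d x\<bar> * R) summable_on S" by (intro summable_on_cmult_left abs)
  qed (use exit_le exit_nonneg in \<open>auto intro!: mult_left_mono\<close>)
  then obtain a where a: "((\<lambda>x. \<bar>d x\<bar> * exit_rate T x) has_sum a) S" by (auto simp: summable_on_def)
  have "(\<lambda>(x, y). \<bar>d x\<bar> * trans_rate T x y) summable_on S \<times> S"
    using row trans_nonneg has_sum_imp_summable[OF a]
    by (intro summable_on_SigmaI[where g = "\<lambda>x. \<bar>d x\<bar> * exit_rate T x"]) auto
  then obtain b where b: "((\<lambda>(x, y). \<bar>d x\<bar> * trans_rate T x y) has_sum b) (S \<times> S)"
    by (auto simp: summable_on_def)
  have "((\<lambda>x. \<bar>d x\<bar> * exit_rate T x) has_sum b) S"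
    by (rule has_sum_SigmaD[OF b]) (use row in auto)
  with a have ab: "a = b" by (rule has_sum_unique)
  have b': "((\<lambda>(y, x). \<bar>d x\<bar> * trans_rate T x y) has_sum b) (S \<times> S)"
    using b by (subst (asm) has_sum_swap) simp
  define I where "I y = infsum (\<lambda>x. \<bar>d x\<bar> * trans_rate T x y) S" for y
  have I: "((\<lambda>x. \<bar>d x\<bar> * trans_rate T x y) has_sum I y) S" if "y \<in> S" for y
    unfolding I_def using summable_on_SigmaD1[OF has_sum_imp_summable[OF b'] that]
    by (rule has_sum_infsum)
  have Ib: "(I has_sum b) S"
    by (rule has_sum_SigmaD[OF b']) (use I in auto)
  have ge: "\<bar>d y\<bar> * exit_rate T y \<le> I y" if "y \<in> S" for y
  proof -
    have "d y * exit_rate T y \<le> I y"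
      by (rule has_sum_mono[OF bal[OF that] I[OF that]])
        (use trans_nonneg in \<open>auto intro!: mult_right_mono\<close>)
    moreover have "- (d y * exit_rate T y) \<le> I y"
      by (rule has_sum_mono[OF has_sum_uminusI[OF bal[OF that]] I[OF that]])
        (use mult_right_mono[of "- d x" "\<bar>d x\<bar>" "trans_rate T x y" for x] trans_nonneg in auto)
    ultimately show ?thesis
      by (simp add: abs_if)
  qed
  have "((\<lambda>y. I y + - (\<bar>d y\<bar> * exit_rate T y)) has_sum (b + - a)) S"
    by (rule has_sum_add[OF Ib has_sum_uminusI[OF a]])
  then have z: "((\<lambda>y. I y + - (\<bar>d y\<bar> * exit_rate T y)) has_sum 0) S" by (simp add: ab)
  have eq: "I y = \<bar>d y\<bar> * exit_rate T y" if "y \<in> S" for y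
  proof -
    have "I y + - (\<bar>d y\<bar> * exit_rate T y) = 0"
      by (rule nonneg_has_sum_le_0D[OF z _ _ that]) (use ge in auto)
    then show ?thesis by simp
  qed
  \<comment> \<open>Twice the positive part of \<open>d\<close>; it vanishes at \<open>z0\<close>
    because \<open>d z0 \<le> 0\<close>.\<close>
  define e where "e x = \<bar>d x\<bar> + d x" for x
  have e: "e x \<ge> 0" for x by (simp add: e_def)
  have bal_e: "((\<lambda>x. e x * trans_rate T x y) has_sum (e y * exit_rate T y)) S" if "y \<in> S" for y
    using has_sum_add[OF I[OF that] bal[OF that]] eq[OF that] by (simp add: e_def distrib_right)
  have "S \<subseteq> {x \<in> S. e x = 0}"
  proof (rule reach[rule_format])
    show "z0 \<in> {x \<in> S. e x = 0}" using z0 by (simp add: e_def)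
    fix x y assume xy: "x \<in> S" "y \<in> S" "y \<in> {x \<in> S. e x = 0}" "trans_rate T x y > 0"
    have "e x * trans_rate T x y = 0"
      by (rule nonneg_has_sum_le_0D[OF bal_e[OF xy(2)]]) (use xy e trans_nonneg in auto)
    then show "x \<in> {x \<in> S. e x = 0}" using xy by auto
  qed
  then have neg: "d x \<le> 0" if "x \<in> S" for x using that by (fastforce simp: e_def)
  have "- d x = 0"
    by (rule nonneg_has_sum_le_0D[OF has_sum_uminusI[OF sum]]) (use neg x in auto)
  then show ?thesis by simp
qed

text \<open>Uniqueness for signed invariant measures: if \<open>d z0\<close> is positive, pass to
  \<open>- d\<close>. Signs cannot be excluded, since \<open>d\<close> will be a difference
  involving a limit of signed measures.\<close>

lemma invariant_vanishes:
  assumes sum: "(d has_sum 0) S"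
    and bal: "\<And>y. y \<in> S \<Longrightarrow> ((\<lambda>x. d x * trans_rate T x y) has_sum (d y * exit_rate T y)) S"
    and z0: "z0 \<in> S"
    and reach: "\<forall>Z. z0 \<in> Z \<longrightarrow>
      (\<forall>x\<in>S. \<forall>y\<in>S. y \<in> Z \<longrightarrow> trans_rate T x y > 0 \<longrightarrow> x \<in> Z) \<longrightarrow> S \<subseteq> Z"
    and x: "x \<in> S"
  shows "d x = 0"
proof (cases "d z0 \<le> 0")
  case True
  show ?thesis by (rule invariant_vanishes_aux[OF sum bal z0 True reach x])
next
  case False
  have "- d x = 0"
  proof (rule invariant_vanishes_aux[OF _ _ z0 _ reach x])
    show "((\<lambda>x. - d x) has_sum 0) S" using has_sum_uminusI[OF sum] by simp
    show "((\<lambda>x. - d x * trans_rate T x y) has_sum (- d y * exit_rate T y)) S" if "y \<in> S" for y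
      using has_sum_uminusI[OF bal[OF that]] by simp
  qed (use False in auto)
  then show ?thesis by simp
qed

lemma stationary_support: "stationary_law S T p \<Longrightarrow> set_pmf p \<subseteq> S"
  by (simp add: stationary_law_def)

text \<open>The generator identity for \<open>exp (- (\<epsilon> * L x))\<close>, divided by
  \<epsilon>. This test function is bounded even if \<open>L\<close> is not. Bounded jumps make the
  cubic Taylor remainder of order \<epsilon> to the third, hence the error of order \<epsilon>
  squared after the division.\<close>

lemma second_order:
  assumes stat: "stationary_law S T p" and L: "\<And>x. x \<in> S \<Longrightarrow> L x \<ge> 0"
    and jump: "\<And>x r z. x \<in> S \<Longrightarrow> (r, z) \<in> set (T x) \<Longrightarrow> \<bar>L z - L x\<bar> \<le> J"
    and eps: "\<epsilon> > 0" "\<epsilon> * J \<le> 1" and J: "J \<ge> 0"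
  shows "\<bar>mean p (\<lambda>x. exp (- (\<epsilon> * L x)) * (gen T L x - \<epsilon> / 2 * quad T L x))\<bar>
    \<le> \<epsilon>\<^sup>2 * (R * J ^ 3)"
proof -
  note supp = stationary_support[OF stat]
  define rem where "rem x z = exp (- (\<epsilon> * (L z - L x))) - 1 - - (\<epsilon> * (L z - L x)) - (- (\<epsilon> * (L z - L x)))\<^sup>2 / 2" for x z
  define E where "E x = (\<Sum>(r, z)\<leftarrow>T x. r * rem x z)" for x
  define f where "f x = exp (- (\<epsilon> * L x))" for x
  have f01: "0 \<le> f x" "f x \<le> 1" if "x \<in> S" for x using L[OF that] eps by (auto simp: f_def)
  have rem: "\<bar>rem x z\<bar> \<le> \<epsilon> ^ 3 * J ^ 3" if "x \<in> S" "(r, z) \<in> set (T x)" for x r z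
  proof -
    have le: "\<bar>- (\<epsilon> * (L z - L x))\<bar> \<le> \<epsilon> * J" using jump[OF that] eps by (simp add: abs_mult)
    then have "\<bar>rem x z\<bar> \<le> \<bar>- (\<epsilon> * (L z - L x))\<bar> ^ 3 / 2"
      unfolding rem_def by (intro exp_taylor2) (use eps in linarith)
    also have "\<dots> \<le> \<bar>- (\<epsilon> * (L z - L x))\<bar> ^ 3" by simp
    also have "\<dots> \<le> (\<epsilon> * J) ^ 3" using le by (intro power_mono) auto
    finally show ?thesis by (simp add: power_mult_distrib)
  qed
  have E: "\<bar>E x\<bar> \<le> R * (\<epsilon> ^ 3 * J ^ 3)" if "x \<in> S" for x
    unfolding E_def by (rule rate_sum_bound[OF that]) (use rem[OF that] eps J in auto)
  have gen_f: "gen T f x = f x * (- \<epsilon> * gen T L x + \<epsilon>\<^sup>2 / 2 * quad T L x + E x)" for x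
  proof -
    have "(\<Sum>(r, z)\<leftarrow>xs. r * (f z - f x)) = f x * (- \<epsilon> * (\<Sum>(r, z)\<leftarrow>xs. r * (L z - L x))
        + \<epsilon>\<^sup>2 / 2 * (\<Sum>(r, z)\<leftarrow>xs. r * (L z - L x)\<^sup>2) + (\<Sum>(r, z)\<leftarrow>xs. r * rem x z))" for xs
    proof (induction xs)
      case (Cons a xs)
      obtain r z where a: "a = (r, z)" by force
      have "f z = f x * exp (- (\<epsilon> * (L z - L x)))"
        unfolding f_def mult_exp_exp by (simp add: algebra_simps)
      then have "f z - f x = f x * (- \<epsilon> * (L z - L x) + \<epsilon>\<^sup>2 / 2 * (L z - L x)\<^sup>2 + rem x z)"
        unfolding rem_def power_mult_distrib power2_minus by (simp add: algebra_simps)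
      then have "r * (f z - f x) = r * (f x * (- \<epsilon> * (L z - L x) + \<epsilon>\<^sup>2 / 2 * (L z - L x)\<^sup>2 + rem x z))"
        by (rule arg_cong)
      with Cons show ?case by (simp add: a algebra_simps)
    qed simp
    then show ?thesis unfolding gen_def quad_def E_def .
  qed
  have "mean p (gen T f) = 0"
    by (rule stationary_expectation_gen[OF stat, of _ 1]) (use f01 in auto)
  then have zero: "mean p (\<lambda>x. f x * (- \<epsilon> * gen T L x + \<epsilon>\<^sup>2 / 2 * quad T L x + E x)) = 0"
    by (simp add: gen_f[abs_def])
  have gL: "\<bar>gen T L x\<bar> \<le> R * J" if "x \<in> S" for x
    by (rule gen_bound[OF that]) (use jump[OF that] J in auto)
  have qL: "\<bar>quad T L x\<bar> \<le> R * J\<^sup>2" if "x \<in> S" for x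
    unfolding quad_def
    by (rule rate_sum_bound[OF that]) (use power_mono[OF jump[OF that] abs_ge_zero, of _ _ 2] in auto)
  have int1: "integrable (measure_pmf p) (\<lambda>x. f x * (gen T L x - \<epsilon> / 2 * quad T L x))"
  proof (rule integrable_pmf_bounded)
    fix x assume "x \<in> set_pmf p"
    then have x: "x \<in> S" using supp by auto
    have "\<bar>f x * (gen T L x - \<epsilon> / 2 * quad T L x)\<bar> \<le> 1 * (R * J + \<epsilon> / 2 * (R * J\<^sup>2))"
      unfolding abs_mult
    proof (rule mult_mono)
      have "\<bar>\<epsilon> / 2 * quad T L x\<bar> \<le> \<epsilon> / 2 * (R * J\<^sup>2)"
        unfolding abs_mult using qL[OF x] eps by (intro mult_mono) auto
      then show "\<bar>gen T L x - \<epsilon> / 2 * quad T L x\<bar> \<le> R * J + \<epsilon> / 2 * (R * J\<^sup>2)"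
        using gL[OF x] by linarith
    qed (use f01[OF x] in auto)
    then show "\<bar>f x * (gen T L x - \<epsilon> / 2 * quad T L x)\<bar> \<le> 1 * (R * J + \<epsilon> / 2 * (R * J\<^sup>2))" .
  qed
  have fE: "\<bar>f x * E x\<bar> \<le> R * (\<epsilon> ^ 3 * J ^ 3)" if "x \<in> set_pmf p" for x
  proof -
    have x: "x \<in> S" using supp that by auto
    have "\<bar>f x * E x\<bar> \<le> 1 * (R * (\<epsilon> ^ 3 * J ^ 3))"
      unfolding abs_mult using f01[OF x] E[OF x] by (intro mult_mono) auto
    then show ?thesis by simp
  qed
  have int2: "integrable (measure_pmf p) (\<lambda>x. f x * E x)"
    by (rule integrable_pmf_bounded[OF fE])
  have "mean p (\<lambda>x. f x * E x - \<epsilon> * (f x * (gen T L x - \<epsilon> / 2 * quad T L x))) = 0"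
    using zero by (simp add: algebra_simps power2_eq_square)
  then have "\<epsilon> * mean p (\<lambda>x. f x * (gen T L x - \<epsilon> / 2 * quad T L x))
      = mean p (\<lambda>x. f x * E x)"
    using int1 int2 by simp
  then have "\<epsilon> * \<bar>mean p (\<lambda>x. f x * (gen T L x - \<epsilon> / 2 * quad T L x))\<bar>
      = \<bar>mean p (\<lambda>x. f x * E x)\<bar>" using eps by (metis abs_mult abs_of_pos)
  also have "\<dots> \<le> R * (\<epsilon> ^ 3 * J ^ 3)" by (rule pmf_expectation_bounded[OF fE])
  also have "\<dots> = \<epsilon> * (\<epsilon>\<^sup>2 * (R * J ^ 3))" by (simp add: power3_eq_cube power2_eq_square)
  finally show ?thesis using eps by (simp add: f_def)
qed

text \<open>Product rule: the generator applied to \<open>f * H\<close> is \<open>f\<close> times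
  the generator of \<open>H\<close> plus a term with the increments of the weight \<open>f\<close>,
  and these are at most \<open>\<epsilon> * J\<close>. So the exponentially weighted law is
  invariant up to order \<epsilon>.\<close>

lemma weighted_gen_bound:
  assumes stat: "stationary_law S T p" and L: "\<And>x. x \<in> S \<Longrightarrow> L x \<ge> 0"
    and jump: "\<And>x r z. x \<in> S \<Longrightarrow> (r, z) \<in> set (T x) \<Longrightarrow> \<bar>L z - L x\<bar> \<le> J"
    and H: "\<And>x. x \<in> S \<Longrightarrow> \<bar>H x\<bar> \<le> C"
    and eps: "\<epsilon> \<ge> 0" and J: "J \<ge> 0"
  shows "\<bar>mean p (\<lambda>x. exp (- (\<epsilon> * L x)) * gen T H x)\<bar> \<le> \<epsilon> * (R * J * C)"
proof -
  note supp = stationary_support[OF stat]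
  define f where "f x = exp (- (\<epsilon> * L x))" for x
  have f01: "0 \<le> f x" "f x \<le> 1" if "x \<in> S" for x using L[OF that] eps by (auto simp: f_def)
  have C: "C \<ge> 0" using H supp set_pmf_not_empty[of p] by fastforce
  define E where "E x = (\<Sum>(r, z)\<leftarrow>T x. r * ((f z - f x) * H z))" for x
  have E: "\<bar>E x\<bar> \<le> R * (\<epsilon> * J * C)" if x: "x \<in> S" for x
    unfolding E_def
  proof (rule rate_sum_bound[OF x])
    fix r z assume z: "(r, z) \<in> set (T x)" "z \<in> S"
    have "\<bar>f z - f x\<bar> \<le> \<bar>\<epsilon> * L z - \<epsilon> * L x\<bar>"
      unfolding f_def by (rule exp_minus_lipschitz) (use L x z eps in auto)
    also have "\<dots> = \<epsilon> * \<bar>L z - L x\<bar>" using eps by (simp add: abs_mult flip: right_diff_distrib)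
    also have "\<dots> \<le> \<epsilon> * J" using jump[OF x z(1)] eps by (intro mult_left_mono)
    finally show "\<bar>(f z - f x) * H z\<bar> \<le> \<epsilon> * J * C"
      unfolding abs_mult using H[OF z(2)] eps J by (intro mult_mono) auto
  qed (use eps J C in auto)
  have "(\<Sum>(r, z)\<leftarrow>xs. r * (f z * H z - f x * H x))
      = f x * (\<Sum>(r, z)\<leftarrow>xs. r * (H z - H x)) + (\<Sum>(r, z)\<leftarrow>xs. r * ((f z - f x) * H z))" for xs x
    by (induction xs) (auto simp: algebra_simps)
  then have split: "gen T (\<lambda>x. f x * H x) x = f x * gen T H x + E x" for x
    unfolding gen_def E_def .
  have fH: "\<bar>f x * H x\<bar> \<le> C" if "x \<in> S" for x
    using mult_mono[of "\<bar>f x\<bar>" 1 "\<bar>H x\<bar>" C] f01[OF that] H[OF that] by (auto simp: abs_mult)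
  have "mean p (gen T (\<lambda>x. f x * H x)) = 0"
    by (rule stationary_expectation_gen[OF stat fH])
  then have "mean p (\<lambda>x. f x * gen T H x + E x) = 0"
    by (simp add: split[abs_def])
  moreover have "integrable (measure_pmf p) (\<lambda>x. f x * gen T H x)"
  proof (rule integrable_pmf_bounded)
    fix x assume "x \<in> set_pmf p"
    then have x: "x \<in> S" using supp by auto
    show "\<bar>f x * gen T H x\<bar> \<le> 1 * (R * (2 * C))"
      unfolding abs_mult using f01[OF x] gen_bounded[OF x H] by (intro mult_mono) auto
  qed
  moreover have "integrable (measure_pmf p) E"
    by (rule integrable_pmf_bounded) (use E supp in auto)
  ultimately have "mean p (\<lambda>x. f x * gen T H x) = - mean p E"
    by simp
  moreover have "\<bar>mean p E\<bar> \<le> R * (\<epsilon> * J * C)"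
    by (rule pmf_expectation_bounded) (use E supp in auto)
  ultimately show ?thesis by (simp add: f_def mult_ac)
qed

text \<open>The test function is truncated at level \<open>l\<close> to make it bounded; the truncation only decreases
  the generator.\<close>

lemma exp_moment:
  assumes stat: "stationary_law S T p" and L: "\<And>x. x \<in> S \<Longrightarrow> L x \<ge> 0"
    and jump: "\<And>x r z. x \<in> S \<Longrightarrow> (r, z) \<in> set (T x) \<Longrightarrow> \<bar>L z - L x\<bar> \<le> J" and J: "J \<ge> 0"
    and drift: "\<And>x. x \<in> S \<Longrightarrow> gen T L x \<le> - \<kappa> \<or> L x \<le> D"
    and par: "\<kappa> > 0" "\<theta> > 0" "\<theta> * J \<le> 1" "\<theta> * (R * J\<^sup>2) \<le> \<kappa> / 2"
  shows "mean p (\<lambda>x. exp (\<theta> * L x) * indicator {x. L x \<le> l} x)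
    \<le> exp (\<theta> * D) * (2 * R + \<kappa> * \<theta> / 2) * 2 / (\<kappa> * \<theta>)"
proof -
  note supp = stationary_support[OF stat]
  define f where "f x = min (exp (\<theta> * L x)) (exp (\<theta> * l))" for x
  define A where "A = exp (\<theta> * D) * (2 * R + \<kappa> * \<theta> / 2)"
  define h where "h x = exp (\<theta> * L x) * indicator {x. L x \<le> l} x" for x
  have A: "A \<ge> 0" unfolding A_def using R_nonneg par by (intro mult_nonneg_nonneg) auto
  have zero: "mean p (gen T f) = 0"
    by (rule stationary_expectation_gen[OF stat, of _ "exp (\<theta> * l)"]) (auto simp: f_def)
  have le: "gen T f x \<le> A - \<kappa> * \<theta> / 2 * h x" if x: "x \<in> S" for x
  proof (cases "L x \<le> l")
    case False
    then have "f x = exp (\<theta> * l)" using par by (auto simp: f_def)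
    then have "(\<Sum>(r, z)\<leftarrow>T x. r * (f z - f x)) \<le> R * 0"
      by (intro rate_sum_bound_above[OF x]) (auto simp: f_def)
    then show ?thesis using False A by (simp add: gen_def h_def)
  next
    case True
    define c where "c = exp (\<theta> * L x)"
    have c: "c > 0" by (simp add: c_def)
    have fx: "f x = c" using True par by (auto simp: f_def c_def)
    have "gen T f x \<le> (\<Sum>(r, z)\<leftarrow>T x. r * (c * (exp (\<theta> * (L z - L x)) - 1)))"
      unfolding gen_def
    proof (rule rate_sum_mono[OF x])
      fix z
      have "f z \<le> c * exp (\<theta> * (L z - L x))"
        unfolding f_def c_def mult_exp_exp by (simp add: algebra_simps)
      then show "f z - f x \<le> c * (exp (\<theta> * (L z - L x)) - 1)" by (simp add: fx algebra_simps)
    qed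
    also have "\<dots> = c * (\<Sum>(r, z)\<leftarrow>T x. r * (exp (\<theta> * (L z - L x)) - 1))"
    proof -
      have "(\<Sum>(r, z)\<leftarrow>xs. r * (c * g z)) = c * (\<Sum>(r, z)\<leftarrow>xs. r * g z)" for xs and g :: "'s \<Rightarrow> real"
        by (induction xs) (auto simp: algebra_simps)
      then show ?thesis .
    qed
    finally have g1: "gen T f x \<le> c * (\<Sum>(r, z)\<leftarrow>T x. r * (exp (\<theta> * (L z - L x)) - 1))" .
    have small: "\<bar>\<theta> * (L z - L x)\<bar> \<le> \<theta> * J" if "(r, z) \<in> set (T x)" for r z
      using jump[OF x that] par by (simp add: abs_mult)
    have up: "exp (\<theta> * (L z - L x)) - 1 \<le> \<theta> * (L z - L x) + \<theta>\<^sup>2 * J\<^sup>2" if "(r, z) \<in> set (T x)" for r z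
    proof -
      have "exp (\<theta> * (L z - L x)) - 1 \<le> \<theta> * (L z - L x) + (\<theta> * (L z - L x))\<^sup>2"
        by (rule exp_upper_quadratic) (use small[OF that] par in linarith)
      moreover have "(\<theta> * (L z - L x))\<^sup>2 \<le> (\<theta> * J)\<^sup>2"
        using power_mono[OF small[OF that] abs_ge_zero, of 2] by simp
      ultimately show ?thesis by (simp add: power_mult_distrib)
    qed
    \<comment> \<open>Where the drift is negative, the last condition of \<open>par\<close> lets the
      quadratic term consume at most half of it. On \<open>L x \<le> D\<close> the crude bound
      \<open>exp 1 - 1 \<le> 2\<close> for every jump suffices.\<close>
    have "\<kappa> * \<theta> / 2 * c + c * (\<Sum>(r, z)\<leftarrow>T x. r * (exp (\<theta> * (L z - L x)) - 1)) \<le> A"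
      using drift[OF x]
    proof
      assume dr: "gen T L x \<le> - \<kappa>"
      have "(\<Sum>(r, z)\<leftarrow>T x. r * (exp (\<theta> * (L z - L x)) - 1)) \<le> (\<Sum>(r, z)\<leftarrow>T x. r * (\<theta> * (L z - L x) + \<theta>\<^sup>2 * J\<^sup>2))"
        by (rule rate_sum_mono[OF x up])
      also have "\<dots> = \<theta> * gen T L x + exit_rate T x * (\<theta>\<^sup>2 * J\<^sup>2)"
      proof -
        have "(\<Sum>(r, z)\<leftarrow>xs. r * (\<theta> * (L z - L x) + b)) = \<theta> * (\<Sum>(r, z)\<leftarrow>xs. r * (L z - L x)) + (\<Sum>(r, z)\<leftarrow>xs. r * b)" for xs b
          by (induction xs) (auto simp: algebra_simps)
        then show ?thesis unfolding gen_def rate_sum_const[symmetric] .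
      qed
      also have "\<dots> \<le> \<theta> * - \<kappa> + R * (\<theta>\<^sup>2 * J\<^sup>2)"
        using dr par exit_le[OF x] by (intro add_mono mult_left_mono mult_right_mono) auto
      also have "R * (\<theta>\<^sup>2 * J\<^sup>2) = \<theta> * (\<theta> * (R * J\<^sup>2))" by (simp add: power2_eq_square)
      also have "\<theta> * - \<kappa> + \<dots> \<le> \<theta> * - \<kappa> + \<theta> * (\<kappa> / 2)"
        using par by (intro add_left_mono mult_left_mono) auto
      finally have "(\<Sum>(r, z)\<leftarrow>T x. r * (exp (\<theta> * (L z - L x)) - 1)) \<le> - (\<kappa> * \<theta> / 2)" by (simp add: field_simps)
      then have "c * (\<Sum>(r, z)\<leftarrow>T x. r * (exp (\<theta> * (L z - L x)) - 1)) \<le> c * - (\<kappa> * \<theta> / 2)"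
        using c by (intro mult_left_mono) auto
      then show ?thesis using A by (simp add: algebra_simps)
    next
      assume D: "L x \<le> D"
      have "(\<Sum>(r, z)\<leftarrow>T x. r * (exp (\<theta> * (L z - L x)) - 1)) \<le> R * 2"
      proof (rule rate_sum_bound_above[OF x])
        fix r z assume z: "(r, z) \<in> set (T x)"
        have "exp (\<theta> * (L z - L x)) \<le> exp 1"
          using small[OF z] par by simp
        then show "exp (\<theta> * (L z - L x)) - 1 \<le> 2" using exp_le by linarith
      qed simp
      then have "\<kappa> * \<theta> / 2 * c + c * (\<Sum>(r, z)\<leftarrow>T x. r * (exp (\<theta> * (L z - L x)) - 1)) \<le> \<kappa> * \<theta> / 2 * c + c * (R * 2)"
        using c by (intro add_left_mono mult_left_mono) auto
      also have "\<dots> = c * (2 * R + \<kappa> * \<theta> / 2)" by (simp add: algebra_simps)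
      also have "\<dots> \<le> A" unfolding A_def c_def using D par R_nonneg by (intro mult_right_mono) auto
      finally show ?thesis .
    qed
    with g1 True show ?thesis by (simp add: h_def c_def)
  qed
  have int_h: "integrable (measure_pmf p) h"
    by (rule integrable_pmf_bounded[of _ _ "exp (\<theta> * l)"]) (use par in \<open>auto simp: h_def indicator_def\<close>)
  have "integrable (measure_pmf p) (gen T f)"
    by (rule integrable_pmf_bounded[of _ _ "R * (2 * exp (\<theta> * l))"], rule gen_bounded)
      (use supp in \<open>auto simp: f_def\<close>)
  then have "0 \<le> mean p (\<lambda>x. A - \<kappa> * \<theta> / 2 * h x)"
    unfolding zero[symmetric]
    by (intro pmf_expectation_mono) (use int_h le supp in auto)
  also have "\<dots> = A - \<kappa> * \<theta> / 2 * mean p h" using int_h by simp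
  finally have "mean p h \<le> A * 2 / (\<kappa> * \<theta>)"
    using par by (simp add: field_simps)
  then show ?thesis by (simp add: h_def[abs_def] A_def)
qed

text \<open>Follows from \<open>exp_moment\<close> through \<open>y\<^sup>2 / 2 \<le> exp y\<close>.
  The bound depends on the chain only through \<open>R\<close> and the drift parameters, which makes
  it uniform over a family of chains.\<close>

lemma second_moment:
  assumes stat: "stationary_law S T p" and L: "\<And>x. x \<in> S \<Longrightarrow> L x \<ge> 0"
    and jump: "\<And>x r z. x \<in> S \<Longrightarrow> (r, z) \<in> set (T x) \<Longrightarrow> \<bar>L z - L x\<bar> \<le> J" and J: "J \<ge> 0"
    and drift: "\<And>x. x \<in> S \<Longrightarrow> gen T L x \<le> - \<kappa> \<or> L x \<le> D"
    and par: "\<kappa> > 0" "\<theta> > 0" "\<theta> * J \<le> 1" "\<theta> * (R * J\<^sup>2) \<le> \<kappa> / 2"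
    and n: "\<And>x. x \<in> S \<Longrightarrow> 0 \<le> n x \<and> n x \<le> L x"
  shows "integrable (measure_pmf p) (\<lambda>x. (n x)\<^sup>2)"
    and "mean p (\<lambda>x. (n x)\<^sup>2)
      \<le> 2 / \<theta>\<^sup>2 * (exp (\<theta> * D) * (2 * R + \<kappa> * \<theta> / 2) * 2 / (\<kappa> * \<theta>))"
proof -
  note supp = stationary_support[OF stat]
  define A where "A = exp (\<theta> * D) * (2 * R + \<kappa> * \<theta> / 2) * 2 / (\<kappa> * \<theta>)"
  have A: "A \<ge> 0" unfolding A_def using R_nonneg par by simp
  have bd: "mean p (\<lambda>x. exp (\<theta> * L x) * indicator {x. exp (\<theta> * L x) \<le> N} x) \<le> A" for N
  proof (cases "N > 0")
    case True
    then have "exp (\<theta> * L x) \<le> N \<longleftrightarrow> L x \<le> ln N / \<theta>" for x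
      using par by (simp add: ln_ge_iff[symmetric] field_simps)
    then show ?thesis
      using exp_moment[OF stat L jump J drift par, where l = "ln N / \<theta>"] by (simp add: A_def)
  next
    case False
    then have "exp (\<theta> * L x) > N" for x by (smt (verit) exp_gt_zero)
    then show ?thesis using A by (simp add: not_le[symmetric])
  qed
  have 1: "integrable (measure_pmf p) (\<lambda>x. exp (\<theta> * L x))" "mean p (\<lambda>x. exp (\<theta> * L x)) \<le> A"
    by (rule pmf_integrable_bounded_truncation[OF _ bd]; simp)+
  have le: "(n x)\<^sup>2 \<le> 2 / \<theta>\<^sup>2 * exp (\<theta> * L x)" if "x \<in> set_pmf p" for x
  proof -
    have x: "x \<in> S" using supp that by auto
    have "(n x)\<^sup>2 \<le> (L x)\<^sup>2" using n[OF x] by (intro power_mono) auto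
    moreover have "1 + \<theta> * L x + (\<theta> * L x)\<^sup>2 / 2 \<le> exp (\<theta> * L x)"
      by (rule exp_lower_Taylor_quadratic) (use L[OF x] par in auto)
    moreover have "\<theta> * L x \<ge> 0" using L[OF x] par by auto
    moreover from \<open>(n x)\<^sup>2 \<le> (L x)\<^sup>2\<close> have "\<theta>\<^sup>2 * (n x)\<^sup>2 \<le> (\<theta> * L x)\<^sup>2"
      unfolding power_mult_distrib by (intro mult_left_mono) auto
    ultimately have "\<theta>\<^sup>2 * (n x)\<^sup>2 / 2 \<le> exp (\<theta> * L x)" by linarith
    then show ?thesis using par by (simp add: field_simps)
  qed
  show int: "integrable (measure_pmf p) (\<lambda>x. (n x)\<^sup>2)"
    by (rule Bochner_Integration.integrable_bound[of _ "\<lambda>x. 2 / \<theta>\<^sup>2 * exp (\<theta> * L x)"])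
      (use 1 le in \<open>auto simp: AE_measure_pmf_iff\<close>)
  have "mean p (\<lambda>x. (n x)\<^sup>2) \<le> mean p (\<lambda>x. 2 / \<theta>\<^sup>2 * exp (\<theta> * L x))"
    by (rule pmf_expectation_mono[OF int]) (use 1 le in auto)
  also have "\<dots> = 2 / \<theta>\<^sup>2 * mean p (\<lambda>x. exp (\<theta> * L x))" by simp
  also have "\<dots> \<le> 2 / \<theta>\<^sup>2 * A" using 1 by (intro mult_left_mono) auto
  finally show "mean p (\<lambda>x. (n x)\<^sup>2)
      \<le> 2 / \<theta>\<^sup>2 * (exp (\<theta> * D) * (2 * R + \<kappa> * \<theta> / 2) * 2 / (\<kappa> * \<theta>))" by (simp add: A_def)
qed

end

section \<open>Stability of queue 1\<close>

lemma polling_trans_closed: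
  assumes "x \<in> polling_states k" "(r, z) \<in> set (polling_trans lam mu sig k x)" "\<And>q. k q \<ge> 1"
  shows "z \<in> polling_states k"
proof -
  obtain n a where x: "x = (n, a)" by force
  have k: "0 < k q" for q using assms(3)[of q] by simp
  show ?thesis
  proof (cases a)
    case (Serving q c)
    then show ?thesis using assms x by (cases q) (auto simp: polling_states_def)
  next
    case (Switching q)
    then show ?thesis using assms x k
      by (cases q) (auto simp: polling_states_def on_reaching_def)
  next
    case (Waiting q)
    then show ?thesis using assms x k
      by (cases q) (auto simp: polling_states_def)
  qed
qed

text \<open>All Lyapunov and test functions of the proof are affine in the two queue lengths, up to a
  correction depending on the activity of the server.\<close>

fun affine_fun :: "real \<Rightarrow> real \<Rightarrow> (activity \<Rightarrow> real) \<Rightarrow> polling_state \<Rightarrow> real" where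
  "affine_fun \<alpha> \<beta> g (n, a) = \<alpha> * real (n Q1) + \<beta> * real (n Q2) + g a"

lemma affine_fun_jump:
  assumes x: "x \<in> polling_states k" and z: "(r, z) \<in> set (polling_trans lam mu sig k x)"
    and k: "\<And>q. k q \<ge> 1"
    and g: "\<And>n a. (n, a) \<in> polling_states k \<Longrightarrow> \<bar>g a\<bar> \<le> G"
  shows "\<bar>affine_fun \<alpha> \<beta> g z - affine_fun \<alpha> \<beta> g x\<bar> \<le> \<bar>\<alpha>\<bar> + \<bar>\<beta>\<bar> + 2 * G"
proof -
  obtain n a where x': "x = (n, a)" by force
  obtain m b where z': "z = (m, b)" by force
  have "\<bar>real (m Q1) - real (n Q1)\<bar> \<le> 1 \<and> \<bar>real (m Q2) - real (n Q2)\<bar> \<le> 1"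
  proof (cases a)
    case (Serving q c)
    then show ?thesis using x z unfolding x' z' by (cases q) (auto simp: polling_states_def)
  next
    case (Switching q)
    then show ?thesis using z unfolding x' z' by (cases q) auto
  next
    case (Waiting q)
    then show ?thesis using z unfolding x' z' by (cases q) auto
  qed
  then have "\<bar>\<alpha> * (real (m Q1) - real (n Q1))\<bar> \<le> \<bar>\<alpha>\<bar>" "\<bar>\<beta> * (real (m Q2) - real (n Q2))\<bar> \<le> \<bar>\<beta>\<bar>"
    unfolding abs_mult by (auto intro: mult_left_le)
  moreover have "\<bar>g a\<bar> \<le> G" "\<bar>g b\<bar> \<le> G"
    using g x polling_trans_closed[OF x z k] unfolding x' z' by blast+
  ultimately show ?thesis unfolding x' z' by (simp add: right_diff_distrib)
qed

section \<open>Generator and local variance of affine functions of the queue lengths\<close>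

lemma gen_affine_fun_Serving1:
  assumes "n Q1 > 0"
  shows "gen (polling_trans lam mu sig k) (affine_fun \<alpha> \<beta> g) (n, Serving Q1 c) = lam Q1 * \<alpha> + lam Q2 * \<beta> + mu Q1 *
    (g (if n Q1 = 1 \<or> c + 1 = k Q1 then Switching Q1 else Serving Q1 (c + 1)) - g (Serving Q1 c) - \<alpha>)"
  using assms by (auto simp: gen_def algebra_simps of_nat_diff)

lemma gen_affine_fun_Serving2:
  assumes "n Q2 > 0"
  shows "gen (polling_trans lam mu sig k) (affine_fun \<alpha> \<beta> g) (n, Serving Q2 c) = lam Q1 * \<alpha> + lam Q2 * \<beta> + mu Q2 *
    (g (if n Q2 = 1 \<or> c + 1 = k Q2 then Switching Q2 else Serving Q2 (c + 1)) - g (Serving Q2 c) - \<beta>)"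
  using assms by (auto simp: gen_def algebra_simps of_nat_diff)

lemma gen_affine_fun_Switching:
  "gen (polling_trans lam mu sig k) (affine_fun \<alpha> \<beta> g) (n, Switching q) = lam Q1 * \<alpha> + lam Q2 * \<beta> + sig q *
    (g (on_reaching n (other q)) - g (Switching q))"
  by (simp add: gen_def algebra_simps)

lemma gen_affine_fun_Waiting1:
  "gen (polling_trans lam mu sig k) (affine_fun \<alpha> \<beta> g) (n, Waiting Q1) = lam Q1 * (\<alpha> + g (Serving Q1 0) - g (Waiting Q1))
    + lam Q2 * (\<beta> + g (Switching Q1) - g (Waiting Q1))"
  by (simp add: gen_def algebra_simps)

lemma gen_affine_fun_Waiting2:
  "gen (polling_trans lam mu sig k) (affine_fun \<alpha> \<beta> g) (n, Waiting Q2) = lam Q2 * (\<beta> + g (Serving Q2 0) - g (Waiting Q2))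
    + lam Q1 * (\<alpha> + g (Switching Q2) - g (Waiting Q2))"
  by (simp add: gen_def algebra_simps)

lemma quad_affine_fun_Serving1:
  assumes "n Q1 > 0"
  shows "quad (polling_trans lam mu sig k) (affine_fun \<alpha> \<beta> g) (n, Serving Q1 c) = lam Q1 * \<alpha>\<^sup>2 + lam Q2 * \<beta>\<^sup>2 + mu Q1 *
    (g (if n Q1 = 1 \<or> c + 1 = k Q1 then Switching Q1 else Serving Q1 (c + 1)) - g (Serving Q1 c) - \<alpha>)\<^sup>2"
  using assms by (auto simp: quad_def algebra_simps of_nat_diff)

lemma quad_affine_fun_Serving2:
  assumes "n Q2 > 0"
  shows "quad (polling_trans lam mu sig k) (affine_fun \<alpha> \<beta> g) (n, Serving Q2 c) = lam Q1 * \<alpha>\<^sup>2 + lam Q2 * \<beta>\<^sup>2 + mu Q2 *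
    (g (if n Q2 = 1 \<or> c + 1 = k Q2 then Switching Q2 else Serving Q2 (c + 1)) - g (Serving Q2 c) - \<beta>)\<^sup>2"
  using assms by (auto simp: quad_def algebra_simps of_nat_diff)

lemma quad_affine_fun_Switching:
  "quad (polling_trans lam mu sig k) (affine_fun \<alpha> \<beta> g) (n, Switching q) = lam Q1 * \<alpha>\<^sup>2 + lam Q2 * \<beta>\<^sup>2 + sig q *
    (g (on_reaching n (other q)) - g (Switching q))\<^sup>2"
  by (simp add: quad_def algebra_simps)

abbreviation len :: "queue \<Rightarrow> polling_state \<Rightarrow> real" where
  "len q x \<equiv> real (queue_length q x)"

text \<open>\<open>Q1_stable\<close> rearranges to
  \<open>lam1 * (k Q1 / mu Q1 + k Q2 * B) < k Q1\<close>: a cycle with full visits to both queues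
  brings on average fewer than \<open>k Q1\<close> arrivals to queue 1. It is the load condition at
  \<delta> = 0, kept strict.\<close>

locale polling_limit =
  fixes lam1 :: real and mu sig :: "queue \<Rightarrow> real" and k :: "queue \<Rightarrow> nat"
  assumes lam1_pos: "lam1 > 0" and mu_pos: "\<And>q. mu q > 0" and sig_pos: "\<And>q. sig q > 0"
    and k_ge_1: "\<And>q. k q \<ge> 1"
    and Q1_stable: "lam1 * (real (k Q2) * mean_B2' mu sig k) < real (k Q1) * (1 - lam1 / mu Q1)"
begin

abbreviation "B \<equiv> mean_B2' mu sig k"
abbreviation "ES \<equiv> mean_S sig"
abbreviation "\<rho>\<^sub>1 \<equiv> lam1 / mu Q1"
abbreviation "S \<equiv> polling_states k"
abbreviation "tr \<delta> \<equiv> polling_trans (ht_lam lam1 mu sig k \<delta>) mu sig k"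

definition "lam2 \<delta> = (1 - \<rho>\<^sub>1 - \<delta>) / B"

text \<open>The sum of all rates, with \<open>lam2\<close> replaced by its value at \<delta> = 0, so
  that one bound serves all \<delta>.\<close>

definition "R = lam1 + (1 - \<rho>\<^sub>1) / B + mu Q1 + mu Q2 + sig Q1 + sig Q2"

lemma ES_pos: "ES > 0" unfolding mean_S_def using sig_pos by (simp add: add_pos_pos)

lemma k_pos: "k q > 0" using k_ge_1[of q] by simp

lemma B_pos: "B > 0"
  unfolding mean_B2'_def using ES_pos mu_pos[of Q2] k_pos[of Q2] by (simp add: add_pos_pos)

lemma kB: "real (k Q2) * B = real (k Q2) / mu Q2 + ES"
  unfolding mean_B2'_def using k_pos[of Q2] by (simp add: distrib_left)

lemma rho1_less: "\<rho>\<^sub>1 < 1"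
proof -
  have "0 < lam1 * (real (k Q2) * B)" using lam1_pos k_pos[of Q2] B_pos by simp
  also note Q1_stable
  finally show ?thesis using k_pos[of Q1] by (simp add: zero_less_mult_iff)
qed

lemma ht_lam_simps [simp]:
  "ht_lam lam1 mu sig k \<delta> Q1 = lam1" "ht_lam lam1 mu sig k \<delta> Q2 = lam2 \<delta>"
  by (simp_all add: ht_lam_def lam2_def)

lemma lam2_B: "lam2 \<delta> * B = 1 - \<rho>\<^sub>1 - \<delta>"
  using B_pos by (simp add: lam2_def)

lemma chain:
  assumes \<delta>: "0 < \<delta>" "\<delta> < 1 - \<rho>\<^sub>1"
  shows "bounded_chain S (tr \<delta>) R"
proof
  have l2: "0 < lam2 \<delta>" "lam2 \<delta> \<le> (1 - \<rho>\<^sub>1) / B"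
    using \<delta> B_pos by (auto simp: lam2_def intro!: divide_pos_pos divide_right_mono)
  note pos = lam1_pos mu_pos[of Q1] mu_pos[of Q2] sig_pos[of Q1] sig_pos[of Q2] l2
  show "R \<ge> 0" unfolding R_def using pos by linarith
  fix x assume x: "x \<in> S"
  obtain n a where x': "x = (n, a)" by force
  show "z \<in> S" if "(r, z) \<in> set (tr \<delta> x)" for r z
    by (rule polling_trans_closed[OF x that k_ge_1])
  show "r \<ge> 0" if "(r, z) \<in> set (tr \<delta> x)" for r z
  proof (cases a)
    case (Serving q c)
    then show ?thesis using that pos unfolding x' by (cases q) auto
  next
    case (Switching q)
    then show ?thesis using that pos unfolding x' by (cases q) auto
  next
    case (Waiting q)
    then show ?thesis using that pos unfolding x' by (cases q) auto
  qed
  show "exit_rate (tr \<delta>) x \<le> R"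
  proof (cases a)
    case (Serving q c)
    then show ?thesis using pos unfolding x' R_def exit_rate_def by (cases q) auto
  next
    case (Switching q)
    then show ?thesis using pos unfolding x' R_def exit_rate_def by (cases q) auto
  next
    case (Waiting q)
    then show ?thesis using pos unfolding x' R_def exit_rate_def by (cases q) auto
  qed
qed

text \<open>The potential for which queue 1 has a negative drift, uniformly in the state of queue 2:
  \<open>\<gamma>\<close> is the rate at which a server that is permanently busy with queue 1 and with full vacations
  completes services at queue 1.\<close>

definition "\<gamma> = real (k Q1) / (real (k Q1) / mu Q1 + real (k Q2) * B)"

fun queue1_pot :: "activity \<Rightarrow> real" where
  "queue1_pot (Serving Q1 c) = real c * (1 - \<gamma> / mu Q1)"
| "queue1_pot (Switching Q1) = \<gamma> * (real (k Q2) * B)"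
| "queue1_pot (Serving Q2 c) = \<gamma> * (real (k Q2) * B - 1 / sig Q1 - real c / mu Q2)"
| "queue1_pot (Switching Q2) = \<gamma> / sig Q2"
| "queue1_pot (Waiting q) = 0"

text \<open>The last identity closes the cycle: what \<open>queue1_pot\<close> gains over
  \<open>k Q1\<close> services is what it loses over a full vacation. The first inequality is
  \<open>Q1_stable\<close>.\<close>

lemma gamma: "\<gamma> > lam1" "\<gamma> < mu Q1"
  "real (k Q1) * (1 - \<gamma> / mu Q1) = \<gamma> * (real (k Q2) * B)"
proof -
  note p = k_pos[of Q1] k_pos[of Q2] mu_pos[of Q1] B_pos
  have d: "real (k Q1) / mu Q1 + real (k Q2) * B > 0" using p by (simp add: add_pos_pos)
  have "lam1 * (real (k Q1) / mu Q1 + real (k Q2) * B) < real (k Q1)"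
    using Q1_stable by (simp add: algebra_simps)
  then show "\<gamma> > lam1" unfolding \<gamma>_def using d by (simp add: pos_less_divide_eq)
  have "mu Q1 * (real (k Q1) / mu Q1 + real (k Q2) * B) > real (k Q1)"
    using p by (simp add: distrib_left)
  then show "\<gamma> < mu Q1" unfolding \<gamma>_def using d by (simp add: pos_divide_less_eq)
  have "\<gamma> * (real (k Q1) / mu Q1 + real (k Q2) * B) = real (k Q1)"
    unfolding \<gamma>_def using d by simp
  then show "real (k Q1) * (1 - \<gamma> / mu Q1) = \<gamma> * (real (k Q2) * B)"
    by (simp add: algebra_simps)
qed

lemma queue1_pot_bounds:
  assumes "(n, a) \<in> S"
  shows "0 \<le> queue1_pot a \<and> queue1_pot a \<le> \<gamma> * (real (k Q2) * B)"
proof -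
  note p = k_pos[of Q1] k_pos[of Q2] mu_pos[of Q1] mu_pos[of Q2] B_pos sig_pos[of Q1] sig_pos[of Q2]
  have g: "\<gamma> > 0" using gamma lam1_pos by linarith
  have pos: "0 \<le> \<gamma> * (real (k Q2) * B)" using g p by simp
  have kB': "real (k Q2) * B = real (k Q2) / mu Q2 + 1 / sig Q1 + 1 / sig Q2"
    unfolding kB mean_S_def by simp
  consider c where "a = Serving Q1 c" "c < k Q1" | c where "a = Serving Q2 c" "c < k Q2"
    | "a = Switching Q1" | "a = Switching Q2" | q where "a = Waiting q"
    using assms by (cases a; simp add: polling_states_def) (metis queue.exhaust)+
  then show ?thesis
  proof cases
    case 1
    have "1 - \<gamma> / mu Q1 \<ge> 0" using gamma p by simp
    then show ?thesis using 1 unfolding gamma(3)[symmetric] by (auto intro!: mult_right_mono)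
  next
    case 2
    have "real c / mu Q2 \<le> real (k Q2) / mu Q2" using 2 p by (intro divide_right_mono) auto
    moreover have "0 \<le> real c / mu Q2" "0 < 1 / sig Q1" "0 < 1 / sig Q2" using p by auto
    ultimately have "0 \<le> real (k Q2) * B - 1 / sig Q1 - real c / mu Q2"
      "real (k Q2) * B - 1 / sig Q1 - real c / mu Q2 \<le> real (k Q2) * B" unfolding kB' by linarith+
    then show ?thesis using 2 g by (auto intro!: mult_left_mono)
  next
    case 4
    have "0 \<le> real (k Q2) / mu Q2" "0 < 1 / sig Q1" "0 < 1 / sig Q2" using p by auto
    then have "1 / sig Q2 \<le> real (k Q2) * B" unfolding kB' by linarith
    from mult_left_mono[OF this, of \<gamma>] show ?thesis using 4 g p by simp
  qed (use pos in auto)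
qed

text \<open>Away from queue 1 the potential is \<gamma> times the mean time until the return if all
  \<open>k Q2\<close> services take place; a visit to queue 2 that is skipped or cut short only
  lowers it further. During a visit to queue 1, each service removes a customer and adds
  \<open>1 - \<gamma> / mu Q1\<close>. Two customers guarantee that the current visit does not end
  by emptying queue 1.\<close>

lemma queue1_pot_drift:
  assumes x: "(n, a) \<in> S" and n: "n Q1 \<ge> 2"
  shows "gen (tr \<delta>) (affine_fun 1 0 queue1_pot) (n, a) \<le> - (\<gamma> - lam1)"
proof -
  note p = k_pos[of Q1] k_pos[of Q2] mu_pos[of Q1] mu_pos[of Q2] B_pos sig_pos[of Q1] sig_pos[of Q2]
  have g: "\<gamma> > 0" using gamma lam1_pos by linarith
  have kB': "real (k Q2) * B = real (k Q2) / mu Q2 + 1 / sig Q1 + 1 / sig Q2"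
    unfolding kB mean_S_def by simp
  consider c where "a = Serving Q1 c" "c < k Q1" | c where "a = Serving Q2 c" "c < k Q2" "n Q2 > 0"
    | "a = Switching Q1" | "a = Switching Q2" 
    using x n by (cases a; simp add: polling_states_def) (metis queue.exhaust)+
  then show ?thesis
  proof cases
    case 1
    have "queue1_pot (if n Q1 = 1 \<or> c + 1 = k Q1 then Switching Q1 else Serving Q1 (c + 1))
        = real (c + 1) * (1 - \<gamma> / mu Q1)"
      using n gamma(3) 1(2) by (cases "c + 1 = k Q1") (auto simp del: of_nat_add of_nat_Suc)
    then have "queue1_pot (if n Q1 = 1 \<or> c + 1 = k Q1 then Switching Q1 else Serving Q1 (c + 1))
        - queue1_pot (Serving Q1 c) = 1 - \<gamma> / mu Q1"
      by (simp only: queue1_pot.simps of_nat_add of_nat_1 distrib_right) simp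
    moreover have "n Q1 > 0" using n by simp
    ultimately have "gen (tr \<delta>) (affine_fun 1 0 queue1_pot) (n, a) = lam1 * 1 + lam2 \<delta> * 0 + mu Q1 * ((1 - \<gamma> / mu Q1) - 1)"
      unfolding 1(1) by (simp only: gen_affine_fun_Serving1 ht_lam_simps)
    then show ?thesis using p by simp
  next
    case 2
    have "queue1_pot (if n Q2 = 1 \<or> c + 1 = k Q2 then Switching Q2 else Serving Q2 (c + 1))
        \<le> \<gamma> * (real (k Q2) * B - 1 / sig Q1 - real (c + 1) / mu Q2)"
    proof -
      have "real (c + 1) / mu Q2 \<le> real (k Q2) / mu Q2" using 2 p by (intro divide_right_mono) auto
      then have "1 / sig Q2 \<le> real (k Q2) * B - 1 / sig Q1 - real (c + 1) / mu Q2"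
        unfolding kB' by linarith
      from mult_left_mono[OF this, of \<gamma>] show ?thesis using g by simp
    qed
    then have "queue1_pot (if n Q2 = 1 \<or> c + 1 = k Q2 then Switching Q2 else Serving Q2 (c + 1))
        - queue1_pot (Serving Q2 c) \<le> - (\<gamma> / mu Q2)"
      by (simp add: algebra_simps add_divide_distrib)
    from mult_left_mono[OF this, of "mu Q2"] show ?thesis
      using p 2 unfolding 2(1) by (subst gen_affine_fun_Serving2) (simp_all del: queue1_pot.simps)
  next
    case 3
    have "queue1_pot (on_reaching n Q2) - queue1_pot (Switching Q1) \<le> - (\<gamma> / sig Q1)"
    proof (cases "n Q2 > 0")
      case True
      then show ?thesis by (simp add: on_reaching_def algebra_simps)
    next
      case False
      have "0 \<le> real (k Q2) / mu Q2" using p by simp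
      then have "1 / sig Q2 - real (k Q2) * B \<le> - (1 / sig Q1)" unfolding kB' by linarith
      from mult_left_mono[OF this, of \<gamma>] show ?thesis
        using g False n by (simp add: on_reaching_def algebra_simps)
    qed
    from mult_left_mono[OF this, of "sig Q1"] show ?thesis
      using p unfolding 3 by (subst gen_affine_fun_Switching) (simp del: queue1_pot.simps)
  next
    case 4
    have "sig Q2 * (queue1_pot (on_reaching n Q1) - queue1_pot (Switching Q2)) = - \<gamma>"
      using n p by (simp add: on_reaching_def)
    then show ?thesis
      unfolding 4 by (subst gen_affine_fun_Switching) simp
  qed
qed

text \<open>\<open>C\<close> is uniform because \<gamma>, the jump bound, \<open>R\<close> and the
  drift are all free of \<delta>. With at most one customer in queue 1 the potential is at most
  \<open>1 + G\<close>, which supplies the exceptional level; \<theta> is the largest value that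
  \<open>second_moment\<close> admits.\<close>

lemma second_moment_Q1:
  obtains C where "C > 0"
    and "\<And>\<delta> p. 0 < \<delta> \<Longrightarrow> \<delta> < 1 - \<rho>\<^sub>1 \<Longrightarrow> stationary_law S (tr \<delta>) p \<Longrightarrow>
      integrable (measure_pmf p) (\<lambda>x. (len Q1 x)\<^sup>2) \<and>
      mean p (\<lambda>x. (len Q1 x)\<^sup>2) \<le> C"
proof -
  define G where "G = \<gamma> * (real (k Q2) * B)"
  define J where "J = 1 + 2 * G"
  define \<kappa> where "\<kappa> = \<gamma> - lam1"
  have \<kappa>: "\<kappa> > 0" using gamma by (simp add: \<kappa>_def)
  have G: "G \<ge> 0" unfolding G_def using gamma lam1_pos k_pos[of Q2] B_pos by simp
  have J: "J > 0" using G by (simp add: J_def)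
  have R: "R > 0"
    unfolding R_def using lam1_pos mu_pos[of Q1] mu_pos[of Q2] sig_pos[of Q1] sig_pos[of Q2] B_pos rho1_less
    by (intro add_pos_pos divide_pos_pos) auto
  define \<theta> where "\<theta> = min (1 / J) (\<kappa> / (2 * R * J\<^sup>2))"
  have \<theta>: "\<theta> > 0" using J R \<kappa> by (simp add: \<theta>_def)
  have \<theta>1: "\<theta> * J \<le> 1" using J by (simp add: \<theta>_def min_def field_simps)
  have "\<theta> * (R * J\<^sup>2) \<le> \<kappa> / (2 * R * J\<^sup>2) * (R * J\<^sup>2)"
    using R by (intro mult_right_mono) (auto simp: \<theta>_def)
  also have "\<dots> = \<kappa> / 2" using R J by simp
  finally have \<theta>2: "\<theta> * (R * J\<^sup>2) \<le> \<kappa> / 2" .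
  define A where "A = 2 / \<theta>\<^sup>2 * (exp (\<theta> * (1 + G)) * (2 * R + \<kappa> * \<theta> / 2) * 2 / (\<kappa> * \<theta>))"
  show ?thesis
  proof (rule that[of "\<bar>A\<bar> + 1"], goal_cases)
    case (2 \<delta> p)
    interpret bounded_chain S "tr \<delta>" R by (rule chain[OF 2(1,2)])
    note * = second_moment[OF 2(3), of "affine_fun 1 0 queue1_pot" J \<kappa> "1 + G" \<theta> "\<lambda>x. len Q1 x"]
    have drift: "gen (tr \<delta>) (affine_fun 1 0 queue1_pot) x \<le> - \<kappa> \<or> affine_fun 1 0 queue1_pot x \<le> 1 + G" if "x \<in> S" for x
    proof (cases "queue_length Q1 x \<ge> 2")
      case True
      then show ?thesis using queue1_pot_drift[of "fst x" "snd x"] that by (simp add: queue_length_def \<kappa>_def)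
    next
      case False
      obtain n a where x: "x = (n, a)" by force
      show ?thesis
        using queue1_pot_bounds[of n a] that False by (auto simp: x queue_length_def G_def)
    qed
    have L: "0 \<le> len Q1 x \<and> len Q1 x \<le> affine_fun 1 0 queue1_pot x" if "x \<in> S" for x
      using queue1_pot_bounds[of "fst x" "snd x"] that by (cases x) (simp add: queue_length_def)
    have jump: "\<bar>affine_fun 1 0 queue1_pot z - affine_fun 1 0 queue1_pot x\<bar> \<le> J" if "x \<in> S" "(r, z) \<in> set (tr \<delta> x)" for x r z
      using affine_fun_jump[OF that k_ge_1, of queue1_pot G 1 0] queue1_pot_bounds by (auto simp: J_def G_def)
    have L0: "0 \<le> affine_fun 1 0 queue1_pot x" if "x \<in> S" for x using L[OF that] by linarith
    have "integrable (measure_pmf p) (\<lambda>x. (len Q1 x)\<^sup>2)"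
      "mean p (\<lambda>x. (len Q1 x)\<^sup>2) \<le> A"
      unfolding A_def
      by (rule *[OF L0 jump less_imp_le[OF J] drift \<kappa> \<theta> \<theta>1 \<theta>2 L]; assumption)+
    then show ?case by simp
  qed simp
qed

end

section \<open>The heavy-traffic limit of queue 2\<close>

lemma gen_add_scale: "gen T (\<lambda>x. f x + c * g x) x = gen T f x + c * gen T g x"
proof -
  have "(\<Sum>(r, z)\<leftarrow>xs. r * (f z + c * g z - (f x + c * g x)))
      = (\<Sum>(r, z)\<leftarrow>xs. r * (f z - f x)) + c * (\<Sum>(r, z)\<leftarrow>xs. r * (g z - g x))" for xs
    by (induction xs) (auto simp: algebra_simps)
  then show ?thesis unfolding gen_def .
qed

lemma (in bounded_chain) quad_bound:
  assumes "x \<in> S" "\<And>r z. (r, z) \<in> set (T x) \<Longrightarrow> \<bar>f z - f x\<bar> \<le> J"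
  shows "\<bar>quad T f x\<bar> \<le> R * J\<^sup>2"
  unfolding quad_def
  by (rule rate_sum_bound[OF assms(1)]) (use power_mono[OF assms(2) abs_ge_zero, of _ _ 2] in auto)

lemma (in bounded_chain) quad_perturb:
  assumes x: "x \<in> S" and f: "\<And>r z. (r, z) \<in> set (T x) \<Longrightarrow> \<bar>f z - f x\<bar> \<le> J"
    and g: "\<And>r z. (r, z) \<in> set (T x) \<Longrightarrow> \<bar>g z - g x\<bar> \<le> J'"
    and c: "0 \<le> c" "c \<le> 1" and J: "J \<ge> 0" "J' \<ge> 0"
  shows "\<bar>quad T (\<lambda>x. f x + c * g x) x - quad T f x\<bar> \<le> c * (R * (2 * J * J' + J'\<^sup>2))"
proof -
  have "(\<Sum>(r, z)\<leftarrow>xs. r * (f z + c * g z - (f x + c * g x))\<^sup>2) - (\<Sum>(r, z)\<leftarrow>xs. r * (f z - f x)\<^sup>2)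
      = (\<Sum>(r, z)\<leftarrow>xs. r * (c * (2 * (f z - f x) * (g z - g x) + c * (g z - g x)\<^sup>2)))" for xs
    by (induction xs) (auto simp: algebra_simps power2_eq_square)
  then have "\<bar>quad T (\<lambda>x. f x + c * g x) x - quad T f x\<bar>
      = \<bar>\<Sum>(r, z)\<leftarrow>T x. r * (c * (2 * (f z - f x) * (g z - g x) + c * (g z - g x)\<^sup>2))\<bar>"
    unfolding quad_def by simp
  also have "\<dots> \<le> R * (c * (2 * J * J' + J'\<^sup>2))"
  proof (rule rate_sum_bound[OF x])
    fix r z assume z: "(r, z) \<in> set (T x)"
    have "\<bar>2 * (f z - f x) * (g z - g x)\<bar> \<le> 2 * J * J'"
      unfolding abs_mult using f[OF z] g[OF z] J by (intro mult_mono) auto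
    moreover have "\<bar>c * (g z - g x)\<^sup>2\<bar> \<le> 1 * J'\<^sup>2"
      unfolding abs_mult using power_mono[OF g[OF z] abs_ge_zero, of 2] c by (intro mult_mono) auto
    ultimately have "\<bar>2 * (f z - f x) * (g z - g x) + c * (g z - g x)\<^sup>2\<bar> \<le> 2 * J * J' + J'\<^sup>2"
      by linarith
    then show "\<bar>c * (2 * (f z - f x) * (g z - g x) + c * (g z - g x)\<^sup>2)\<bar> \<le> c * (2 * J * J' + J'\<^sup>2)"
      unfolding abs_mult[of c] using c by (simp add: mult_left_mono)
  qed (use c J in auto)
  finally show ?thesis by (simp add: mult_ac)
qed

section \<open>Work potential, corrector and boundary states\<close>

context polling_limit
begin

text \<open>The server works off the potential \<open>work\<close> below at rate 1: a customer of queue 2 counts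
  \<open>B\<close>, of which only \<open>1 / mu Q2\<close> is service, and \<open>work_corr\<close> keeps the account of the part of
  \<open>ES\<close> that has been charged to served customers but not yet spent on switching. The constant 1
  leaves room for the perturbation by \<open>corrector\<close>.\<close>

fun work_corr :: "activity \<Rightarrow> real" where
  "work_corr (Serving Q1 c) = 1 + 1 / sig Q1"
| "work_corr (Serving Q2 c) = 1 + real c * (ES / real (k Q2))"
| "work_corr (Switching Q1) = 1 + 1 / sig Q1"
| "work_corr (Switching Q2) = 1 + ES"
| "work_corr (Waiting Q1) = 1 + 1 / sig Q1"
| "work_corr (Waiting Q2) = 1"

definition "VB = var_B2' mu sig k"
text \<open>A phase of rate r contributes 1 / r to the local variance of \<open>work\<close>. Over a
  full vacation, the time average of this contribution is \<open>k Q2 * VB\<close> divided by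
  \<open>k Q2 * B\<close>.\<close>

definition "var_ratio = VB / B"
text \<open>Solves \<open>mu Q1 * \<alpha> = var_ratio - 1 / mu Q1\<close>, the Poisson equation
  while queue 1 is served.\<close>

definition "\<alpha> = (var_ratio - 1 / mu Q1) / mu Q1"

text \<open>The coefficients are those of the solution of the Poisson equation stated in \<open>gen_work\<close>.\<close>

fun corrector_pot :: "activity \<Rightarrow> real" where
  "corrector_pot (Serving Q1 c) = 0"
| "corrector_pot (Switching Q1) = 0"
| "corrector_pot (Waiting Q1) = 0"
| "corrector_pot (Serving Q2 c) = 1 / sig Q1 * (1 / sig Q1 - var_ratio) + real c * (1 / mu Q2 * (1 / mu Q2 - var_ratio))"
| "corrector_pot (Waiting Q2) = 1 / sig Q1 * (1 / sig Q1 - var_ratio)"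
| "corrector_pot (Switching Q2) = - (1 / sig Q2 * (1 / sig Q2 - var_ratio))"

text \<open>Outside of these states the activity evolves as if queue 2 were never empty.\<close>

fun irregular :: "polling_state \<Rightarrow> bool" where
  "irregular (n, Serving Q1 c) = False"
| "irregular (n, Serving Q2 c) = (n Q2 = 1 \<and> c + 1 < k Q2)"
| "irregular (n, Switching Q1) = (n Q2 = 0 \<and> n Q1 > 0)"
| "irregular (n, Switching Q2) = False"
| "irregular (n, Waiting q) = True"

abbreviation "work \<equiv> affine_fun (1 / mu Q1) B work_corr"
abbreviation "corrector \<equiv> affine_fun \<alpha> 0 corrector_pot"

text \<open>The averaged local variance. The first two terms come from the arrivals; the bracket
  equals \<open>(1 - \<rho>\<^sub>1) * var_ratio + \<rho>\<^sub>1 / mu Q1\<close>, the contribution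
  of the server when a fraction \<open>\<rho>\<^sub>1\<close> of the time is spent on queue
  1.\<close>

definition "var_rate \<delta> = lam1 / (mu Q1)\<^sup>2 + lam2 \<delta> * B\<^sup>2 + (var_ratio - \<alpha> * lam1)"

text \<open>The least excess drift at an irregular state; the entries belong to a visit to queue 2
  cut short, to queue 2 found empty while queue 1 is not, and to the waiting server.\<close>

definition "\<beta> = min (min (mu Q2 * (ES / real (k Q2))) (sig Q1 * ES)) 1"

lemma beta_pos: "\<beta> > 0"
  unfolding \<beta>_def using mu_pos[of Q2] sig_pos[of Q1] ES_pos k_pos[of Q2] by simp

lemma state_cases:
  assumes "x \<in> S"
  obtains n c where "x = (n, Serving Q1 c)" "n Q1 > 0" "c < k Q1"
  | n c where "x = (n, Serving Q2 c)" "n Q2 > 0" "c < k Q2"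
  | n where "x = (n, Switching Q1)"
  | n where "x = (n, Switching Q2)"
  | n where "x = (n, Waiting Q1)" "n Q1 = 0" "n Q2 = 0"
  | n where "x = (n, Waiting Q2)" "n Q1 = 0" "n Q2 = 0"
proof -
  obtain n a where x: "x = (n, a)" by force
  show ?thesis
  proof (cases a)
    case (Serving q c)
    then show ?thesis using assms that x by (cases q) (auto simp: polling_states_def)
  next
    case (Switching q)
    then show ?thesis using assms that x by (cases q) (auto simp: polling_states_def)
  next
    case (Waiting q)
    then show ?thesis using assms that x by (cases q) (auto simp: polling_states_def)
  qed
qed

lemma B_ES: "B = 1 / mu Q2 + ES / real (k Q2)"
  by (simp add: mean_B2'_def)

text \<open>The increments are the same whether the visit goes on or ends after \<open>k Q2\<close>
  services. For \<open>work_corr\<close>, \<open>k Q2\<close> shares add up to \<open>ES\<close>.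
  For \<open>corrector_pot\<close>, the increments over a full vacation must add up to 0; this
  solvability condition \<open>k Q2 * VB = var_ratio * (k Q2 * B)\<close> is what fixes
  \<open>var_ratio\<close>.\<close>

lemma step_Serving2:
  assumes "n Q2 > 0" "c < k Q2" "\<not> irregular (n, Serving Q2 c)"
  shows "work_corr (if n Q2 = 1 \<or> c + 1 = k Q2 then Switching Q2 else Serving Q2 (c + 1)) - work_corr (Serving Q2 c)
      = ES / real (k Q2)"
    and "corrector_pot (if n Q2 = 1 \<or> c + 1 = k Q2 then Switching Q2 else Serving Q2 (c + 1)) - corrector_pot (Serving Q2 c)
      = 1 / mu Q2 * (1 / mu Q2 - var_ratio)"
proof -
  consider "c + 1 = k Q2" | "n Q2 \<noteq> 1" "c + 1 \<noteq> k Q2" using assms by fastforce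
  note c = this
  have k: "real (k Q2) > 0" using k_pos by simp
  show "work_corr (if n Q2 = 1 \<or> c + 1 = k Q2 then Switching Q2 else Serving Q2 (c + 1)) - work_corr (Serving Q2 c)
      = ES / real (k Q2)"
    using c
  proof cases
    case 1
    then have "real c = real (k Q2) - 1" by linarith
    then have "real c * (ES / real (k Q2)) = (real (k Q2) - 1) * (ES / real (k Q2))" by simp
    also have "\<dots> = ES - ES / real (k Q2)" using k by (simp add: left_diff_distrib diff_divide_distrib)
    finally have "real c * (ES / real (k Q2)) = ES - ES / real (k Q2)" .
    with 1 show ?thesis by simp
  qed (auto simp: distrib_right add_divide_distrib)
  show "corrector_pot (if n Q2 = 1 \<or> c + 1 = k Q2 then Switching Q2 else Serving Q2 (c + 1)) - corrector_pot (Serving Q2 c)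
      = 1 / mu Q2 * (1 / mu Q2 - var_ratio)"
    using c
  proof cases
    case 1
    then have c: "real c = real (k Q2) - 1" by linarith
    have VB: "real (k Q2) * VB = real (k Q2) * (1 / mu Q2)\<^sup>2 + (1 / sig Q1)\<^sup>2 + (1 / sig Q2)\<^sup>2"
      unfolding VB_def var_B2'_def var_S_def using k by (simp add: distrib_left power_divide add_divide_distrib)
    have "var_ratio * B = VB" unfolding var_ratio_def using B_pos by simp
    then have "real (k Q2) * VB = var_ratio * (real (k Q2) * B)" by (simp add: mult_ac)
    also have "\<dots> = var_ratio * (real (k Q2) * (1 / mu Q2) + 1 / sig Q1 + 1 / sig Q2)"
      unfolding kB mean_S_def by simp
    finally have "real (k Q2) * (1 / mu Q2)\<^sup>2 + (1 / sig Q1)\<^sup>2 + (1 / sig Q2)\<^sup>2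
        = var_ratio * (real (k Q2) * (1 / mu Q2) + 1 / sig Q1 + 1 / sig Q2)"
      unfolding VB .
    moreover define a b d where "a = 1 / mu Q2" and "b = 1 / sig Q1" and "d = 1 / sig Q2"
    ultimately have "real (k Q2) * (a * (a - var_ratio)) + b * (b - var_ratio) + d * (d - var_ratio) = 0"
      by (simp add: algebra_simps power2_eq_square)
    then have "- (d * (d - var_ratio)) - (b * (b - var_ratio) + real c * (a * (a - var_ratio))) = a * (a - var_ratio)"
      unfolding c by (simp add: left_diff_distrib)
    with 1 show ?thesis by (simp add: a_def b_def d_def)
  qed (auto simp: distrib_right add_divide_distrib)
qed

text \<open>At a regular state the running phase, of rate r, lowers \<open>work\<close> by exactly 1
  / r when it ends: it contributes -1 to the drift and 1 / r to the local variance. Arrivals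
  contribute \<open>\<rho>\<^sub>1 + lam2 \<delta> * B = 1 - \<delta>\<close> to the drift. The
  second claim is the Poisson equation for the local variance.\<close>

lemma gen_work:
  assumes x: "x \<in> S" "\<not> irregular x"
  shows "gen (tr \<delta>) work x = - \<delta>" (is ?A) and "gen (tr \<delta>) corrector x = quad (tr \<delta>) work x - var_rate \<delta>" (is ?C)
proof -
  note p = mu_pos[of Q1] mu_pos[of Q2] sig_pos[of Q1] sig_pos[of Q2]
  have base: "lam1 * (1 / mu Q1) + lam2 \<delta> * B = 1 - \<delta>" using lam2_B[of \<delta>] by simp
  have al: "mu Q1 * \<alpha> = var_ratio - 1 / mu Q1" unfolding \<alpha>_def using p by simp
  have excess: "ES / real (k Q2) - B = - (1 / mu Q2)" using B_ES by simp
  have "?A \<and> ?C" using x(1)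
  proof (cases rule: state_cases)
    case (1 n c)
    have "work_corr (if n Q1 = 1 \<or> c + 1 = k Q1 then Switching Q1 else Serving Q1 (c + 1)) - work_corr (Serving Q1 c) = 0"
      "corrector_pot (if n Q1 = 1 \<or> c + 1 = k Q1 then Switching Q1 else Serving Q1 (c + 1)) - corrector_pot (Serving Q1 c) = 0"
      by auto
    note * = gen_affine_fun_Serving1[where n = n, OF 1(2)] quad_affine_fun_Serving1[where n = n, OF 1(2)] this ht_lam_simps base
    have 1: "gen (tr \<delta>) work x = 1 - \<delta> + mu Q1 * (0 - 1 / mu Q1)" unfolding 1(1) * ..
    have 2: "gen (tr \<delta>) corrector x = lam1 * \<alpha> + lam2 \<delta> * 0 + mu Q1 * (0 - \<alpha>)" unfolding \<open>x = _\<close> * ..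
    have 3: "quad (tr \<delta>) work x = lam1 * (1 / mu Q1)\<^sup>2 + lam2 \<delta> * B\<^sup>2 + mu Q1 * (0 - 1 / mu Q1)\<^sup>2"
      unfolding \<open>x = _\<close> * ..
    have "mu Q1 * (0 - 1 / mu Q1)\<^sup>2 = 1 / mu Q1" using p by (simp add: power2_eq_square)
    then show ?thesis using p al unfolding 1 2 3 var_rate_def by (simp add: power_divide algebra_simps)
  next
    case (2 n c)
    note st = step_Serving2[OF 2(2,3) x(2)[unfolded 2(1)]]
    note * = gen_affine_fun_Serving2[where n = n, OF 2(2)] quad_affine_fun_Serving2[where n = n, OF 2(2)] st ht_lam_simps base excess
    have 1: "gen (tr \<delta>) work x = 1 - \<delta> + mu Q2 * (- (1 / mu Q2))" unfolding 2(1) * ..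
    have 2: "gen (tr \<delta>) corrector x = lam1 * \<alpha> + lam2 \<delta> * 0 + mu Q2 * (1 / mu Q2 * (1 / mu Q2 - var_ratio) - 0)" unfolding \<open>x = _\<close> * ..
    have 3: "quad (tr \<delta>) work x = lam1 * (1 / mu Q1)\<^sup>2 + lam2 \<delta> * B\<^sup>2 + mu Q2 * (- (1 / mu Q2))\<^sup>2"
      unfolding \<open>x = _\<close> * ..
    have "mu Q2 * (- (1 / mu Q2))\<^sup>2 = 1 / mu Q2" using p by (simp add: power2_eq_square)
    then show ?thesis using p unfolding 1 2 3 var_rate_def by (simp add: power_divide algebra_simps)
  next
    case (3 n)
    have "work_corr (on_reaching n (other Q1)) - work_corr (Switching Q1) = - (1 / sig Q1)"
      "corrector_pot (on_reaching n (other Q1)) - corrector_pot (Switching Q1) = 1 / sig Q1 * (1 / sig Q1 - var_ratio)"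
      using x(2) unfolding 3 by (auto simp: on_reaching_def)
    note * = gen_affine_fun_Switching quad_affine_fun_Switching this ht_lam_simps base
    have 1: "gen (tr \<delta>) work x = 1 - \<delta> + sig Q1 * (- (1 / sig Q1))" unfolding 3 * ..
    have 2: "gen (tr \<delta>) corrector x = lam1 * \<alpha> + lam2 \<delta> * 0 + sig Q1 * (1 / sig Q1 * (1 / sig Q1 - var_ratio))" unfolding \<open>x = _\<close> * ..
    have 3: "quad (tr \<delta>) work x = lam1 * (1 / mu Q1)\<^sup>2 + lam2 \<delta> * B\<^sup>2 + sig Q1 * (- (1 / sig Q1))\<^sup>2"
      unfolding \<open>x = _\<close> * ..
    have "sig Q1 * (- (1 / sig Q1))\<^sup>2 = 1 / sig Q1" using p by (simp add: power2_eq_square)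
    then show ?thesis using p unfolding 1 2 3 var_rate_def by (simp add: power_divide algebra_simps)
  next
    case (4 n)
    have "work_corr (on_reaching n (other Q2)) - work_corr (Switching Q2) = - (1 / sig Q2)"
      "corrector_pot (on_reaching n (other Q2)) - corrector_pot (Switching Q2) = 1 / sig Q2 * (1 / sig Q2 - var_ratio)"
      by (auto simp: on_reaching_def mean_S_def)
    note * = gen_affine_fun_Switching quad_affine_fun_Switching this ht_lam_simps base
    have 1: "gen (tr \<delta>) work x = 1 - \<delta> + sig Q2 * (- (1 / sig Q2))" unfolding 4 * ..
    have 2: "gen (tr \<delta>) corrector x = lam1 * \<alpha> + lam2 \<delta> * 0 + sig Q2 * (1 / sig Q2 * (1 / sig Q2 - var_ratio))" unfolding \<open>x = _\<close> * ..
    have 3: "quad (tr \<delta>) work x = lam1 * (1 / mu Q1)\<^sup>2 + lam2 \<delta> * B\<^sup>2 + sig Q2 * (- (1 / sig Q2))\<^sup>2"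
      unfolding \<open>x = _\<close> * ..
    have "sig Q2 * (- (1 / sig Q2))\<^sup>2 = 1 / sig Q2" using p by (simp add: power2_eq_square)
    then show ?thesis using p unfolding 1 2 3 var_rate_def by (simp add: power_divide algebra_simps)
  qed (use x(2) in auto)
  then show ?A ?C by auto
qed

text \<open>When a visit to queue 2 is cut short or skipped, \<open>work_corr\<close> is reset to
  the full \<open>ES\<close> although fewer than \<open>k Q2\<close> customers have paid their
  share; the missing shares appear as upward drift. A waiting server does no work at all.\<close>

lemma gen_work_irregular:
  assumes x: "x \<in> S" "irregular x"
  shows "gen (tr \<delta>) work x \<ge> \<beta> - \<delta>"
proof -
  note p = lam1_pos mu_pos[of Q1] mu_pos[of Q2] sig_pos[of Q1] sig_pos[of Q2] ES_pos k_pos[of Q2]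
  have base: "lam1 * (1 / mu Q1) + lam2 \<delta> * B = 1 - \<delta>" using lam2_B[of \<delta>] by simp
  show ?thesis using x(1)
  proof (cases rule: state_cases)
    case (2 n c)
    then have n: "n Q2 = 1" "c + 1 < k Q2" using x by auto
    define e where "e = ES / real (k Q2)"
    have e: "e > 0" "ES = real (k Q2) * e" using p by (auto simp: e_def)
    \<comment> \<open>At least two shares are missing: one belongs to the departing customer and is
      covered by \<open>B\<close>, the other one is the excess.\<close>
    have "real c + 2 \<le> real (k Q2)" using n by linarith
    then have "(real c + 2) * e \<le> ES" unfolding e(2) using e by (intro mult_right_mono) auto
    then have "e - 1 / mu Q2 \<le> work_corr (if n Q2 = 1 \<or> c + 1 = k Q2 then Switching Q2 else Serving Q2 (c + 1))
        - work_corr (Serving Q2 c) - B"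
      using n B_ES unfolding work_corr.simps e_def[symmetric] by (auto simp: distrib_right)
    from mult_left_mono[OF this, of "mu Q2"] have "mu Q2 * e - 1 \<le> mu Q2 * (work_corr (if n Q2 = 1 \<or> c + 1 = k Q2 then Switching Q2 else Serving Q2 (c + 1))
        - work_corr (Serving Q2 c) - B)"
      using p by (simp add: right_diff_distrib)
    then have "gen (tr \<delta>) work x \<ge> 1 - \<delta> + (mu Q2 * e - 1)"
      unfolding 2(1) gen_affine_fun_Serving2[where n = n, OF 2(2)] ht_lam_simps base by (rule add_left_mono)
    moreover have "\<beta> \<le> mu Q2 * e" by (simp add: \<beta>_def e_def)
    ultimately show ?thesis by linarith
  next
    case (3 n)
    then have "on_reaching n (other Q1) = Switching Q2" using x(2) by (auto simp: on_reaching_def)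
    then have "gen (tr \<delta>) work x = 1 - \<delta> + sig Q1 * (ES - 1 / sig Q1)"
      unfolding 3 gen_affine_fun_Switching ht_lam_simps base by simp
    also have "\<dots> = sig Q1 * ES - \<delta>" using p by (simp add: right_diff_distrib)
    finally show ?thesis by (simp add: \<beta>_def)
  next
    case (5 n)
    have "gen (tr \<delta>) work x = lam1 * (1 / mu Q1) + lam2 \<delta> * B"
      unfolding 5 gen_affine_fun_Waiting1 ht_lam_simps by simp
    then show ?thesis unfolding base by (simp add: \<beta>_def)
  next
    case (6 n)
    have "gen (tr \<delta>) work x = lam1 * (1 / mu Q1) + lam2 \<delta> * B + lam1 * ES"
      unfolding 6 gen_affine_fun_Waiting2 ht_lam_simps by (simp add: distrib_left)
    moreover have "lam1 * ES > 0" using p by simp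
    ultimately show ?thesis unfolding base by (simp add: \<beta>_def)
  qed (use x in auto)
qed

lemma work_corr_bounds:
  assumes "(n, a) \<in> S"
  shows "1 \<le> work_corr a \<and> work_corr a \<le> 1 + ES"
proof -
  note p = sig_pos[of Q1] sig_pos[of Q2] ES_pos k_pos[of Q2]
  have s: "0 \<le> 1 / sig Q1" "1 / sig Q1 \<le> ES" unfolding mean_S_def using p by auto
  show ?thesis using assms
  proof (cases rule: state_cases)
    case (2 m c)
    have "real c * (ES / real (k Q2)) \<le> real (k Q2) * (ES / real (k Q2))"
      using 2 p by (intro mult_right_mono) auto
    then show ?thesis using 2 p by auto
  qed (use s ES_pos in auto)
qed

definition "Gp = \<bar>1 / sig Q1 * (1 / sig Q1 - var_ratio)\<bar> + real (k Q2) * \<bar>1 / mu Q2 * (1 / mu Q2 - var_ratio)\<bar>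
  + \<bar>1 / sig Q2 * (1 / sig Q2 - var_ratio)\<bar>"

lemma corrector_pot_bounds:
  assumes "(n, a) \<in> S"
  shows "\<bar>corrector_pot a\<bar> \<le> Gp"
proof -
  define a1 a2 a3 where "a1 = 1 / sig Q1 * (1 / sig Q1 - var_ratio)" and "a2 = 1 / mu Q2 * (1 / mu Q2 - var_ratio)"
    and "a3 = 1 / sig Q2 * (1 / sig Q2 - var_ratio)"
  have G: "Gp = \<bar>a1\<bar> + real (k Q2) * \<bar>a2\<bar> + \<bar>a3\<bar>" unfolding Gp_def a1_def a2_def a3_def ..
  have nn: "real (k Q2) * \<bar>a2\<bar> \<ge> 0" by simp
  note ps = corrector_pot.simps[folded a1_def a2_def a3_def]
  show ?thesis using assms
  proof (cases rule: state_cases)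
    case (2 m c)
    have "\<bar>real c * a2\<bar> \<le> real (k Q2) * \<bar>a2\<bar>"
      unfolding abs_mult using 2 by (intro mult_mono) auto
    then have "\<bar>a1 + real c * a2\<bar> \<le> Gp" unfolding G by linarith
    then show ?thesis using 2 ps(4)[of c] by simp
  next
    case 4
    then show ?thesis using nn ps(6) unfolding G by auto
  next
    case 6
    then show ?thesis using nn ps(5) unfolding G by auto
  qed (use nn in \<open>auto simp: G\<close>)
qed

definition "Jw = 1 / mu Q1 + B + 2 * (1 + ES)"
definition "Jp = \<bar>\<alpha>\<bar> + 2 * Gp"

lemma Gp_nonneg: "Gp \<ge> 0" unfolding Gp_def by simp
lemma Jp_nonneg: "Jp \<ge> 0" unfolding Jp_def using Gp_nonneg by simp
lemma Jw_pos: "Jw > 0" unfolding Jw_def using mu_pos[of Q1] B_pos ES_pos by (intro add_pos_pos) auto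

lemma work_jump:
  assumes "x \<in> S" "(r, z) \<in> set (tr \<delta> x)"
  shows "\<bar>work z - work x\<bar> \<le> Jw"
proof -
  have "\<bar>work z - work x\<bar> \<le> \<bar>1 / mu Q1\<bar> + \<bar>B\<bar> + 2 * (1 + ES)"
    by (rule affine_fun_jump[OF assms k_ge_1]) (use work_corr_bounds in fastforce)
  then show ?thesis using mu_pos[of Q1] B_pos by (simp add: Jw_def)
qed

lemma corrector_jump:
  assumes "x \<in> S" "(r, z) \<in> set (tr \<delta> x)"
  shows "\<bar>corrector z - corrector x\<bar> \<le> Jp"
proof -
  have "\<bar>corrector z - corrector x\<bar> \<le> \<bar>\<alpha>\<bar> + \<bar>0\<bar> + 2 * Gp"
    by (rule affine_fun_jump[OF assms k_ge_1]) (use corrector_pot_bounds in fastforce)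
  then show ?thesis by (simp add: Jp_def)
qed

lemma work_ge: "x \<in> S \<Longrightarrow> work x \<ge> 1"
  using work_corr_bounds[of "fst x" "snd x"] mu_pos[of Q1] B_pos by (cases x) (auto intro!: add_increasing)

end

section \<open>Estimates at a fixed value of \<delta>\<close>

context polling_limit
begin

text \<open>Constants free of \<delta>: \<open>Vmax\<close> bounds \<open>var_rate\<close>,
  \<open>Cb\<close> bounds \<open>excess\<close>, \<open>JL\<close> bounds the jumps of
  \<open>pwork\<close>, \<open>K1\<close> and \<open>K2\<close> are the errors of
  \<open>generator_expansion\<close>, and \<open>K3\<close> compares \<open>pwork\<close> with queue
  2.\<close>

definition "Vmax = lam1 / (mu Q1)\<^sup>2 + (1 - \<rho>\<^sub>1) * B + \<bar>var_ratio - \<alpha> * lam1\<bar>"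
definition "Cb = R * Jw + 1"
definition "JL = Jw + Jp"
definition "K1 = R * (2 * Jw * Jp + Jp\<^sup>2) / 4"
definition "K2 = (R * Jp + Vmax + R * JL\<^sup>2) / 2"
definition "K3 = 1 / mu Q1 + \<bar>\<alpha>\<bar> + B + 1 + ES + Gp"

text \<open>The analogue of the local time at a reflecting boundary: it lives on the irregular
  states, and its mean compensates the drift -\<delta>.\<close>

definition excess :: "real \<Rightarrow> polling_state \<Rightarrow> real" where
  "excess \<delta> x = gen (tr \<delta>) work x + \<delta>"

lemma var_rate_bound:
  assumes "0 < \<delta>" "\<delta> < 1 - \<rho>\<^sub>1"
  shows "\<bar>var_rate \<delta>\<bar> \<le> Vmax"
proof -
  have "lam2 \<delta> * B\<^sup>2 = (1 - \<rho>\<^sub>1 - \<delta>) * B" using lam2_B[of \<delta>] by (simp add: power2_eq_square)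
  then have "0 \<le> lam2 \<delta> * B\<^sup>2" "lam2 \<delta> * B\<^sup>2 \<le> (1 - \<rho>\<^sub>1) * B"
    using assms B_pos by (auto intro!: mult_right_mono)
  moreover have "lam1 / (mu Q1)\<^sup>2 \<ge> 0" using lam1_pos by simp
  ultimately show ?thesis unfolding var_rate_def Vmax_def by linarith
qed

context
  fixes \<delta> :: real and p :: "polling_state pmf" and C :: real
  assumes \<delta>: "0 < \<delta>" "\<delta> < 1 - \<rho>\<^sub>1" and stat: "stationary_law S (tr \<delta>) p"
    and n1_int: "integrable (measure_pmf p) (\<lambda>x. (len Q1 x)\<^sup>2)"
    and n1_bound: "mean p (\<lambda>x. (len Q1 x)\<^sup>2) \<le> C"
begin

interpretation bc: bounded_chain S "tr \<delta>" R by (rule chain[OF \<delta>])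

lemma supp: "x \<in> set_pmf p \<Longrightarrow> x \<in> S"
  using bc.stationary_support[OF stat] by auto

lemma gen_work_bound: "x \<in> S \<Longrightarrow> \<bar>gen (tr \<delta>) work x\<bar> \<le> R * Jw"
  by (rule bc.gen_bound) (use work_jump Jw_pos in auto)

lemma quad_work_bound: "x \<in> S \<Longrightarrow> \<bar>quad (tr \<delta>) work x\<bar> \<le> R * Jw\<^sup>2"
  by (rule bc.quad_bound) (use work_jump in auto)

text \<open>Letting the exponent tend to 0 shows that the mean drift of the potential vanishes although
  the potential is not known to be integrable.\<close>

lemma mean_drift: "mean p (gen (tr \<delta>) work) = 0"
proof -
  define e where "e i = inverse (real (Suc i))" for i
  define f where "f i x = exp (- (e i * work x)) * (gen (tr \<delta>) work x - e i / 2 * quad (tr \<delta>) work x)" for i x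
  have e: "e \<longlonglongrightarrow> 0" unfolding e_def by (rule LIMSEQ_inverse_real_of_nat)
  have e01: "0 < e i" "e i \<le> 1" for i by (auto simp: e_def inverse_le_1_iff)
  have "(\<lambda>i. mean p (f i)) \<longlonglongrightarrow> mean p (gen (tr \<delta>) work)"
  proof (rule integral_dominated_convergence[where w = "\<lambda>_. R * Jw + R * Jw\<^sup>2"])
    have "(\<lambda>i. f i x) \<longlonglongrightarrow> exp (- (0 * work x)) * (gen (tr \<delta>) work x - 0 / 2 * quad (tr \<delta>) work x)" for x
      unfolding f_def by (intro tendsto_intros e) auto
    then show "AE x in measure_pmf p. (\<lambda>i. f i x) \<longlonglongrightarrow> gen (tr \<delta>) work x" by simp
    fix i
    show "AE x in measure_pmf p. norm (f i x) \<le> R * Jw + R * Jw\<^sup>2"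
      unfolding AE_measure_pmf_iff
    proof
      fix x assume "x \<in> set_pmf p"
      then have x: "x \<in> S" by (rule supp)
      have "e i * work x \<ge> 0" using work_ge[OF x] e01[of i] by simp
      then have "\<bar>exp (- (e i * work x))\<bar> \<le> 1" by simp
      moreover have "\<bar>gen (tr \<delta>) work x - e i / 2 * quad (tr \<delta>) work x\<bar> \<le> R * Jw + R * Jw\<^sup>2"
      proof -
        have "\<bar>e i / 2 * quad (tr \<delta>) work x\<bar> \<le> 1 * (R * Jw\<^sup>2)"
          unfolding abs_mult using quad_work_bound[OF x] e01[of i] by (intro mult_mono) auto
        then show ?thesis using gen_work_bound[OF x] by linarith
      qed
      ultimately have "\<bar>f i x\<bar> \<le> 1 * (R * Jw + R * Jw\<^sup>2)"
        unfolding f_def abs_mult by (intro mult_mono) auto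
      then show "norm (f i x) \<le> R * Jw + R * Jw\<^sup>2" by simp
    qed
  qed auto
  moreover have "(\<lambda>i. mean p (f i)) \<longlonglongrightarrow> 0"
  proof (rule Lim_null_comparison)
    have "(\<lambda>i. (e i)\<^sup>2 * (R * Jw ^ 3)) \<longlonglongrightarrow> 0\<^sup>2 * (R * Jw ^ 3)" by (intro tendsto_intros e)
    then show "(\<lambda>i. (e i)\<^sup>2 * (R * Jw ^ 3)) \<longlonglongrightarrow> 0" by simp
    have "(\<lambda>i. e i * Jw) \<longlonglongrightarrow> 0 * Jw" by (intro tendsto_intros e)
    then have "\<forall>\<^sub>F i in sequentially. e i * Jw < 1" by (intro order_tendstoD) auto
    then show "\<forall>\<^sub>F i in sequentially. norm (mean p (f i)) \<le> (e i)\<^sup>2 * (R * Jw ^ 3)"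
    proof eventually_elim
      case (elim i)
      have "\<bar>mean p (\<lambda>x. exp (- (e i * work x)) * (gen (tr \<delta>) work x - e i / 2 * quad (tr \<delta>) work x))\<bar>
        \<le> (e i)\<^sup>2 * (R * Jw ^ 3)"
      proof (rule bc.second_order[OF stat _ work_jump])
        show "0 \<le> work x" if "x \<in> S" for x using work_ge[OF that] by linarith
      qed (use e01[of i] elim Jw_pos in auto)
      then show ?case by (simp add: f_def[abs_def])
    qed
  qed
  ultimately show ?thesis by (rule LIMSEQ_unique)
qed

lemma excess_props:
  assumes "x \<in> S"
  shows "0 \<le> excess \<delta> x" "excess \<delta> x \<le> Cb" "\<not> irregular x \<Longrightarrow> excess \<delta> x = 0" "irregular x \<Longrightarrow> excess \<delta> x \<ge> \<beta>"
proof -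
  have 1: "\<not> irregular x \<Longrightarrow> excess \<delta> x = 0" using gen_work(1)[OF assms] by (simp add: excess_def)
  have 2: "irregular x \<Longrightarrow> excess \<delta> x \<ge> \<beta>" using gen_work_irregular[OF assms, of \<delta>] by (simp add: excess_def)
  show "0 \<le> excess \<delta> x" using 1 2 beta_pos by fastforce
  have "\<delta> \<le> 1" using \<delta> lam1_pos mu_pos[of Q1] by (smt (verit) divide_pos_pos)
  then show "excess \<delta> x \<le> Cb" using gen_work_bound[OF assms] unfolding excess_def Cb_def by linarith
  show "\<not> irregular x \<Longrightarrow> excess \<delta> x = 0" "irregular x \<Longrightarrow> excess \<delta> x \<ge> \<beta>" by fact+
qed

lemma excess_int: "integrable (measure_pmf p) (excess \<delta>)"
  by (rule integrable_pmf_bounded[of _ _ Cb]) (use excess_props supp in fastforce)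

lemma excess_mean: "mean p (excess \<delta>) = \<delta>"
proof -
  have "integrable (measure_pmf p) (gen (tr \<delta>) work)"
    by (rule integrable_pmf_bounded[of _ _ "R * Jw"]) (use gen_work_bound supp in auto)
  then show ?thesis unfolding excess_def[abs_def] using mean_drift by simp
qed

text \<open>Markov's inequality for \<open>excess\<close>, which has mean \<delta> and is at least
  \<beta> on these states.\<close>

lemma irregular_prob: "mean p (indicator {x. irregular x}) \<le> \<delta> / \<beta>"
proof -
  have int: "integrable (measure_pmf p) (indicator {x. irregular x} :: _ \<Rightarrow> real)"
    by (rule integrable_pmf_bounded[of _ _ 1]) auto
  have "\<beta> * mean p (indicator {x. irregular x}) = mean p (\<lambda>x. \<beta> * indicator {x. irregular x} x)"
    by simp
  also have "\<dots> \<le> mean p (excess \<delta>)"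
  proof (rule pmf_expectation_mono[OF _ excess_int])
    show "integrable (measure_pmf p) (\<lambda>x. \<beta> * indicator {x. irregular x} x)"
      by (intro integrable_mult_right int)
    show "\<beta> * indicator {x. irregular x} x \<le> excess \<delta> x" if "x \<in> set_pmf p" for x
      using excess_props(1,4)[OF supp[OF that]] by (cases "irregular x") auto
  qed
  finally show ?thesis using excess_mean beta_pos by (simp add: field_simps)
qed

lemma n1_integrable: "integrable (measure_pmf p) (\<lambda>x. len Q1 x)"
proof (rule Bochner_Integration.integrable_bound[where f = "\<lambda>x. 1 + (len Q1 x)\<^sup>2"])
  have "a \<le> 1 + a\<^sup>2" for a :: real
    using sum_squares_bound[of a 1] zero_le_power2[of a] by (simp; linarith)
  then show "AE x in measure_pmf p. norm (len Q1 x) \<le> norm (1 + (len Q1 x)\<^sup>2)"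
    by simp
qed (use n1_int in auto)

lemma n1_mean: "mean p (\<lambda>x. len Q1 x) \<le> 1 + C"
proof -
  have "a \<le> 1 + a\<^sup>2" for a :: real
    using sum_squares_bound[of a 1] zero_le_power2[of a] by (simp; linarith)
  then have "mean p (\<lambda>x. len Q1 x)
    \<le> mean p (\<lambda>x. 1 + (len Q1 x)\<^sup>2)"
    by (intro pmf_expectation_mono n1_integrable) (use n1_int in auto)
  also have "\<dots> = 1 + mean p (\<lambda>x. (len Q1 x)\<^sup>2)"
    using n1_int by simp
  finally show ?thesis using n1_bound by linarith
qed

lemma excess_n1_integrable: "integrable (measure_pmf p) (\<lambda>x. excess \<delta> x * len Q1 x)"
proof (rule Bochner_Integration.integrable_bound[where f = "\<lambda>x. Cb * len Q1 x"])
  show "AE x in measure_pmf p. norm (excess \<delta> x * len Q1 x) \<le> norm (Cb * len Q1 x)"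
    unfolding AE_measure_pmf_iff using excess_props(1,2) supp
    by (fastforce simp: abs_mult intro!: mult_right_mono)
qed (use n1_integrable in auto)

lemma C_nonneg: "C \<ge> 0"
proof -
  have "0 \<le> mean p (\<lambda>x. (len Q1 x)\<^sup>2)"
    by (rule integral_nonneg_AE) simp
  then show ?thesis using n1_bound by linarith
qed

lemma Cb_nonneg: "Cb \<ge> 0"
  unfolding Cb_def using bc.R_nonneg Jw_pos by simp

text \<open>In the boundary term \<open>excess\<close> is weighted by queue 1, and a bound that
  vanishes with \<delta> is needed. Use a \<le> M + a^2 / M, once against the mean \<delta> of
  \<open>excess\<close> and once against the second moment of queue 1; M = 1 / sqrt \<delta>
  balances the two.\<close>

lemma excess_n1: "mean p (\<lambda>x. excess \<delta> x * len Q1 x) \<le> (1 + Cb * C) * sqrt \<delta>"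
proof -
  define M where "M = 1 / sqrt \<delta>"
  have s: "sqrt \<delta> > 0" using \<delta> by simp
  have M: "M > 0" "M * \<delta> = sqrt \<delta>" "1 / M = sqrt \<delta>"
    using s \<delta> by (auto simp: M_def real_div_sqrt)
  have a: "a \<le> M + a\<^sup>2 / M" if "a \<ge> 0" for a :: real
  proof (cases "a \<le> M")
    case True
    then show ?thesis using M by (simp add: add_increasing2)
  next
    case False
    then have "a * M \<le> a * a" using that by (intro mult_left_mono) auto
    then have "a \<le> a\<^sup>2 / M" using M by (simp add: pos_le_divide_eq power2_eq_square)
    then show ?thesis using M by linarith
  qed
  have "mean p (\<lambda>x. excess \<delta> x * len Q1 x)
      \<le> mean p (\<lambda>x. M * excess \<delta> x + Cb / M * (len Q1 x)\<^sup>2)"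
  proof (rule pmf_expectation_mono[OF excess_n1_integrable])
    show "integrable (measure_pmf p) (\<lambda>x. M * excess \<delta> x + Cb / M * (len Q1 x)\<^sup>2)"
      using n1_int excess_int by auto
    fix x assume "x \<in> set_pmf p"
    note b = excess_props(1,2)[OF supp[OF this]]
    have "excess \<delta> x * len Q1 x \<le> excess \<delta> x * (M + (len Q1 x)\<^sup>2 / M)"
      using b a by (intro mult_left_mono) auto
    also have "\<dots> \<le> M * excess \<delta> x + Cb * ((len Q1 x)\<^sup>2 / M)"
      unfolding distrib_left using b M by (intro add_mono mult_right_mono) auto
    finally show "excess \<delta> x * len Q1 x \<le> M * excess \<delta> x + Cb / M * (len Q1 x)\<^sup>2" by simp
  qed
  also have "\<dots> = M * \<delta> + Cb / M * mean p (\<lambda>x. (len Q1 x)\<^sup>2)"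
    using n1_int excess_int excess_mean by simp
  also have "\<dots> \<le> M * \<delta> + Cb / M * C"
    using n1_bound M Cb_nonneg by (intro add_left_mono mult_left_mono) auto
  also have "\<dots> = sqrt \<delta> + Cb * C * (1 / M)" unfolding M(2) by simp
  also have "\<dots> = (1 + Cb * C) * sqrt \<delta>" unfolding M(3) by (simp add: distrib_right)
  finally show ?thesis .
qed

text \<open>The smallness conditions keep every jump of \<open>\<epsilon> * pwork\<close> below 1
  and \<open>pwork\<close> nonnegative: the corrector can neither cancel the coefficient
  \<open>1 / mu Q1\<close> of queue 1 nor the constant 1 in \<open>work_corr\<close>.\<close>

context
  fixes \<epsilon> :: real
  assumes \<epsilon>: "\<epsilon> > 0" "\<epsilon> \<le> 1" "\<epsilon> * JL \<le> 1" "\<epsilon> * Gp \<le> 1" "\<epsilon> * \<bar>\<alpha>\<bar> \<le> 1 / mu Q1"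
begin

text \<open>By the Poisson equation, the generator of the added term turns the fluctuating
  \<open>quad\<close> of \<open>work\<close> in the second-order expansion into the constant
  \<open>var_rate \<delta>\<close>.\<close>

definition "pwork x = work x + \<epsilon> / 2 * corrector x"

lemma pwork_near:
  assumes "x \<in> S"
  shows "\<bar>pwork x - B * len Q2 x\<bar> \<le> K3 * (1 + len Q1 x)"
    and "pwork x \<ge> 0"
    and "irregular x \<Longrightarrow> pwork x \<le> K3 * (1 + len Q1 x)"
proof -
  obtain n a where x: "x = (n, a)" by force
  have c: "1 \<le> work_corr a" "work_corr a \<le> 1 + ES" "\<bar>corrector_pot a\<bar> \<le> Gp" using work_corr_bounds corrector_pot_bounds assms x by blast+
  have L: "pwork x = (1 / mu Q1 + \<epsilon> / 2 * \<alpha>) * real (n Q1) + B * real (n Q2) + (work_corr a + \<epsilon> / 2 * corrector_pot a)"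
    unfolding pwork_def x by (simp add: algebra_simps)
  have e1: "\<bar>\<epsilon> / 2 * \<alpha>\<bar> \<le> \<bar>\<alpha>\<bar>"
    unfolding abs_mult using \<epsilon> by (intro mult_left_le_one_le) auto
  have e2: "\<bar>\<epsilon> / 2 * corrector_pot a\<bar> \<le> Gp"
  proof -
    have "\<bar>\<epsilon> / 2 * corrector_pot a\<bar> \<le> \<bar>corrector_pot a\<bar>" unfolding abs_mult using \<epsilon> by (intro mult_left_le_one_le) auto
    then show ?thesis using c by linarith
  qed
  have e3: "\<bar>\<epsilon> / 2 * \<alpha>\<bar> \<le> 1 / mu Q1"
  proof -
    have "\<bar>\<epsilon> / 2 * \<alpha>\<bar> \<le> \<epsilon> * \<bar>\<alpha>\<bar>" unfolding abs_mult using \<epsilon> by (intro mult_right_mono) auto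
    then show ?thesis using \<epsilon> by linarith
  qed
  have e4: "\<bar>\<epsilon> / 2 * corrector_pot a\<bar> \<le> 1"
  proof -
    have "\<bar>\<epsilon> / 2 * corrector_pot a\<bar> \<le> \<epsilon> * Gp" unfolding abs_mult using \<epsilon> c by (intro mult_mono) auto
    then show ?thesis using \<epsilon> by linarith
  qed
  have m: "1 / mu Q1 > 0" using mu_pos[of Q1] by simp
  have nn: "0 \<le> (1 / mu Q1 + \<epsilon> / 2 * \<alpha>) * real (n Q1)" using e3 by (intro mult_nonneg_nonneg) auto
  have up: "(1 / mu Q1 + \<epsilon> / 2 * \<alpha>) * real (n Q1) \<le> (1 / mu Q1 + \<bar>\<alpha>\<bar>) * real (n Q1)"
    using e1 by (intro mult_right_mono) auto
  have K3: "(1 / mu Q1 + \<bar>\<alpha>\<bar>) * real (n Q1) + (B + 1 + ES + Gp) \<le> K3 * (1 + real (n Q1))"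
  proof -
    define c0 where "c0 = B + 1 + ES + Gp"
    define a0 where "a0 = 1 / mu Q1 + \<bar>\<alpha>\<bar>"
    have "0 \<le> c0" unfolding c0_def using B_pos ES_pos Gp_nonneg by linarith
    then have "0 \<le> c0 * real (n Q1)" by simp
    moreover have "0 \<le> a0" unfolding a0_def using m by linarith
    moreover have "K3 = a0 + c0" by (simp add: K3_def a0_def c0_def)
    ultimately show ?thesis unfolding a0_def[symmetric] c0_def[symmetric] by (simp add: algebra_simps)
  qed
  show "\<bar>pwork x - B * len Q2 x\<bar> \<le> K3 * (1 + len Q1 x)"
    using c nn up K3 e2 e4 B_pos unfolding L by (simp add: x queue_length_def)
  show "pwork x \<ge> 0"
  proof -
    have "0 \<le> work_corr a + \<epsilon> / 2 * corrector_pot a" using c e4 by linarith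
    moreover have "0 \<le> B * real (n Q2)" using B_pos by simp
    ultimately show ?thesis unfolding L using nn by linarith
  qed
  show "pwork x \<le> K3 * (1 + len Q1 x)" if "irregular x"
  proof -
    \<comment> \<open>An irregular state has at most one customer in queue 2, so only queue 1 can
      make \<open>pwork\<close> large there.\<close>
    have "n Q2 \<le> 1" using that assms unfolding x by (cases a rule: activity.exhaust; auto simp: polling_states_def elim: irregular.elims)
    then have "B * real (n Q2) \<le> B * 1" using B_pos by (intro mult_left_mono) auto
    then show ?thesis using c up K3 e2 unfolding L by (simp add: x queue_length_def)
  qed
qed

lemma pwork_jump:
  assumes "x \<in> S" "(r, z) \<in> set (tr \<delta> x)"
  shows "\<bar>pwork z - pwork x\<bar> \<le> JL"
proof -
  have "pwork z - pwork x = (work z - work x) + \<epsilon> / 2 * (corrector z - corrector x)" unfolding pwork_def by (simp add: algebra_simps)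
  moreover have "\<bar>\<epsilon> / 2 * (corrector z - corrector x)\<bar> \<le> \<bar>corrector z - corrector x\<bar>"
    unfolding abs_mult using \<epsilon> by (intro mult_left_le_one_le) auto
  ultimately show ?thesis using work_jump[OF assms] corrector_jump[OF assms] unfolding JL_def by linarith
qed

definition "pweight x = exp (- (\<epsilon> * pwork x))"

lemma pweight01: "x \<in> S \<Longrightarrow> 0 \<le> pweight x \<and> pweight x \<le> 1"
  using pwork_near(2) \<epsilon> by (simp add: pweight_def)

text \<open>At regular states only the effect of the corrector on \<open>quad\<close> remains, which
  is of order \<epsilon> squared. At irregular states the crude error of order \<epsilon> is
  affordable, since these states have mass of order \<delta>.\<close>

lemma generator_expansion:
  assumes x: "x \<in> S"
  shows "\<bar>(gen (tr \<delta>) pwork x - \<epsilon> / 2 * quad (tr \<delta>) pwork x) - (excess \<delta> x - \<delta> - \<epsilon> / 2 * var_rate \<delta>)\<bar>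
    \<le> K1 * \<epsilon>\<^sup>2 + K2 * \<epsilon> * indicator {x. irregular x} x"
proof -
  have g: "gen (tr \<delta>) pwork x = excess \<delta> x - \<delta> + \<epsilon> / 2 * gen (tr \<delta>) corrector x"
    unfolding pwork_def[abs_def] gen_add_scale excess_def by simp
  have K1: "K1 \<ge> 0" unfolding K1_def using bc.R_nonneg Jw_pos Jp_nonneg by simp
  show ?thesis
  proof (cases "irregular x")
    case False
    have "\<bar>quad (tr \<delta>) pwork x - quad (tr \<delta>) work x\<bar> \<le> \<epsilon> / 2 * (R * (2 * Jw * Jp + Jp\<^sup>2))"
      unfolding pwork_def[abs_def]
      by (rule bc.quad_perturb[OF x]) (use work_jump[OF x] corrector_jump[OF x] \<epsilon> Jw_pos Jp_nonneg in auto)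
    then have "\<epsilon> / 2 * \<bar>quad (tr \<delta>) pwork x - quad (tr \<delta>) work x\<bar> \<le> \<epsilon> / 2 * (\<epsilon> / 2 * (R * (2 * Jw * Jp + Jp\<^sup>2)))"
      using \<epsilon> by (intro mult_left_mono) auto
    also have "\<dots> = K1 * \<epsilon>\<^sup>2" by (simp add: K1_def power2_eq_square)
    finally have "\<bar>\<epsilon> / 2 * (quad (tr \<delta>) pwork x - quad (tr \<delta>) work x)\<bar> \<le> K1 * \<epsilon>\<^sup>2"
      unfolding abs_mult using \<epsilon> by simp
    then show ?thesis unfolding g gen_work(2)[OF x False] using False by (simp add: algebra_simps)
  next
    case True
    have "\<bar>gen (tr \<delta>) corrector x\<bar> \<le> R * Jp"
      by (rule bc.gen_bound[OF x]) (use corrector_jump[OF x] Jp_nonneg in auto)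
    moreover have "\<bar>quad (tr \<delta>) pwork x\<bar> \<le> R * JL\<^sup>2"
      by (rule bc.quad_bound[OF x]) (use pwork_jump[OF x] in auto)
    moreover have "2 * K2 = R * Jp + Vmax + R * JL\<^sup>2" by (simp add: K2_def)
    ultimately have "\<bar>gen (tr \<delta>) corrector x + var_rate \<delta> - quad (tr \<delta>) pwork x\<bar> \<le> 2 * K2"
      using var_rate_bound[OF \<delta>] by linarith
    then have "\<epsilon> / 2 * \<bar>gen (tr \<delta>) corrector x + var_rate \<delta> - quad (tr \<delta>) pwork x\<bar> \<le> \<epsilon> / 2 * (2 * K2)"
      using \<epsilon> by (intro mult_left_mono) auto
    then have "\<bar>\<epsilon> / 2 * (gen (tr \<delta>) corrector x + var_rate \<delta> - quad (tr \<delta>) pwork x)\<bar> \<le> K2 * \<epsilon>"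
      unfolding abs_mult using \<epsilon> by simp
    moreover have "K1 * \<epsilon>\<^sup>2 \<ge> 0" using K1 by simp
    ultimately show ?thesis unfolding g using True by (simp add: algebra_simps)
  qed
qed

text \<open>Combines \<open>second_order\<close> for \<open>pwork\<close> with
  \<open>generator_expansion\<close>. For \<epsilon> proportional to \<delta> the errors are of
  order \<delta> squared, one order below the terms that are kept.\<close>

lemma laplace_identity:
  "\<bar>mean p pweight * (\<delta> + \<epsilon> / 2 * var_rate \<delta>) - mean p (\<lambda>x. pweight x * excess \<delta> x)\<bar>
    \<le> \<epsilon>\<^sup>2 * (R * JL ^ 3 + K1) + K2 * \<epsilon> * (\<delta> / \<beta>)"
proof -
  define D where "D x = gen (tr \<delta>) pwork x - \<epsilon> / 2 * quad (tr \<delta>) pwork x" for x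
  have JL: "JL \<ge> 0" unfolding JL_def using Jw_pos Jp_nonneg by simp
  have 1: "\<bar>mean p (\<lambda>x. pweight x * D x)\<bar> \<le> \<epsilon>\<^sup>2 * (R * JL ^ 3)"
    unfolding pweight_def[abs_def] D_def
    by (rule bc.second_order[OF stat pwork_near(2) pwork_jump]) (use \<epsilon> JL in auto)
  have intX: "integrable (measure_pmf p) pweight"
    by (rule integrable_pmf_bounded[of _ _ 1]) (use pweight01 supp in auto)
  have bX: "\<bar>pweight x * excess \<delta> x\<bar> \<le> Cb" if "x \<in> set_pmf p" for x
  proof -
    have "\<bar>pweight x * excess \<delta> x\<bar> \<le> 1 * Cb"
      unfolding abs_mult using pweight01[OF supp[OF that]] excess_props(1,2)[OF supp[OF that]] by (intro mult_mono) auto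
    then show ?thesis by simp
  qed
  have intXb: "integrable (measure_pmf p) (\<lambda>x. pweight x * excess \<delta> x)" by (rule integrable_pmf_bounded[OF bX])
  have K: "0 \<le> K1 * \<epsilon>\<^sup>2" "0 \<le> K2 * \<epsilon>"
    unfolding K1_def K2_def Vmax_def using bc.R_nonneg Jw_pos Jp_nonneg lam1_pos B_pos rho1_less \<epsilon> by auto
  have near: "\<bar>pweight x * D x - pweight x * (excess \<delta> x - \<delta> - \<epsilon> / 2 * var_rate \<delta>)\<bar> \<le> K1 * \<epsilon>\<^sup>2 + K2 * \<epsilon> * indicator {x. irregular x} x"
    if "x \<in> set_pmf p" for x
  proof -
    note x = supp[OF that]
    have "\<bar>pweight x * D x - pweight x * (excess \<delta> x - \<delta> - \<epsilon> / 2 * var_rate \<delta>)\<bar> = pweight x * \<bar>D x - (excess \<delta> x - \<delta> - \<epsilon> / 2 * var_rate \<delta>)\<bar>"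
      using pweight01[OF x] by (simp add: abs_mult flip: right_diff_distrib)
    also have "\<dots> \<le> 1 * (K1 * \<epsilon>\<^sup>2 + K2 * \<epsilon> * indicator {x. irregular x} x)"
      using pweight01[OF x] generator_expansion[OF x] unfolding D_def by (intro mult_mono) auto
    finally show ?thesis by simp
  qed
  define h where "h x = pweight x * D x - pweight x * (excess \<delta> x - \<delta> - \<epsilon> / 2 * var_rate \<delta>)" for x
  have inth: "integrable (measure_pmf p) h"
    by (rule integrable_pmf_bounded[of _ _ "K1 * \<epsilon>\<^sup>2 + K2 * \<epsilon>"], rule order_trans[OF near[folded h_def]])
      (use K in \<open>auto simp: indicator_def\<close>)
  have indint: "integrable (measure_pmf p) (indicator {x. irregular x} :: _ \<Rightarrow> real)"
    by (rule integrable_pmf_bounded[of _ _ 1]) auto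
  have "\<bar>mean p h\<bar> \<le> mean p (\<lambda>x. \<bar>h x\<bar>)" by (rule integral_abs_bound)
  also have "\<dots> \<le> mean p (\<lambda>x. K1 * \<epsilon>\<^sup>2 + K2 * \<epsilon> * indicator {x. irregular x} x)"
    by (rule pmf_expectation_mono[OF integrable_abs[OF inth]])
      (use indint near[folded h_def] in \<open>auto simp: integrable_mult_right simp del: integrable_indicator_iff\<close>)
  also have "\<dots> = K1 * \<epsilon>\<^sup>2 + K2 * \<epsilon> * mean p (indicator {x. irregular x})"
    using indint by simp
  also have "\<dots> \<le> K1 * \<epsilon>\<^sup>2 + K2 * \<epsilon> * (\<delta> / \<beta>)"
    using irregular_prob K by (intro add_left_mono mult_left_mono) auto
  finally have 2: "\<bar>mean p h\<bar> \<le> K1 * \<epsilon>\<^sup>2 + K2 * \<epsilon> * (\<delta> / \<beta>)" .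
  have "mean p (\<lambda>x. pweight x * D x)
      = mean p (\<lambda>x. h x + (pweight x * excess \<delta> x - pweight x * (\<delta> + \<epsilon> / 2 * var_rate \<delta>)))"
    by (rule pmf_expectation_cong) (simp add: h_def algebra_simps)
  also have "\<dots> = mean p h + (mean p (\<lambda>x. pweight x * excess \<delta> x)
      - mean p pweight * (\<delta> + \<epsilon> / 2 * var_rate \<delta>))"
    using inth intX intXb by simp
  finally show ?thesis using 1 2 by (simp add: algebra_simps abs_le_iff)
qed

text \<open>\<open>excess\<close> is supported where \<open>pwork\<close> is at most
  \<open>K3\<close> times one plus the length of queue 1, so the weight is close to 1 there and the
  mean of \<open>excess\<close> is \<delta>.\<close>

lemma boundary_term:
  "\<bar>mean p (\<lambda>x. pweight x * excess \<delta> x) - \<delta>\<bar> \<le> \<epsilon> * K3 * (\<delta> + (1 + Cb * C) * sqrt \<delta>)"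
proof -
  have bX: "\<bar>pweight x * excess \<delta> x\<bar> \<le> Cb" if "x \<in> set_pmf p" for x
  proof -
    have "\<bar>pweight x * excess \<delta> x\<bar> \<le> 1 * Cb"
      unfolding abs_mult using pweight01[OF supp[OF that]] excess_props(1,2)[OF supp[OF that]] by (intro mult_mono) auto
    then show ?thesis by simp
  qed
  have intXb: "integrable (measure_pmf p) (\<lambda>x. pweight x * excess \<delta> x)" by (rule integrable_pmf_bounded[OF bX])
  have K3: "K3 \<ge> 0" unfolding K3_def using mu_pos[of Q1] B_pos ES_pos Gp_nonneg by simp
  have le: "\<bar>pweight x * excess \<delta> x - excess \<delta> x\<bar> \<le> \<epsilon> * K3 * (excess \<delta> x + excess \<delta> x * len Q1 x)"
    if "x \<in> set_pmf p" for x
  proof (cases "irregular x")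
    case False
    then show ?thesis using excess_props(3)[OF supp[OF that]] by simp
  next
    case True
    note x = supp[OF that]
    have "\<bar>pweight x - 1\<bar> = \<bar>exp (- (\<epsilon> * pwork x)) - exp (- 0)\<bar>" by (simp add: pweight_def)
    also have "\<dots> \<le> \<bar>\<epsilon> * pwork x - 0\<bar>" by (rule exp_minus_lipschitz) (use pwork_near(2)[OF x] \<epsilon> in auto)
    also have "\<dots> = \<epsilon> * pwork x" using pwork_near(2)[OF x] \<epsilon> by simp
    also have "\<dots> \<le> \<epsilon> * (K3 * (1 + len Q1 x))"
      using pwork_near(3)[OF x True] \<epsilon> by (intro mult_left_mono) auto
    finally have "\<bar>pweight x - 1\<bar> * excess \<delta> x \<le> \<epsilon> * (K3 * (1 + len Q1 x)) * excess \<delta> x"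
      using excess_props(1)[OF x] by (intro mult_right_mono)
    moreover have "\<bar>pweight x * excess \<delta> x - excess \<delta> x\<bar> = \<bar>pweight x - 1\<bar> * excess \<delta> x"
      using excess_props(1)[OF x] by (metis abs_mult abs_of_nonneg left_diff_distrib mult_1_left)
    ultimately show ?thesis by (simp add: algebra_simps)
  qed
  have eq: "mean p (\<lambda>x. pweight x * excess \<delta> x) - \<delta> = mean p (\<lambda>x. pweight x * excess \<delta> x - excess \<delta> x)"
    using intXb excess_int excess_mean by simp
  have "\<bar>mean p (\<lambda>x. pweight x * excess \<delta> x - excess \<delta> x)\<bar>
      \<le> mean p (\<lambda>x. \<bar>pweight x * excess \<delta> x - excess \<delta> x\<bar>)" by (rule integral_abs_bound)
  also have "\<dots> \<le> mean p (\<lambda>x. \<epsilon> * K3 * (excess \<delta> x + excess \<delta> x * len Q1 x))"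
  proof (rule pmf_expectation_mono)
    show "integrable (measure_pmf p) (\<lambda>x. \<bar>pweight x * excess \<delta> x - excess \<delta> x\<bar>)"
      by (rule integrable_abs[OF Bochner_Integration.integrable_diff[OF intXb excess_int]])
    show "integrable (measure_pmf p) (\<lambda>x. \<epsilon> * K3 * (excess \<delta> x + excess \<delta> x * len Q1 x))"
      by (rule integrable_mult_right[OF Bochner_Integration.integrable_add[OF excess_int excess_n1_integrable]])
  qed (rule le)
  also have "\<dots> = \<epsilon> * K3 * (\<delta> + mean p (\<lambda>x. excess \<delta> x * len Q1 x))"
    unfolding integral_mult_right_zero Bochner_Integration.integral_add[OF excess_int excess_n1_integrable] excess_mean ..
  also have "\<dots> \<le> \<epsilon> * K3 * (\<delta> + (1 + Cb * C) * sqrt \<delta>)"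
    using excess_n1 \<epsilon> K3 by (intro mult_left_mono) auto
  finally show ?thesis unfolding eq .
qed

text \<open>\<open>pwork\<close> and \<open>B\<close> times queue 2 differ by a multiple of one plus
  the length of queue 1, whose mean is bounded.\<close>

lemma replace_pwork:
  "\<bar>mean p pweight - mean p (\<lambda>x. exp (- (\<epsilon> * (B * len Q2 x))))\<bar>
    \<le> \<epsilon> * K3 * (2 + C)"
proof -
  define Y where "Y x = exp (- (\<epsilon> * (B * len Q2 x)))" for x
  have K3: "K3 \<ge> 0" unfolding K3_def using mu_pos[of Q1] B_pos ES_pos Gp_nonneg by simp
  have intX: "integrable (measure_pmf p) pweight"
    by (rule integrable_pmf_bounded[of _ _ 1]) (use pweight01 supp in auto)
  have intY: "integrable (measure_pmf p) Y"
    by (rule integrable_pmf_bounded[of _ _ 1]) (use \<epsilon> B_pos in \<open>auto simp: Y_def\<close>)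
  have le: "\<bar>pweight x - Y x\<bar> \<le> \<epsilon> * K3 * (1 + len Q1 x)" if "x \<in> set_pmf p" for x
  proof -
    note x = supp[OF that]
    have "\<bar>pweight x - Y x\<bar> \<le> \<bar>\<epsilon> * pwork x - \<epsilon> * (B * len Q2 x)\<bar>"
      unfolding pweight_def Y_def by (rule exp_minus_lipschitz) (use pwork_near(2)[OF x] \<epsilon> B_pos in auto)
    also have "\<dots> = \<epsilon> * \<bar>pwork x - B * len Q2 x\<bar>"
      using \<epsilon> by (simp add: abs_mult flip: right_diff_distrib)
    also have "\<dots> \<le> \<epsilon> * (K3 * (1 + len Q1 x))"
      using pwork_near(1)[OF x] \<epsilon> by (intro mult_left_mono) auto
    finally show ?thesis by simp
  qed
  have "mean p pweight - mean p Y = mean p (\<lambda>x. pweight x - Y x)"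
    using intX intY by simp
  also have "\<bar>\<dots>\<bar> \<le> mean p (\<lambda>x. \<bar>pweight x - Y x\<bar>)" by (rule integral_abs_bound)
  also have "\<dots> \<le> mean p (\<lambda>x. \<epsilon> * K3 * (1 + len Q1 x))"
    by (rule pmf_expectation_mono) (use le intX intY n1_integrable in auto)
  also have "\<dots> = \<epsilon> * K3 * (1 + mean p (\<lambda>x. len Q1 x))"
    using n1_integrable by simp
  also have "\<dots> \<le> \<epsilon> * K3 * (2 + C)" using n1_mean \<epsilon> K3 by (intro mult_left_mono) auto
  finally show ?thesis by (simp add: Y_def[abs_def])
qed

end

text \<open>The choice \<epsilon> = t \<delta>, after which everything is divided by \<delta>: the
  left-hand side forces the transform towards the exponential form 1 / (1 + t v / 2), where v is the
  limit of \<open>var_rate\<close>.\<close>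

lemma laplace_estimate:
  assumes t: "t > 0" and \<epsilon>: "t * \<delta> \<le> 1" "t * \<delta> * JL \<le> 1" "t * \<delta> * Gp \<le> 1" "t * \<delta> * \<bar>\<alpha>\<bar> \<le> 1 / mu Q1"
  shows "\<bar>mean p (\<lambda>x. exp (- (t * \<delta> * (B * len Q2 x)))) * (1 + t / 2 * var_rate \<delta>) - 1\<bar>
    \<le> t * \<delta> * K3 * (2 + C) * (1 + t / 2 * Vmax) + t\<^sup>2 * \<delta> * (R * JL ^ 3 + K1) + K2 * t * (\<delta> / \<beta>)
      + t * K3 * (\<delta> + (1 + Cb * C) * sqrt \<delta>)"
proof -
  have pos: "t * \<delta> > 0" using t \<delta> by simp
  define x where "x = mean p (pweight (t * \<delta>))"
  define y where "y = mean p (\<lambda>x. exp (- (t * \<delta> * (B * len Q2 x))))"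
  define b where "b = mean p (\<lambda>x. pweight (t * \<delta>) x * excess \<delta> x)"
  have 1: "\<bar>x * (\<delta> + t * \<delta> / 2 * var_rate \<delta>) - b\<bar> \<le> (t * \<delta>)\<^sup>2 * (R * JL ^ 3 + K1) + K2 * (t * \<delta>) * (\<delta> / \<beta>)"
    unfolding x_def b_def by (rule laplace_identity[OF pos \<epsilon>])
  have 2: "\<bar>b - \<delta>\<bar> \<le> t * \<delta> * K3 * (\<delta> + (1 + Cb * C) * sqrt \<delta>)"
    unfolding b_def by (rule boundary_term[OF pos \<epsilon>])
  have 3: "\<bar>x - y\<bar> \<le> t * \<delta> * K3 * (2 + C)"
    unfolding x_def y_def by (rule replace_pwork[OF pos \<epsilon>])
  have "\<delta> * (x * (1 + t / 2 * var_rate \<delta>) - 1) = (x * (\<delta> + t * \<delta> / 2 * var_rate \<delta>) - b) + (b - \<delta>)"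
    by (simp add: algebra_simps)
  then have "\<delta> * \<bar>x * (1 + t / 2 * var_rate \<delta>) - 1\<bar> = \<bar>(x * (\<delta> + t * \<delta> / 2 * var_rate \<delta>) - b) + (b - \<delta>)\<bar>"
    using \<delta> by (metis abs_mult abs_of_pos)
  also have "\<dots> \<le> (t * \<delta>)\<^sup>2 * (R * JL ^ 3 + K1) + K2 * (t * \<delta>) * (\<delta> / \<beta>) + t * \<delta> * K3 * (\<delta> + (1 + Cb * C) * sqrt \<delta>)"
    using 1 2 by linarith
  also have "\<dots> = \<delta> * (t\<^sup>2 * \<delta> * (R * JL ^ 3 + K1) + K2 * t * (\<delta> / \<beta>) + t * K3 * (\<delta> + (1 + Cb * C) * sqrt \<delta>))"
    by (simp add: algebra_simps power2_eq_square)
  finally have A: "\<bar>x * (1 + t / 2 * var_rate \<delta>) - 1\<bar>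
      \<le> t\<^sup>2 * \<delta> * (R * JL ^ 3 + K1) + K2 * t * (\<delta> / \<beta>) + t * K3 * (\<delta> + (1 + Cb * C) * sqrt \<delta>)"
    using \<delta> by simp
  have K3: "K3 \<ge> 0" unfolding K3_def using mu_pos[of Q1] B_pos ES_pos Gp_nonneg by simp
  have v: "\<bar>1 + t / 2 * var_rate \<delta>\<bar> \<le> 1 + t / 2 * Vmax"
  proof -
    have "\<bar>t / 2 * var_rate \<delta>\<bar> \<le> t / 2 * Vmax"
      unfolding abs_mult using var_rate_bound[OF \<delta>] t by (intro mult_mono) auto
    then show ?thesis by linarith
  qed
  have "\<bar>(y - x) * (1 + t / 2 * var_rate \<delta>)\<bar> \<le> t * \<delta> * K3 * (2 + C) * (1 + t / 2 * Vmax)"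
    unfolding abs_mult using 3 v K3 t \<delta> C_nonneg by (intro mult_mono) (auto simp: abs_minus_commute)
  moreover have "y * (1 + t / 2 * var_rate \<delta>) - 1 = (y - x) * (1 + t / 2 * var_rate \<delta>) + (x * (1 + t / 2 * var_rate \<delta>) - 1)"
    unfolding left_diff_distrib by simp
  ultimately show ?thesis using A unfolding y_def[symmetric] by linarith
qed

end

text \<open>The denominator is \<open>var_rate\<close> at \<delta> = 0. It agrees with that of
  \<open>eta\<close> because \<open>B + var_ratio\<close> is the second moment of B2' divided by
  \<open>B\<close>, while \<open>- \<alpha> * lam1\<close> supplies the second copy of
  \<open>lam1 / (mu Q1)\<^sup>2\<close>.\<close>

lemma eta_var_rate: "eta lam1 mu sig k = 2 * B / (lam1 / (mu Q1)\<^sup>2 + (1 - \<rho>\<^sub>1) * B + (var_ratio - \<alpha> * lam1))" (is "_ = _ / ?v")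
  and var_rate0_pos: "lam1 / (mu Q1)\<^sup>2 + (1 - \<rho>\<^sub>1) * B + (var_ratio - \<alpha> * lam1) > 0"
proof -
  have m: "mu Q1 > 0" by (rule mu_pos)
  have "\<alpha> * lam1 = \<rho>\<^sub>1 * var_ratio - lam1 / (mu Q1)\<^sup>2"
    unfolding \<alpha>_def using m by (simp add: field_simps power2_eq_square)
  then have v: "?v = 2 * (lam1 / (mu Q1)\<^sup>2) + ((1 - \<rho>\<^sub>1) * B + (1 - \<rho>\<^sub>1) * var_ratio)"
    unfolding \<open>\<alpha> * lam1 = _\<close> by (simp add: left_diff_distrib)
  have "1 / B * (1 - \<rho>\<^sub>1) * second_moment_B2' mu sig k = (1 - \<rho>\<^sub>1) * B + (1 - \<rho>\<^sub>1) * var_ratio"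
    unfolding second_moment_B2'_def var_ratio_def VB_def using B_pos by (simp add: field_simps power2_eq_square)
  with v show "eta lam1 mu sig k = 2 * B / ?v" unfolding eta_def by simp
  have "VB > 0" unfolding VB_def var_B2'_def var_S_def using mu_pos[of Q2] sig_pos k_pos[of Q2]
    by (intro add_pos_nonneg) (auto intro!: divide_nonneg_nonneg)
  then have "var_ratio > 0" unfolding var_ratio_def using B_pos by simp
  then show "?v > 0" unfolding v using rho1_less B_pos lam1_pos m
    by (intro add_pos_pos mult_pos_pos) auto
qed

text \<open>\<open>laplace_estimate\<close> weighs queue 2 with \<open>B\<close>, hence
  \<open>t = s / B\<close>; the limit 1 / (1 + s v / (2 B)) is the transform of the exponential law
  with parameter \<eta> = 2 B / v. The case \<open>s = 0\<close> is separate because t must be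
  positive.\<close>

lemma laplace_limit:
  assumes P: "\<forall>\<^sub>F \<delta> in at_right 0. stationary_law S (tr \<delta>) (P \<delta>)" and s: "s \<ge> 0"
  shows "((\<lambda>\<delta>. mean (P \<delta>) (\<lambda>x. exp (- (s * \<delta> * len Q2 x))))
    \<longlongrightarrow> eta lam1 mu sig k / (eta lam1 mu sig k + s)) (at_right 0)"
proof (cases "s = 0")
  case True
  have "eta lam1 mu sig k > 0" unfolding eta_var_rate using var_rate0_pos B_pos by simp
  then show ?thesis using True by simp
next
  case False
  define t where "t = s / B"
  have t: "t > 0" unfolding t_def using s False B_pos by simp
  define v where "v = lam1 / (mu Q1)\<^sup>2 + (1 - \<rho>\<^sub>1) * B + (var_ratio - \<alpha> * lam1)"
  define y where "y \<delta> = mean (P \<delta>) (\<lambda>x. exp (- (s * \<delta> * len Q2 x)))" for \<delta>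
  obtain C where C: "\<And>\<delta> p. 0 < \<delta> \<Longrightarrow> \<delta> < 1 - \<rho>\<^sub>1 \<Longrightarrow> stationary_law S (tr \<delta>) p \<Longrightarrow>
      integrable (measure_pmf p) (\<lambda>x. (len Q1 x)\<^sup>2) \<and>
      mean p (\<lambda>x. (len Q1 x)\<^sup>2) \<le> C"
    using second_moment_Q1 by metis
  define F where "F \<delta> = t * \<delta> * K3 * (2 + C) * (1 + t / 2 * Vmax) + t\<^sup>2 * \<delta> * (R * JL ^ 3 + K1) + K2 * t * (\<delta> / \<beta>)
      + t * K3 * (\<delta> + (1 + Cb * C) * sqrt \<delta>)" for \<delta>
  have id: "((\<lambda>\<delta>::real. \<delta>) \<longlongrightarrow> 0) (at_right 0)" by (rule tendsto_ident_at)
  have "(F \<longlongrightarrow> t * 0 * K3 * (2 + C) * (1 + t / 2 * Vmax) + t\<^sup>2 * 0 * (R * JL ^ 3 + K1) + K2 * t * (0 / \<beta>)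
      + t * K3 * (0 + (1 + Cb * C) * sqrt 0)) (at_right 0)"
    unfolding F_def by (intro tendsto_intros id) (use beta_pos in auto)
  then have F: "(F \<longlongrightarrow> 0) (at_right 0)" by simp
  have small: "\<forall>\<^sub>F \<delta> in at_right 0. t * \<delta> * c \<le> d" if "d > 0" for c d :: real
  proof -
    have "((\<lambda>\<delta>. t * \<delta> * c) \<longlongrightarrow> t * 0 * c) (at_right 0)" by (intro tendsto_intros id)
    then have "\<forall>\<^sub>F \<delta> in at_right 0. t * \<delta> * c < d" using that by (intro order_tendstoD) auto
    then show ?thesis by (rule eventually_mono) simp
  qed
  have dl: "\<forall>\<^sub>F \<delta> in at_right 0. 0 < \<delta> \<and> \<delta> < 1 - \<rho>\<^sub>1"
    unfolding eventually_at_right_field using rho1_less by (intro exI[of _ "1 - \<rho>\<^sub>1"]) auto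
  have m: "1 / mu Q1 > 0" using mu_pos[of Q1] by simp
  have "\<forall>\<^sub>F \<delta> in at_right 0. norm (y \<delta> * (1 + t / 2 * var_rate \<delta>) - 1) \<le> F \<delta>"
    using P dl small[OF zero_less_one, of 1] small[OF zero_less_one, of JL]
      small[OF zero_less_one, of Gp] small[OF m, of "\<bar>\<alpha>\<bar>"]
  proof eventually_elim
    case (elim \<delta>)
    have "mean (P \<delta>) (\<lambda>x. exp (- (t * \<delta> * (B * len Q2 x)))) = y \<delta>"
      unfolding y_def t_def using B_pos by (simp add: mult_ac)
    with laplace_estimate[of \<delta> "P \<delta>" C t] C[of \<delta> "P \<delta>"] elim t mu_pos[of Q1]
    show ?case unfolding F_def real_norm_def by simp
  qed
  then have "((\<lambda>\<delta>. y \<delta> * (1 + t / 2 * var_rate \<delta>) - 1) \<longlongrightarrow> 0) (at_right 0)"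
    by (rule Lim_null_comparison[OF _ F])
  from tendsto_add[OF this tendsto_const[of 1]]
  have 1: "((\<lambda>\<delta>. y \<delta> * (1 + t / 2 * var_rate \<delta>)) \<longlongrightarrow> 1) (at_right 0)" by simp
  have "(var_rate \<longlongrightarrow> lam1 / (mu Q1)\<^sup>2 + (1 - \<rho>\<^sub>1 - 0) / B * B\<^sup>2 + (var_ratio - \<alpha> * lam1)) (at_right 0)"
    unfolding var_rate_def lam2_def by (intro tendsto_intros id) (use B_pos in auto)
  then have "(var_rate \<longlongrightarrow> v) (at_right 0)" using B_pos by (simp add: v_def power2_eq_square)
  then have 2: "((\<lambda>\<delta>. 1 + t / 2 * var_rate \<delta>) \<longlongrightarrow> 1 + t / 2 * v) (at_right 0)" by (intro tendsto_intros)
  have v: "v > 0" unfolding v_def by (rule var_rate0_pos)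
  then have pos: "1 + t / 2 * v > 0" using t by (simp add: add_pos_pos)
  have "((\<lambda>\<delta>. y \<delta> * (1 + t / 2 * var_rate \<delta>) / (1 + t / 2 * var_rate \<delta>)) \<longlongrightarrow> 1 / (1 + t / 2 * v)) (at_right 0)"
    by (rule tendsto_divide[OF 1 2]) (use pos in simp)
  moreover have "\<forall>\<^sub>F \<delta> in at_right 0. y \<delta> * (1 + t / 2 * var_rate \<delta>) / (1 + t / 2 * var_rate \<delta>) = y \<delta>"
    using order_tendstoD(1)[OF 2 pos] by eventually_elim simp
  ultimately have "(y \<longlongrightarrow> 1 / (1 + t / 2 * v)) (at_right 0)"
    by (rule Lim_transform_eventually)
  moreover have "1 / (1 + t / 2 * v) = eta lam1 mu sig k / (eta lam1 mu sig k + s)"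
    unfolding eta_var_rate v_def[symmetric] t_def using v B_pos pos s by (simp add: field_simps)
  ultimately show ?thesis by (simp add: y_def[abs_def])
qed

end

section \<open>Convergence to the vacation queue\<close>

lemma finite_vac_states_le: "finite {x \<in> vac_states k rs. fst x \<le> N}"
proof (rule finite_subset)
  show "{x \<in> vac_states k rs. fst x \<le> N} \<subseteq> {..N} \<times> (VServing ` {..<k} \<union> Vacation ` {..<length rs})"
    by (auto simp: vac_states_def split: vac_activity.splits)
qed auto

lemma trans_rate_nonzero: "trans_rate T x y \<noteq> 0 \<Longrightarrow> \<exists>r. (r, y) \<in> set (T x)"
proof -
  have "(\<Sum>(r, z)\<leftarrow>xs. if z = y then r else 0) \<noteq> 0 \<Longrightarrow> \<exists>r. (r, y) \<in> set xs" for xs :: "(real \<times> 'a) list"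
    by (induction xs) (auto split: if_splits)
  then show "trans_rate T x y \<noteq> 0 \<Longrightarrow> \<exists>r. (r, y) \<in> set (T x)" unfolding trans_rate_def by blast
qed

lemma (in bounded_chain) trans_rate_pos:
  assumes "x \<in> S" "(r, y) \<in> set (T x)" "r > 0"
  shows "trans_rate T x y > 0"
proof -
  have "(\<Sum>(r, z)\<leftarrow>xs. if z = y then r else 0) > 0"
    if "(r, y) \<in> set xs" "\<forall>(r, z)\<in>set xs. r \<ge> 0" for xs :: "(real \<times> 's) list"
    using that
  proof (induction xs)
    case (Cons a xs)
    obtain r' z where a: "a = (r', z)" by force
    have nn: "0 \<le> (\<Sum>(r, z)\<leftarrow>xs. if z = y then r else 0)"
      using Cons.prems(2) by (intro sum_list_nonneg) auto
    show ?case
    proof (cases "a = (r, y)")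
      case True
      then show ?thesis using nn assms(3) by auto
    next
      case False
      then show ?thesis using Cons by (auto simp: a add_nonneg_pos)
    qed
  qed simp
  then show ?thesis unfolding trans_rate_def using assms(2) rate_nonneg[OF assms(1)] by auto
qed

text \<open>Queue length drops by at most one per transition, so every state has finitely many
  predecessors. The balance equations are then finite sums and survive pointwise limits.\<close>

lemma vac_trans_fst:
  assumes "trans_rate (vac_trans lam mu k rs) x y \<noteq> 0"
  shows "fst x \<le> fst y + 1"
proof -
  obtain r where "(r, y) \<in> set (vac_trans lam mu k rs x)" using trans_rate_nonzero[OF assms] by blast
  then show ?thesis by (cases x; cases "snd x") auto
qed

lemma vac_chain:
  fixes rs :: "real list"
  assumes "lam > 0" "mu > 0" "k \<ge> 1" "rs \<noteq> []" "\<And>r. r \<in> set rs \<Longrightarrow> 0 < r \<and> r \<le> M"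
  shows "bounded_chain (vac_states k rs) (vac_trans lam mu k rs) (lam + mu + M)"
proof
  have M: "M > 0" using assms(4) assms(5)[OF hd_in_set] by force
  have rs: "0 < rs ! j \<and> rs ! j \<le> M" if "j < length rs" for j using assms(5) that by simp
  show "lam + mu + M \<ge> 0" using assms M by linarith
  fix x assume x: "x \<in> vac_states k rs"
  show "z \<in> vac_states k rs" if "(r, z) \<in> set (vac_trans lam mu k rs x)" for r z
    using x that assms(3,4) by (cases x; cases "snd x") (auto simp: vac_states_def split: if_splits)
  show "r \<ge> 0" if "(r, z) \<in> set (vac_trans lam mu k rs x)" for r z
    using x that assms(1,2) rs by (cases x; cases "snd x") (fastforce simp: vac_states_def)+
  show "exit_rate (vac_trans lam mu k rs) x \<le> lam + mu + M"
    using x assms(1,2) rs M unfolding exit_rate_def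
    by (cases x; cases "snd x") (fastforce simp: vac_states_def)+
qed

text \<open>Irreducibility in backward form: the empty queue at the start of a vacation can be
  reached from everywhere. Induction on the queue length: a service leads one level down, and the
  phases of a vacation, taken backwards from the last one, lead to a service or, at level 0, to
  \<open>Vacation 0\<close>.\<close>

lemma vac_reach:
  fixes rs :: "real list"
  assumes par: "lam > 0" "mu > 0" "k \<ge> 1" "rs \<noteq> []" "\<And>r. r \<in> set rs \<Longrightarrow> 0 < r \<and> r \<le> M"
    and z0: "(0, Vacation 0) \<in> Z"
    and pred: "\<And>x y. x \<in> vac_states k rs \<Longrightarrow> y \<in> vac_states k rs \<Longrightarrow> y \<in> Z \<Longrightarrow>
      trans_rate (vac_trans lam mu k rs) x y > 0 \<Longrightarrow> x \<in> Z"
  shows "vac_states k rs \<subseteq> Z"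
proof -
  interpret bounded_chain "vac_states k rs" "vac_trans lam mu k rs" "lam + mu + M"
    by (rule vac_chain[OF par])
  have step: "x \<in> Z" if "x \<in> vac_states k rs" "(r, y) \<in> set (vac_trans lam mu k rs x)" "r > 0" "y \<in> Z" for x y r
    using pred[OF that(1) closed[OF that(1,2)] that(4) trans_rate_pos[OF that(1-3)]] .
  have rs: "rs ! j > 0" if "j < length rs" for j using par(5) that by simp
  have vac: "(n, Vacation j) \<in> Z"
    if last: "(n, if n > 0 then VServing 0 else Vacation 0) \<in> Z" and j: "j < length rs" for n j
    using j
  proof (induction "length rs - j" arbitrary: j)
    case (Suc m)
    show ?case
    proof (cases "j + 1 < length rs")
      case True
      have "m = length rs - (j + 1)" using Suc.hyps(2) by linarith
      then have "(n, Vacation (j + 1)) \<in> Z" using True by (rule Suc.hyps(1))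
      have "rs ! j > 0" by (rule rs[OF Suc.prems])
      show ?thesis
      proof (rule step[of _ "rs ! j" "(n, Vacation (j + 1))"])
        show "(n, Vacation j) \<in> vac_states k rs" using Suc.prems by (simp add: vac_states_def)
        show "(rs ! j, n, Vacation (j + 1)) \<in> set (vac_trans lam mu k rs (n, Vacation j))"
          using True by simp
      qed fact+
    next
      case False
      show ?thesis
      proof (rule step[of _ "rs ! j" "(n, if n > 0 then VServing 0 else Vacation 0)"])
        show "(n, Vacation j) \<in> vac_states k rs" using Suc.prems by (simp add: vac_states_def)
        show "(rs ! j, n, if n > 0 then VServing 0 else Vacation 0) \<in> set (vac_trans lam mu k rs (n, Vacation j))"
          using False by simp
        show "rs ! j > 0" by (rule rs[OF Suc.prems])
      qed (rule last)
    qed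
  qed simp
  have "(\<forall>j<length rs. (n, Vacation j) \<in> Z) \<and> (\<forall>c<k. n > 0 \<longrightarrow> (n, VServing c) \<in> Z)" for n
  proof (induction n)
    case 0
    have "(0, if (0::nat) > 0 then VServing 0 else Vacation 0) \<in> Z" using z0 by simp
    then show ?case using vac[of 0] by simp
  next
    case (Suc n)
    have serv: "(Suc n, VServing c) \<in> Z" if "c < k" for c
    proof (rule step[of _ mu "(n, if n = 0 \<or> c + 1 = k then Vacation 0 else VServing (c + 1))"])
      show "(n, if n = 0 \<or> c + 1 = k then Vacation 0 else VServing (c + 1)) \<in> Z"
        using Suc.IH par(4) that by auto
    qed (use that par in \<open>auto simp: vac_states_def\<close>)
    moreover have "(Suc n, if Suc n > 0 then VServing 0 else Vacation 0) \<in> Z" using serv[of 0] par(3) by simp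
    ultimately show ?case using vac[of "Suc n"] by simp
  qed
  note all = this
  show ?thesis
  proof
    fix x assume "x \<in> vac_states k rs"
    then show "x \<in> Z" using all by (cases x; cases "snd x") (auto simp: vac_states_def)
  qed
qed

section \<open>Exchange of the phases of a vacation\<close>

context polling_limit
begin

abbreviation "rs \<equiv> replicate (k Q2) (mu Q2) @ [sig Q1, sig Q2]"
abbreviation "VS \<equiv> vac_states (k Q1) rs"
abbreviation "VT \<equiv> vac_trans lam1 (mu Q1) (k Q1) rs"

definition "RV = lam1 + mu Q1 + (mu Q2 + sig Q1 + sig Q2)"
definition "rate_ratio = mu Q2 / sig Q1"
text \<open>Bounds the total absolute weight \<open>\<bar>1 - rate_ratio\<bar> + rate_ratio\<close>
  used by \<open>swap_phases\<close>.\<close>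

definition "CT = 1 + 2 * rate_ratio"

lemma rs_pos: "r \<in> set rs \<Longrightarrow> 0 < r \<and> r \<le> mu Q2 + sig Q1 + sig Q2"
  using mu_pos[of Q2] sig_pos[of Q1] sig_pos[of Q2] by (auto split: if_splits)

lemma VT_chain: "bounded_chain VS VT RV"
  unfolding RV_def by (rule vac_chain) (use lam1_pos mu_pos k_ge_1 rs_pos in auto)

sublocale vc: bounded_chain VS VT RV by (rule VT_chain)

lemma rs_nth: "j < k Q2 \<Longrightarrow> rs ! j = mu Q2" "rs ! k Q2 = sig Q1" "rs ! Suc (k Q2) = sig Q2"
  by (auto simp: nth_append)

text \<open>In the polling model the vacation of queue 1 is composed of a switch-over time of rate
  \<open>sig Q1\<close> followed by \<open>k Q2\<close> services, in the vacation queue the two parts come in the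
  opposite order. The operator \<open>swap_phases\<close> intertwines the two generators. It interchanges
  two adjacent exponential phases with rates \<open>a\<close> and \<open>b\<close> by mixing their test functions with the
  (possibly negative) weights \<open>1 - b / a\<close> and \<open>b / a\<close>, and leaves functions of the queue length
  alone.\<close>

fun swap_phases :: "(vac_state \<Rightarrow> real) \<Rightarrow> polling_state \<Rightarrow> real" where
  "swap_phases h (n, Serving Q1 c) = h (n Q1, VServing c)"
| "swap_phases h (n, Switching Q1) = h (n Q1, Vacation 0)"
| "swap_phases h (n, Waiting Q1) = h (n Q1, Vacation 0)"
| "swap_phases h (n, Serving Q2 c) = (1 - rate_ratio) * h (n Q1, Vacation c) + rate_ratio * h (n Q1, Vacation (c + 1))"
| "swap_phases h (n, Waiting Q2) = (1 - rate_ratio) * h (n Q1, Vacation 0) + rate_ratio * h (n Q1, Vacation 1)"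
| "swap_phases h (n, Switching Q2) = h (n Q1, Vacation (k Q2 + 1))"

lemma rate_ratio_pos: "rate_ratio > 0" unfolding rate_ratio_def using mu_pos sig_pos by simp

text \<open>The structural facts about \<open>swap_phases\<close> below rest on this form: two
  evaluations at states with the right queue length, with weights of sum 1 that are bounded in
  absolute value.\<close>

lemma swap_phases_rep:
  assumes "x \<in> S"
  obtains a b y z where "\<bar>a\<bar> + \<bar>b\<bar> \<le> CT" "a + b = 1" "y \<in> VS" "z \<in> VS"
    "fst y = queue_length Q1 x" "fst z = queue_length Q1 x" "\<And>h. swap_phases h x = a * h y + b * h z"
proof -
  have C: "1 \<le> CT" "\<bar>1 - rate_ratio\<bar> + \<bar>rate_ratio\<bar> \<le> CT" unfolding CT_def using rate_ratio_pos by auto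
  show ?thesis using assms
  proof (cases rule: state_cases)
    case (1 n c)
    then show ?thesis using C
      by (intro that[of 1 0 "(n Q1, VServing c)" "(n Q1, VServing c)"]) (auto simp: vac_states_def queue_length_def)
  next
    case (2 n c)
    then show ?thesis using C
      by (intro that[of "1 - rate_ratio" rate_ratio "(n Q1, Vacation c)" "(n Q1, Vacation (c + 1))"])
        (auto simp: vac_states_def queue_length_def)
  next
    case (3 n)
    then show ?thesis using C
      by (intro that[of 1 0 "(n Q1, Vacation 0)" "(n Q1, Vacation 0)"]) (auto simp: vac_states_def queue_length_def)
  next
    case (4 n)
    then show ?thesis using C
      by (intro that[of 1 0 "(n Q1, Vacation (k Q2 + 1))" "(n Q1, Vacation (k Q2 + 1))"])
        (auto simp: vac_states_def queue_length_def)
  next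
    case (5 n)
    then show ?thesis using C
      by (intro that[of 1 0 "(n Q1, Vacation 0)" "(n Q1, Vacation 0)"]) (auto simp: vac_states_def queue_length_def)
  next
    case (6 n)
    then show ?thesis using C
      by (intro that[of "1 - rate_ratio" rate_ratio "(n Q1, Vacation 0)" "(n Q1, Vacation 1)"])
        (auto simp: vac_states_def queue_length_def)
  qed
qed

lemma swap_phases_bound:
  assumes "x \<in> S" "\<And>y. y \<in> VS \<Longrightarrow> \<bar>h y\<bar> \<le> c"
  shows "\<bar>swap_phases h x\<bar> \<le> CT * c"
proof -
  obtain a b y z where r: "\<bar>a\<bar> + \<bar>b\<bar> \<le> CT" "y \<in> VS" "z \<in> VS" "\<And>h. swap_phases h x = a * h y + b * h z"
    using swap_phases_rep[OF assms(1)] by metis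
  have c: "c \<ge> 0" using assms(2)[OF r(2)] by linarith
  have "\<bar>swap_phases h x\<bar> \<le> \<bar>a * h y\<bar> + \<bar>b * h z\<bar>" unfolding r(4) by (rule abs_triangle_ineq)
  also have "\<dots> \<le> \<bar>a\<bar> * c + \<bar>b\<bar> * c"
    unfolding abs_mult using assms(2) r(2,3) by (intro add_mono mult_left_mono) auto
  also have "\<dots> \<le> CT * c" using r(1) c by (simp add: mult_right_mono flip: distrib_right)
  finally show ?thesis .
qed

lemma swap_phases_cong:
  assumes "x \<in> S" "\<And>y. y \<in> VS \<Longrightarrow> h y = h' y"
  shows "swap_phases h x = swap_phases h' x"
proof -
  obtain a b y z where r: "y \<in> VS" "z \<in> VS" "\<And>h. swap_phases h x = a * h y + b * h z"
    using swap_phases_rep[OF assms(1)] by metis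
  then show ?thesis using assms(2) by simp
qed

lemma swap_phases_sum:
  assumes "x \<in> S"
  shows "swap_phases (\<lambda>z. \<Sum>y\<in>F. c y * h y z) x = (\<Sum>y\<in>F. c y * swap_phases (h y) x)"
proof -
  obtain a b y z where r: "\<And>h. swap_phases h x = a * h y + b * h z"
    using swap_phases_rep[OF assms(1)] by metis
  show ?thesis unfolding r by (simp add: sum_distrib_left distrib_left sum.distrib mult_ac)
qed

lemma swap_phases_diff:
  assumes "x \<in> S"
  shows "swap_phases (\<lambda>z. f z - g z) x = swap_phases f x - swap_phases g x"
proof -
  obtain a b y z where r: "\<And>h. swap_phases h x = a * h y + b * h z"
    using swap_phases_rep[OF assms(1)] by metis
  show ?thesis unfolding r by (simp add: algebra_simps)
qed

lemma swap_phases_fst: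
  assumes "x \<in> S"
  shows "swap_phases (\<lambda>z. u (fst z)) x = u (queue_length Q1 x)"
proof -
  obtain a b y z where r: "a + b = 1" "fst y = queue_length Q1 x" "fst z = queue_length Q1 x"
    "\<And>h. swap_phases h x = a * h y + b * h z"
    using swap_phases_rep[OF assms(1)] by metis
  show ?thesis unfolding r(2-4) using r(1) by (simp flip: distrib_right)
qed

text \<open>The total variation of the signed measure to which the dual of
  \<open>swap_phases\<close> sends the point mass at \<open>x\<close>.\<close>

lemma swap_phases_indicator_sum:
  assumes "x \<in> S" "finite F"
  shows "(\<Sum>y\<in>F. \<bar>swap_phases (indicator {y}) x\<bar>) \<le> CT"
proof -
  obtain a b y z where r: "\<bar>a\<bar> + \<bar>b\<bar> \<le> CT" "\<And>h. swap_phases h x = a * h y + b * h z"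
    using swap_phases_rep[OF assms(1)] by metis
  have one: "(\<Sum>y'\<in>F. indicator {y'} w) \<le> (1::real)" for w
  proof -
    have "(\<Sum>y'\<in>F. indicator {y'} w) = (\<Sum>y'\<in>F. if y' = w then 1 else (0::real))"
      by (rule sum.cong) (auto simp: indicator_def)
    also have "\<dots> \<le> 1" using assms(2) by simp
    finally show ?thesis .
  qed
  have "(\<Sum>y'\<in>F. \<bar>swap_phases (indicator {y'}) x\<bar>) \<le> (\<Sum>y'\<in>F. \<bar>a\<bar> * indicator {y'} y + \<bar>b\<bar> * indicator {y'} z)"
    unfolding r(2) by (rule sum_mono) (auto simp: abs_mult intro!: order_trans[OF abs_triangle_ineq])
  also have "\<dots> = \<bar>a\<bar> * (\<Sum>y'\<in>F. indicator {y'} y) + \<bar>b\<bar> * (\<Sum>y'\<in>F. indicator {y'} z)"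
    by (simp add: sum.distrib sum_distrib_left)
  also have "\<dots> \<le> \<bar>a\<bar> * 1 + \<bar>b\<bar> * 1" by (intro add_mono mult_left_mono one) auto
  finally show ?thesis using r(1) by linarith
qed

text \<open>Only two activities test the weights, the switch to queue 2 and the last of
  \<open>k Q2\<close> services; both reduce to \<open>rate_ratio * sig Q1 = mu Q2\<close>. At
  irregular states the identity may fail, because the server does not run through all the phases of
  a full vacation.\<close>

lemma swap_phases_intertwines:
  assumes x: "x \<in> S" "\<not> irregular x"
  shows "gen (tr \<delta>) (swap_phases h) x = swap_phases (gen VT h) x"
proof -
  have qs: "rate_ratio * sig Q1 = mu Q2" unfolding rate_ratio_def using sig_pos[of Q1] by simp
  show ?thesis using x(1)
  proof (cases rule: state_cases)
    case (1 n c)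
    then show ?thesis by (auto simp: gen_def)
  next
    case (2 n c)
    show ?thesis
    proof (cases "c + 1 = k Q2")
      case True
      then have kc: "k Q2 = Suc c" by simp
      have r: "rs ! c = mu Q2" "rs ! Suc c = sig Q1" using rs_nth kc by auto
      have "gen (tr \<delta>) (swap_phases h) x - swap_phases (gen VT h) x = (rate_ratio * sig Q1 - mu Q2) * (h (n Q1, Vacation (Suc c)) - h (n Q1, Vacation (Suc (Suc c))))"
        using r True unfolding 2(1) by (simp add: gen_def kc) (simp add: algebra_simps)
      then show ?thesis unfolding qs by simp
    next
      case False
      then have n: "n Q2 > 1" "c + 1 < k Q2" using 2 x(2) by auto
      have r: "rs ! c = mu Q2" "rs ! Suc c = mu Q2" using rs_nth n by auto
      show ?thesis using r n unfolding 2(1) by (simp add: gen_def) (simp add: algebra_simps)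
    qed
  next
    case (3 n)
    have r: "rs ! 0 = mu Q2" using rs_nth(1)[of 0] k_pos[of Q2] by blast
    have "swap_phases h (n, on_reaching n Q2) = (1 - rate_ratio) * h (n Q1, Vacation 0) + rate_ratio * h (n Q1, Vacation 1)"
      using x(2) 3 by (auto simp: on_reaching_def)
    then have "gen (tr \<delta>) (swap_phases h) x - swap_phases (gen VT h) x = (rate_ratio * sig Q1 - mu Q2) * (h (n Q1, Vacation 1) - h (n Q1, Vacation 0))"
      using r unfolding 3 by (simp add: gen_def) (simp add: algebra_simps)
    then show ?thesis unfolding qs by simp
  next
    case (4 n)
    have "swap_phases h (n, on_reaching n Q1) = h (n Q1, if n Q1 > 0 then VServing 0 else Vacation 0)"
      by (auto simp: on_reaching_def)
    then show ?thesis using rs_nth(3) unfolding 4 by (simp add: gen_def)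
  qed (use x(2) in auto)
qed

end

lemma trans_rate_eq: "trans_rate T x y = (\<Sum>(r, z)\<leftarrow>T x. r * indicator {y} z)"
proof -
  have "(\<Sum>(r, z)\<leftarrow>xs. if z = y then r else 0) = (\<Sum>(r, z)\<leftarrow>xs. r * indicator {y} z)" for xs :: "(real \<times> 'a) list"
    by (induction xs) (auto simp: indicator_def)
  then show ?thesis unfolding trans_rate_def .
qed

section \<open>Exponentially weighted laws and their approximate balance equations\<close>

context polling_limit
begin

definition weight :: "real \<Rightarrow> real \<Rightarrow> polling_state \<Rightarrow> real" where
  "weight s \<delta> x = exp (- (s * \<delta> * len Q2 x))"

definition preds :: "vac_state \<Rightarrow> vac_state set" where
  "preds y = {x \<in> VS. fst x \<le> fst y + 1}"

lemma finite_preds: "finite (preds y)"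
  unfolding preds_def by (rule finite_vac_states_le)

text \<open>Testing with the indicator of \<open>y\<close> turns a generator identity into the
  balance equation at \<open>y\<close>, with a finite sum of inflows.\<close>

lemma gen_VT_indicator:
  assumes "x \<in> VS"
  shows "gen VT (indicator {y}) x
    = (\<Sum>x'\<in>preds y. trans_rate VT x' y * indicator {x'} x) - exit_rate VT y * indicator {y} x"
proof -
  have "(\<Sum>x'\<in>preds y. trans_rate VT x' y * indicator {x'} x) = (\<Sum>x'\<in>preds y. if x' = x then trans_rate VT x y else 0)"
    by (rule sum.cong) (auto simp: indicator_def)
  also have "\<dots> = trans_rate VT x y"
    using assms vac_trans_fst[of lam1 "mu Q1" "k Q1" rs x y] finite_preds[of y]
    by (auto simp: preds_def)
  finally show ?thesis
    unfolding gen_eq trans_rate_eq[symmetric] by (auto simp: indicator_def)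
qed

text \<open>Two errors of order \<delta>: the weight varies slowly along the chain
  (\<open>weighted_gen_bound\<close>), and the intertwining fails on the irregular states
  (\<open>irregular_prob\<close>).\<close>

lemma balance_estimate:
  assumes \<delta>: "0 < \<delta>" "\<delta> < 1 - \<rho>\<^sub>1" and stat: "stationary_law S (tr \<delta>) p" and s: "s \<ge> 0"
    and h: "\<And>y. y \<in> VS \<Longrightarrow> \<bar>h y\<bar> \<le> 1"
  shows "\<bar>mean p (\<lambda>x. weight s \<delta> x * swap_phases (gen VT h) x)\<bar>
    \<le> s * \<delta> * (R * CT) + (R * (2 * CT) + CT * (RV * 2)) * (\<delta> / \<beta>)"
proof -
  interpret bc: bounded_chain S "tr \<delta>" R by (rule chain[OF \<delta>])
  obtain C where C: "integrable (measure_pmf p) (\<lambda>x. (len Q1 x)\<^sup>2)"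
      "mean p (\<lambda>x. (len Q1 x)\<^sup>2) \<le> C"
    using second_moment_Q1 \<delta> stat by metis
  note supp = bc.stationary_support[OF stat]
  define D where "D = R * (2 * CT) + CT * (RV * 2)"
  have CT: "CT \<ge> 0" unfolding CT_def using rate_ratio_pos by simp
  have D: "D \<ge> 0" unfolding D_def using bc.R_nonneg vc.R_nonneg CT by simp
  have W: "0 \<le> weight s \<delta> x" "weight s \<delta> x \<le> 1" for x unfolding weight_def using s \<delta> by auto
  have Th: "\<bar>swap_phases h x\<bar> \<le> CT" if "x \<in> S" for x using swap_phases_bound[OF that h] by simp
  have gT: "\<bar>gen (tr \<delta>) (swap_phases h) x\<bar> \<le> R * (2 * CT)" if "x \<in> S" for x
    by (rule bc.gen_bounded[OF that Th])
  have Tg: "\<bar>swap_phases (gen VT h) x\<bar> \<le> CT * (RV * 2)" if "x \<in> S" for x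
    by (rule swap_phases_bound[OF that]) (use vc.gen_bounded[of _ h 1] h in auto)
  have "\<bar>mean p (\<lambda>x. exp (- (s * \<delta> * len Q2 x)) * gen (tr \<delta>) (swap_phases h) x)\<bar>
      \<le> s * \<delta> * (R * 1 * CT)"
  proof (rule bc.weighted_gen_bound[OF stat _ _ Th])
    show "\<bar>len Q2 z - len Q2 x\<bar> \<le> 1" if "x \<in> S" "(r, z) \<in> set (tr \<delta> x)" for x r z
      using affine_fun_jump[OF that k_ge_1, of "\<lambda>_. 0" 0 0 1]
      by (cases x; cases z) (auto simp: queue_length_def)
  qed (use s \<delta> in auto)
  then have 1: "\<bar>mean p (\<lambda>x. weight s \<delta> x * gen (tr \<delta>) (swap_phases h) x)\<bar> \<le> s * \<delta> * (R * CT)"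
    by (simp add: weight_def)
  have near: "\<bar>weight s \<delta> x * swap_phases (gen VT h) x - weight s \<delta> x * gen (tr \<delta>) (swap_phases h) x\<bar> \<le> D * indicator {x. irregular x} x"
    if "x \<in> set_pmf p" for x
  proof (cases "irregular x")
    case False
    then show ?thesis using swap_phases_intertwines[of x] supp that by auto
  next
    case True
    have x: "x \<in> S" using supp that by auto
    have "\<bar>weight s \<delta> x * (swap_phases (gen VT h) x - gen (tr \<delta>) (swap_phases h) x)\<bar> \<le> 1 * D"
      unfolding abs_mult
    proof (rule mult_mono)
      show "\<bar>swap_phases (gen VT h) x - gen (tr \<delta>) (swap_phases h) x\<bar> \<le> D"
        using gT[OF x] Tg[OF x] unfolding D_def by linarith
    qed (use W D in auto)
    then show ?thesis using True by (simp add: right_diff_distrib)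
  qed
  have Wle: "\<bar>weight s \<delta> x * a\<bar> \<le> c" if "\<bar>a\<bar> \<le> c" for x a c
    using mult_mono[OF W(2) that] W(1)[of x] by (simp add: abs_mult)
  have i1: "integrable (measure_pmf p) (\<lambda>x. weight s \<delta> x * swap_phases (gen VT h) x)"
    by (rule integrable_pmf_bounded, rule Wle, rule Tg) (use supp in auto)
  have i2: "integrable (measure_pmf p) (\<lambda>x. weight s \<delta> x * gen (tr \<delta>) (swap_phases h) x)"
    by (rule integrable_pmf_bounded, rule Wle, rule gT) (use supp in auto)
  have i3: "integrable (measure_pmf p) (\<lambda>x. D * indicator {x. irregular x} x)"
    by (rule integrable_pmf_bounded[of _ _ D]) (use D in \<open>auto simp: indicator_def\<close>)
  have "\<bar>mean p (\<lambda>x. weight s \<delta> x * swap_phases (gen VT h) x - weight s \<delta> x * gen (tr \<delta>) (swap_phases h) x)\<bar>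
      \<le> mean p (\<lambda>x. \<bar>weight s \<delta> x * swap_phases (gen VT h) x - weight s \<delta> x * gen (tr \<delta>) (swap_phases h) x\<bar>)"
    by (rule integral_abs_bound)
  also have "\<dots> \<le> mean p (\<lambda>x. D * indicator {x. irregular x} x)"
    by (rule pmf_expectation_mono[OF integrable_abs[OF Bochner_Integration.integrable_diff[OF i1 i2]] i3 near])
  also have "\<dots> = D * mean p (indicator {x. irregular x})" by (rule integral_mult_right_zero)
  also have "\<dots> \<le> D * (\<delta> / \<beta>)"
    using irregular_prob[OF \<delta> stat C] D by (intro mult_left_mono)
  finally show ?thesis
    using 1 unfolding Bochner_Integration.integral_diff[OF i1 i2] D_def by linarith
qed

text \<open>The weighted law of the polling chain, transported to the vacation queue by the dual of
  \<open>swap_phases\<close>. It is a signed measure.\<close>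

definition tilted :: "polling_state pmf \<Rightarrow> real \<Rightarrow> real \<Rightarrow> vac_state \<Rightarrow> real" where
  "tilted p s \<delta> y = mean p (\<lambda>x. weight s \<delta> x * swap_phases (indicator {y}) x)"

context
  fixes p :: "polling_state pmf" and s \<delta> :: real
  assumes supp: "set_pmf p \<subseteq> S" and s\<delta>: "s \<ge> 0" "\<delta> > 0"
begin

lemma weight01: "0 \<le> weight s \<delta> x" "weight s \<delta> x \<le> 1"
  unfolding weight_def using s\<delta> by auto

lemma weight_swap_integrable:
  assumes "\<And>y. y \<in> VS \<Longrightarrow> \<bar>h y\<bar> \<le> c"
  shows "integrable (measure_pmf p) (\<lambda>x. weight s \<delta> x * swap_phases h x)"
proof (rule integrable_pmf_bounded)
  fix x assume "x \<in> set_pmf p"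
  then have x: "x \<in> S" using supp by auto
  show "\<bar>weight s \<delta> x * swap_phases h x\<bar> \<le> 1 * (CT * c)"
    unfolding abs_mult using weight01 swap_phases_bound[OF x assms] by (intro mult_mono) auto
qed

lemma tilted_sum:
  assumes F: "finite F"
  shows "mean p (\<lambda>x. weight s \<delta> x * swap_phases (\<lambda>z. \<Sum>y\<in>F. c y * indicator {y} z) x) = (\<Sum>y\<in>F. c y * tilted p s \<delta> y)"
proof -
  have int: "integrable (measure_pmf p) (\<lambda>x. weight s \<delta> x * swap_phases (indicator {y}) x)" for y
    by (rule weight_swap_integrable[of _ 1]) (auto simp: indicator_def)
  have "mean p (\<lambda>x. weight s \<delta> x * swap_phases (\<lambda>z. \<Sum>y\<in>F. c y * indicator {y} z) x)
      = mean p (\<lambda>x. \<Sum>y\<in>F. c y * (weight s \<delta> x * swap_phases (indicator {y}) x))"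
    by (rule pmf_expectation_cong) (use supp in \<open>auto simp: swap_phases_sum sum_distrib_left mult_ac\<close>)
  also have "\<dots> = (\<Sum>y\<in>F. mean p (\<lambda>x. c y * (weight s \<delta> x * swap_phases (indicator {y}) x)))"
    by (rule Bochner_Integration.integral_sum) (use int in auto)
  finally show ?thesis by (simp add: tilted_def)
qed

lemma tilted_balance:
  assumes y: "y \<in> VS"
  shows "mean p (\<lambda>x. weight s \<delta> x * swap_phases (gen VT (indicator {y})) x)
    = (\<Sum>x\<in>preds y. trans_rate VT x y * tilted p s \<delta> x) - exit_rate VT y * tilted p s \<delta> y"
proof -
  define f where "f z = (\<Sum>x'\<in>preds y. trans_rate VT x' y * indicator {x'} z)" for z :: vac_state
  define g where "g z = (\<Sum>y'\<in>{y}. exit_rate VT y' * indicator {y'} z)" for z :: vac_state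
  have g: "g z = exit_rate VT y * indicator {y} z" for z by (cases "z = y") (auto simp: g_def)
  have gb: "\<bar>g z\<bar> \<le> RV" for z
    using vc.exit_le[OF y] vc.exit_nonneg[OF y] by (cases "z = y") (auto simp: g_def)
  have fb: "\<bar>f z\<bar> \<le> RV * 2 + RV" if "z \<in> VS" for z
  proof -
    have "f z = gen VT (indicator {y}) z + g z" unfolding gen_VT_indicator[OF that] f_def g by simp
    moreover have "\<bar>gen VT (indicator {y}) z\<bar> \<le> RV * (2 * 1)"
      by (rule vc.gen_bounded[OF that]) (auto simp: indicator_def)
    ultimately show ?thesis using gb[of z] by linarith
  qed
  have "mean p (\<lambda>x. weight s \<delta> x * swap_phases (gen VT (indicator {y})) x)
      = mean p (\<lambda>x. weight s \<delta> x * swap_phases f x - weight s \<delta> x * swap_phases g x)"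
  proof (rule pmf_expectation_cong)
    fix x assume "x \<in> set_pmf p"
    then have x: "x \<in> S" using supp by auto
    have "swap_phases (gen VT (indicator {y})) x = swap_phases (\<lambda>z. f z - g z) x"
      by (rule swap_phases_cong[OF x]) (simp add: gen_VT_indicator f_def g)
    then show "weight s \<delta> x * swap_phases (gen VT (indicator {y})) x = weight s \<delta> x * swap_phases f x - weight s \<delta> x * swap_phases g x"
      by (simp add: swap_phases_diff[OF x] right_diff_distrib)
  qed
  also have "\<dots> = mean p (\<lambda>x. weight s \<delta> x * swap_phases f x) - mean p (\<lambda>x. weight s \<delta> x * swap_phases g x)"
    by (rule Bochner_Integration.integral_diff[OF weight_swap_integrable[OF fb] weight_swap_integrable[OF gb]])
  also have "\<dots> = (\<Sum>x\<in>preds y. trans_rate VT x y * tilted p s \<delta> x) - (\<Sum>y'\<in>{y}. exit_rate VT y' * tilted p s \<delta> y')"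
    unfolding f_def g_def by (simp only: tilted_sum finite_preds finite.intros)
  finally show ?thesis by simp
qed

text \<open>A bound on the total variation that is free of \<delta>; it gives convergent
  subsequences and the absolute summability of their limits.\<close>

lemma tilted_abs_sum:
  assumes "finite F"
  shows "(\<Sum>y\<in>F. \<bar>tilted p s \<delta> y\<bar>) \<le> CT"
proof -
  have int: "integrable (measure_pmf p) (\<lambda>x. weight s \<delta> x * swap_phases (indicator {y}) x)" for y
    by (rule weight_swap_integrable[of _ 1]) (auto simp: indicator_def)
  have "(\<Sum>y\<in>F. \<bar>tilted p s \<delta> y\<bar>) \<le> (\<Sum>y\<in>F. mean p (\<lambda>x. \<bar>weight s \<delta> x * swap_phases (indicator {y}) x\<bar>))"
    unfolding tilted_def by (intro sum_mono integral_abs_bound)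
  also have "\<dots> = mean p (\<lambda>x. \<Sum>y\<in>F. \<bar>weight s \<delta> x * swap_phases (indicator {y}) x\<bar>)"
    by (rule Bochner_Integration.integral_sum[symmetric]) (rule integrable_abs[OF int])
  also have "\<dots> \<le> mean p (\<lambda>x. CT)"
  proof (rule pmf_expectation_mono)
    show "integrable (measure_pmf p) (\<lambda>x. \<Sum>y\<in>F. \<bar>weight s \<delta> x * swap_phases (indicator {y}) x\<bar>)"
      by (intro Bochner_Integration.integrable_sum integrable_abs[OF int])
    fix x assume "x \<in> set_pmf p"
    then have x: "x \<in> S" using supp by auto
    have "(\<Sum>y\<in>F. \<bar>weight s \<delta> x * swap_phases (indicator {y}) x\<bar>) = weight s \<delta> x * (\<Sum>y\<in>F. \<bar>swap_phases (indicator {y}) x\<bar>)"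
      using weight01 by (simp add: abs_mult sum_distrib_left)
    also have "\<dots> \<le> 1 * CT"
      using weight01 swap_phases_indicator_sum[OF x assms] by (intro mult_mono) (auto intro: sum_nonneg)
    finally show "(\<Sum>y\<in>F. \<bar>weight s \<delta> x * swap_phases (indicator {y}) x\<bar>) \<le> CT" by simp
  qed simp
  finally show ?thesis by simp
qed

text \<open>\<open>swap_phases\<close> preserves functions of the queue length, so the signed
  weights disappear from level sets and the law of queue 1 can be read off.\<close>

lemma tilted_level:
  "(\<Sum>y\<in>{y \<in> VS. fst y \<le> n}. tilted p s \<delta> y)
    = mean p (\<lambda>x. weight s \<delta> x * indicator {x. queue_length Q1 x \<le> n} x)"
proof -
  have fin: "finite {y \<in> VS. fst y \<le> n}" by (rule finite_vac_states_le)
  have "(\<Sum>y\<in>{y \<in> VS. fst y \<le> n}. 1 * tilted p s \<delta> y)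
      = mean p (\<lambda>x. weight s \<delta> x * swap_phases (\<lambda>z. \<Sum>y\<in>{y \<in> VS. fst y \<le> n}. 1 * indicator {y} z) x)"
    by (rule tilted_sum[OF fin, symmetric])
  also have "\<dots> = mean p (\<lambda>x. weight s \<delta> x * indicator {x. queue_length Q1 x \<le> n} x)"
  proof (rule pmf_expectation_cong)
    fix x assume "x \<in> set_pmf p"
    then have x: "x \<in> S" using supp by auto
    have "swap_phases (\<lambda>z. \<Sum>y\<in>{y \<in> VS. fst y \<le> n}. 1 * indicator {y} z) x = swap_phases (\<lambda>z. indicator {..n} (fst z)) x"
    proof (rule swap_phases_cong[OF x])
      fix z assume z: "z \<in> VS"
      have "(\<Sum>y\<in>{y \<in> VS. fst y \<le> n}. 1 * indicator {y} z) = (\<Sum>y\<in>{y \<in> VS. fst y \<le> n}. if y = z then 1 else (0::real))"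
        by (rule sum.cong) (auto simp: indicator_def)
      then show "(\<Sum>y\<in>{y \<in> VS. fst y \<le> n}. 1 * indicator {y} z) = (indicator {..n} (fst z) :: real)"
        using fin z by (simp add: indicator_def)
    qed
    then show "weight s \<delta> x * swap_phases (\<lambda>z. \<Sum>y\<in>{y \<in> VS. fst y \<le> n}. 1 * indicator {y} z) x
        = weight s \<delta> x * indicator {x. queue_length Q1 x \<le> n} x"
      unfolding swap_phases_fst[OF x] by (simp add: indicator_def)
  qed
  finally show ?thesis by simp
qed

end

text \<open>Chebyshev's inequality; with the uniform second moment it gives tightness in queue
  1.\<close>

lemma tail_bound:
  assumes p: "set_pmf p \<subseteq> S" and s\<delta>: "s \<ge> 0" "\<delta> > 0"
    and int: "integrable (measure_pmf p) (\<lambda>x. (len Q1 x)\<^sup>2)"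
    and le: "mean p (\<lambda>x. (len Q1 x)\<^sup>2) \<le> C"
  shows "\<bar>mean p (weight s \<delta>)
      - mean p (\<lambda>x. weight s \<delta> x * indicator {x. queue_length Q1 x \<le> n} x)\<bar> \<le> C / (real n + 1)\<^sup>2"
proof -
  note W = weight01[OF p s\<delta>]
  have i1: "integrable (measure_pmf p) (weight s \<delta>)"
    by (rule integrable_pmf_bounded[of _ _ 1]) (use W in auto)
  have i2: "integrable (measure_pmf p) (\<lambda>x. weight s \<delta> x * indicator {x. queue_length Q1 x \<le> n} x)"
    by (rule integrable_pmf_bounded[of _ _ 1]) (use W in \<open>auto simp: indicator_def\<close>)
  have "\<bar>mean p (\<lambda>x. weight s \<delta> x - weight s \<delta> x * indicator {x. queue_length Q1 x \<le> n} x)\<bar>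
      \<le> mean p (\<lambda>x. \<bar>weight s \<delta> x - weight s \<delta> x * indicator {x. queue_length Q1 x \<le> n} x\<bar>)"
    by (rule integral_abs_bound)
  also have "\<dots> \<le> mean p (\<lambda>x. (len Q1 x)\<^sup>2 / (real n + 1)\<^sup>2)"
  proof (rule pmf_expectation_mono[OF integrable_abs[OF Bochner_Integration.integrable_diff[OF i1 i2]]])
    fix x
    show "\<bar>weight s \<delta> x - weight s \<delta> x * indicator {x. queue_length Q1 x \<le> n} x\<bar> \<le> (len Q1 x)\<^sup>2 / (real n + 1)\<^sup>2"
    proof (cases "queue_length Q1 x \<le> n")
      case False
      then have "(real n + 1)\<^sup>2 \<le> (len Q1 x)\<^sup>2" by (intro power_mono) auto
      then have "1 \<le> (len Q1 x)\<^sup>2 / (real n + 1)\<^sup>2" by (simp add: pos_le_divide_eq)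
      then have "weight s \<delta> x \<le> (len Q1 x)\<^sup>2 / (real n + 1)\<^sup>2" using W(2)[of x] by linarith
      then show ?thesis using False W(1)[of x] by simp
    qed simp
  qed (use int in auto)
  also have "\<dots> = mean p (\<lambda>x. (len Q1 x)\<^sup>2) / (real n + 1)\<^sup>2" by simp
  also have "\<dots> \<le> C / (real n + 1)\<^sup>2" using le by (intro divide_right_mono) auto
  finally show ?thesis unfolding Bochner_Integration.integral_diff[OF i1 i2] .
qed

section \<open>Compactness and uniqueness of the limit\<close>

lemma VS_reach:
  "\<forall>Z. (0, Vacation 0) \<in> Z \<longrightarrow>
    (\<forall>x\<in>VS. \<forall>y\<in>VS. y \<in> Z \<longrightarrow> trans_rate VT x y > 0 \<longrightarrow> x \<in> Z) \<longrightarrow> VS \<subseteq> Z"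
proof (intro allI impI)
  fix Z assume Z: "(0, Vacation 0) \<in> Z" "\<forall>x\<in>VS. \<forall>y\<in>VS. y \<in> Z \<longrightarrow> trans_rate VT x y > 0 \<longrightarrow> x \<in> Z"
  show "VS \<subseteq> Z"
  proof (rule vac_reach[OF lam1_pos mu_pos k_ge_1 _ rs_pos Z(1)])
    show "x \<in> Z" if "x \<in> VS" "y \<in> VS" "y \<in> Z" "trans_rate VT x y > 0" for x y
      using Z(2) that by blast
  qed simp
qed

text \<open>A pointwise limit \<open>l\<close> is an absolutely summable signed measure of total
  mass \<open>M\<close>, the limiting transform of queue 2, and it satisfies the balance equations.
  Hence \<open>l - M * pmf V\<close> is invariant with total 0 and vanishes.\<close>

lemma subsequence_limit:
  assumes P: "\<forall>\<^sub>F \<delta> in at_right 0. stationary_law S (tr \<delta>) (P \<delta>)" and s: "s \<ge> 0"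
    and V: "stationary_law VS VT V"
    and Z: "filterlim Z (at_right 0) sequentially"
    and l: "\<And>y. y \<in> VS \<Longrightarrow> (\<lambda>i. tilted (P (Z i)) s (Z i) y) \<longlonglongrightarrow> l y"
  shows "(\<lambda>i. mean (P (Z i)) (\<lambda>x. weight s (Z i) x * indicator {x. queue_length Q1 x \<le> n} x))
    \<longlonglongrightarrow> eta lam1 mu sig k / (eta lam1 mu sig k + s) * vac_length_cdf V n"
proof -
  define M where "M = eta lam1 mu sig k / (eta lam1 mu sig k + s)"
  define f where "f m i = mean (P (Z i)) (\<lambda>x. weight s (Z i) x * indicator {x. queue_length Q1 x \<le> m} x)" for m i
  define F where "F m = {y \<in> VS. fst y \<le> m}" for m
  have finF: "finite (F m)" for m unfolding F_def by (rule finite_vac_states_le)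
  obtain C where C: "\<And>\<delta> p. 0 < \<delta> \<Longrightarrow> \<delta> < 1 - \<rho>\<^sub>1 \<Longrightarrow> stationary_law S (tr \<delta>) p \<Longrightarrow>
      integrable (measure_pmf p) (\<lambda>x. (len Q1 x)\<^sup>2) \<and>
      mean p (\<lambda>x. (len Q1 x)\<^sup>2) \<le> C"
    using second_moment_Q1 by metis
  have dl: "\<forall>\<^sub>F \<delta> in at_right 0. 0 < \<delta> \<and> \<delta> < 1 - \<rho>\<^sub>1"
    unfolding eventually_at_right_field using rho1_less by (intro exI[of _ "1 - \<rho>\<^sub>1"]) auto
  have Z0: "Z \<longlonglongrightarrow> 0" using Z unfolding filterlim_at by blast
  have ev: "\<forall>\<^sub>F i in sequentially. 0 < Z i \<and> Z i < 1 - \<rho>\<^sub>1 \<and> stationary_law S (tr (Z i)) (P (Z i))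
      \<and> set_pmf (P (Z i)) \<subseteq> S"
    using eventually_compose_filterlim[OF eventually_conj[OF P dl] Z]
    by eventually_elim (auto simp: stationary_law_def)
  have lev: "f m \<longlonglongrightarrow> (\<Sum>y\<in>F m. l y)" for m
  proof (rule Lim_transform_eventually)
    show "(\<lambda>i. \<Sum>y\<in>F m. tilted (P (Z i)) s (Z i) y) \<longlonglongrightarrow> (\<Sum>y\<in>F m. l y)"
      by (intro tendsto_sum l) (auto simp: F_def)
    show "\<forall>\<^sub>F i in sequentially. (\<Sum>y\<in>F m. tilted (P (Z i)) s (Z i) y) = f m i"
      using ev by eventually_elim (use tilted_level s in \<open>auto simp: f_def F_def\<close>)
  qed
  have "((\<lambda>\<delta>. mean (P \<delta>) (weight s \<delta>)) \<longlongrightarrow> M) (at_right 0)"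
    unfolding M_def weight_def[abs_def] by (rule laplace_limit[OF P s])
  from filterlim_compose[OF this Z]
  have tot: "(\<lambda>i. mean (P (Z i)) (weight s (Z i))) \<longlonglongrightarrow> M" .
  \<comment> \<open>Tightness passes to the limit: no mass escapes to large queue lengths, which
    identifies the total of \<open>l\<close> with \<open>M\<close>.\<close>
  have tail: "\<bar>M - (\<Sum>y\<in>F m. l y)\<bar> \<le> C / (real m + 1)\<^sup>2" for m
  proof (rule tendsto_upperbound)
    show "(\<lambda>i. \<bar>mean (P (Z i)) (weight s (Z i)) - f m i\<bar>) \<longlonglongrightarrow> \<bar>M - (\<Sum>y\<in>F m. l y)\<bar>"
      by (intro tendsto_intros tot lev)
    show "\<forall>\<^sub>F i in sequentially. \<bar>mean (P (Z i)) (weight s (Z i)) - f m i\<bar> \<le> C / (real m + 1)\<^sup>2"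
      using ev
    proof eventually_elim
      case (elim i)
      then show ?case unfolding f_def using C[of "Z i" "P (Z i)"] s by (intro tail_bound) auto
    qed
  qed simp
  have "(\<lambda>y. \<bar>l y\<bar>) summable_on VS"
  proof (rule nonneg_bdd_above_summable_on)
    show "bdd_above (sum (\<lambda>y. \<bar>l y\<bar>) ` {F. F \<subseteq> VS \<and> finite F})"
    proof (rule bdd_aboveI2)
      fix G assume G: "G \<in> {F. F \<subseteq> VS \<and> finite F}"
      show "(\<Sum>y\<in>G. \<bar>l y\<bar>) \<le> CT"
      proof (rule tendsto_upperbound)
        show "(\<lambda>i. \<Sum>y\<in>G. \<bar>tilted (P (Z i)) s (Z i) y\<bar>) \<longlonglongrightarrow> (\<Sum>y\<in>G. \<bar>l y\<bar>)"
          using G by (intro tendsto_intros l) auto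
        show "\<forall>\<^sub>F i in sequentially. (\<Sum>y\<in>G. \<bar>tilted (P (Z i)) s (Z i) y\<bar>) \<le> CT"
          using ev by eventually_elim (use tilted_abs_sum s G in auto)
      qed simp
    qed
  qed simp
  then have "l summable_on VS"
    using summable_on_iff_abs_summable_on_real[of l VS] by simp
  then obtain T where T: "(l has_sum T) VS" by (auto simp: summable_on_def)
  \<comment> \<open>The level sets exhaust \<open>VS\<close> by finite sets, so the unordered sum of
    \<open>l\<close> is the limit of the sums over levels.\<close>
  have "filterlim F (finite_subsets_at_top VS) sequentially"
    unfolding filterlim_finite_subsets_at_top
  proof (intro allI impI)
    fix X assume X: "finite X \<and> X \<subseteq> VS"
    define N where "N = (\<Sum>y\<in>X. fst y)"
    have "fst y \<le> N" if "y \<in> X" for y unfolding N_def using X that by (intro member_le_sum) auto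
    then have "X \<subseteq> F m" if "N \<le> m" for m using that X unfolding F_def by fastforce
    then show "\<forall>\<^sub>F m in sequentially. finite (F m) \<and> X \<subseteq> F m \<and> F m \<subseteq> VS"
      unfolding eventually_sequentially using finF by (intro exI[of _ N]) (auto simp: F_def)
  qed
  from filterlim_compose[OF T[unfolded has_sum_def] this]
  have T': "(\<lambda>m. \<Sum>y\<in>F m. l y) \<longlonglongrightarrow> T" .
  have "(\<lambda>m. \<Sum>y\<in>F m. l y) \<longlonglongrightarrow> M"
  proof (rule LIM_zero_cancel, rule Lim_null_comparison)
    show "\<forall>\<^sub>F m in sequentially. norm ((\<Sum>y\<in>F m. l y) - M) \<le> C / (real m + 1)\<^sup>2"
      using tail by (auto simp: abs_minus_commute)
    show "(\<lambda>m. C / (real m + 1)\<^sup>2) \<longlonglongrightarrow> 0" by real_asymp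
  qed
  with T' have TM: "T = M" by (rule LIMSEQ_unique)
  have bal: "((\<lambda>x. l x * trans_rate VT x y) has_sum (l y * exit_rate VT y)) VS" if y: "y \<in> VS" for y
  proof (rule has_sum_finite_neutralI[OF finite_preds[of y]])
    show "preds y \<subseteq> VS" by (auto simp: preds_def)
    show "l x * trans_rate VT x y = 0" if "x \<in> VS - preds y" for x
      using that vac_trans_fst[of lam1 "mu Q1" "k Q1" rs x y] by (auto simp: preds_def)
    \<comment> \<open>The defect in the balance equation at \<open>y\<close>; it tends to 0 by
      \<open>balance_estimate\<close>.\<close>
    define g where "g i = (\<Sum>x\<in>preds y. trans_rate VT x y * tilted (P (Z i)) s (Z i) x) - exit_rate VT y * tilted (P (Z i)) s (Z i) y" for i
    have 1: "g \<longlonglongrightarrow> (\<Sum>x\<in>preds y. trans_rate VT x y * l x) - exit_rate VT y * l y"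
      unfolding g_def by (intro tendsto_intros l y) (auto simp: preds_def)
    have "g \<longlonglongrightarrow> 0"
    proof (rule Lim_null_comparison)
      have "(\<lambda>i. s * Z i * (R * CT) + (R * (2 * CT) + CT * (RV * 2)) * (Z i / \<beta>))
          \<longlonglongrightarrow> s * 0 * (R * CT) + (R * (2 * CT) + CT * (RV * 2)) * (0 / \<beta>)"
        by (intro tendsto_intros Z0) (use beta_pos in auto)
      then show "(\<lambda>i. s * Z i * (R * CT) + (R * (2 * CT) + CT * (RV * 2)) * (Z i / \<beta>)) \<longlonglongrightarrow> 0" by simp
      show "\<forall>\<^sub>F i in sequentially. norm (g i) \<le> s * Z i * (R * CT) + (R * (2 * CT) + CT * (RV * 2)) * (Z i / \<beta>)"
        using ev
      proof eventually_elim
        case (elim i)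
        have "g i = mean (P (Z i)) (\<lambda>x. weight s (Z i) x * swap_phases (gen VT (indicator {y})) x)"
          unfolding g_def by (rule tilted_balance[symmetric]) (use elim s y in auto)
        then show ?case
          using balance_estimate[of "Z i" "P (Z i)" s "indicator {y}"] elim s by (simp add: indicator_def)
      qed
    qed
    with 1 have "(\<Sum>x\<in>preds y. trans_rate VT x y * l x) - exit_rate VT y * l y = 0" by (rule LIMSEQ_unique)
    then show "l y * exit_rate VT y = (\<Sum>x\<in>preds y. l x * trans_rate VT x y)" by (simp add: mult_ac)
  qed
  have suppV: "set_pmf V \<subseteq> VS" and balV: "\<And>y. y \<in> VS \<Longrightarrow> ((\<lambda>x. pmf V x * trans_rate VT x y) has_sum (pmf V y * exit_rate VT y)) VS"
    using V by (auto simp: stationary_law_def)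
  have sumV: "(pmf V has_sum 1) VS" using pmf_expectation_has_sum[OF suppV, of "\<lambda>_. 1" 1] by simp
  have sum0: "((\<lambda>y. l y - M * pmf V y) has_sum 0) VS"
    using has_sum_add[OF T has_sum_uminusI[OF has_sum_cmult_right[OF sumV, of M]]] by (simp add: TM)
  have bal0: "((\<lambda>x. (l x - M * pmf V x) * trans_rate VT x y) has_sum ((l y - M * pmf V y) * exit_rate VT y)) VS"
    if "y \<in> VS" for y
    using has_sum_add[OF bal[OF that] has_sum_uminusI[OF has_sum_cmult_right[OF balV[OF that], of M]]]
    by (simp add: left_diff_distrib mult.assoc)
  have z0: "(0, Vacation 0) \<in> VS" by (simp add: vac_states_def)
  have lV: "l y - M * pmf V y = 0" if "y \<in> VS" for y
    by (rule vc.invariant_vanishes[OF sum0 bal0 z0 VS_reach that])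
  have "(\<Sum>y\<in>F n. l y) = M * (\<Sum>y\<in>F n. pmf V y)"
    unfolding sum_distrib_left by (rule sum.cong) (use lV in \<open>auto simp: F_def\<close>)
  also have "(\<Sum>y\<in>F n. pmf V y) = measure_pmf.prob V (F n)"
    using finF by (simp add: measure_measure_pmf_finite)
  also have "\<dots> = vac_length_cdf V n"
    unfolding vac_length_cdf_def F_def
    by (rule measure_pmf.finite_measure_eq_AE) (use suppV in \<open>auto simp: AE_measure_pmf_iff\<close>)
  finally show ?thesis using lev[of n] unfolding f_def M_def by simp
qed

text \<open>Otherwise some sequence of \<delta> keeps a distance from the limit. \<open>VS\<close>
  is countable and \<open>tilted\<close> is bounded, so a diagonal subsequence converges at every
  state, and \<open>subsequence_limit\<close> contradicts the distance.\<close>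

lemma joint_limit:
  assumes P: "\<forall>\<^sub>F \<delta> in at_right 0. stationary_law S (tr \<delta>) (P \<delta>)" and s: "s \<ge> 0"
    and V: "stationary_law VS VT V"
  shows "((\<lambda>\<delta>. mean (P \<delta>) (\<lambda>x. weight s \<delta> x * indicator {x. queue_length Q1 x \<le> n} x))
    \<longlongrightarrow> eta lam1 mu sig k / (eta lam1 mu sig k + s) * vac_length_cdf V n) (at_right 0)"
    (is "(?f \<longlongrightarrow> ?L) _")
proof (rule ccontr)
  assume "\<not> (?f \<longlongrightarrow> ?L) (at_right 0)"
  then obtain e where e: "e > 0" and fr: "\<exists>\<^sub>F \<delta> in at_right 0. dist (?f \<delta>) ?L \<ge> e"
    unfolding tendsto_iff by (auto simp: not_eventually not_less)
  define Q where "Q i \<delta> \<longleftrightarrow> 0 < \<delta> \<and> \<delta> < 1 / (real i + 1) \<and> stationary_law S (tr \<delta>) (P \<delta>) \<and> dist (?f \<delta>) ?L \<ge> e"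
    for i :: nat and \<delta>
  have "\<exists>\<delta>. Q i \<delta>" for i
  proof -
    have "\<forall>\<^sub>F \<delta> in at_right 0. 0 < \<delta> \<and> \<delta> < 1 / (real i + 1)"
      unfolding eventually_at_right_field by (intro exI[of _ "1 / (real i + 1)"]) auto
    then have "\<exists>\<^sub>F \<delta> in at_right 0. dist (?f \<delta>) ?L \<ge> e \<and> ((0 < \<delta> \<and> \<delta> < 1 / (real i + 1)) \<and> stationary_law S (tr \<delta>) (P \<delta>))"
      using P by (intro frequently_eventually_frequently[OF fr] eventually_conj[OF _ P])
    then show ?thesis unfolding Q_def by (auto dest: frequently_ex)
  qed
  then obtain X where "\<And>i. Q i (X i)" by metis
  then have X: "\<And>i. 0 < X i" "\<And>i. X i < 1 / (real i + 1)"
    "\<And>i. stationary_law S (tr (X i)) (P (X i))" "\<And>i. dist (?f (X i)) ?L \<ge> e" unfolding Q_def by blast+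
  have X0: "X \<longlonglongrightarrow> 0"
  proof (rule Lim_null_comparison)
    show "\<forall>\<^sub>F i in sequentially. norm (X i) \<le> 1 / (real i + 1)"
      using X(1,2) by (intro always_eventually allI) (simp add: less_imp_le)
    show "(\<lambda>i. 1 / (real i + 1)) \<longlonglongrightarrow> 0" by real_asymp
  qed
  have "VS = (\<Union>N. {x \<in> VS. fst x \<le> N})" by blast
  also have "countable \<dots>" by (rule countable_UN[OF countableI_type]) (rule countable_finite[OF finite_vac_states_le])
  finally have cnt: "countable VS" .
  have bound: "norm (tilted (P (X i)) s (X i) y) \<le> CT" for i y
  proof -
    have "set_pmf (P (X i)) \<subseteq> S" using X(3)[of i] by (simp add: stationary_law_def)
    from tilted_abs_sum[OF this s X(1), of "{y}"] show ?thesis by simp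
  qed
  obtain r where r: "strict_mono r" "\<And>y. y \<in> VS \<Longrightarrow> \<exists>l. (\<lambda>i. tilted (P (X (r i))) s (X (r i)) y) \<longlonglongrightarrow> l"
    using function_convergent_subsequence[OF cnt, of "\<lambda>i. tilted (P (X i)) s (X i)" CT] bound by blast
  define l where "l y = lim (\<lambda>i. tilted (P (X (r i))) s (X (r i)) y)" for y
  have l: "(\<lambda>i. tilted (P (X (r i))) s (X (r i)) y) \<longlonglongrightarrow> l y" if "y \<in> VS" for y
    unfolding l_def using r(2)[OF that] convergent_LIMSEQ_iff convergent_def by blast
  have "filterlim (\<lambda>i. X (r i)) (at_right 0) sequentially"
    using LIMSEQ_subseq_LIMSEQ[OF X0 r(1)] X(1)
    by (intro tendsto_imp_filterlim_at_right) (auto simp: o_def)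
  from subsequence_limit[OF P s V this l]
  have "(\<lambda>i. ?f (X (r i))) \<longlonglongrightarrow> ?L" .
  then have "\<forall>\<^sub>F i in sequentially. dist (?f (X (r i))) ?L < e" using e by (rule tendstoD)
  then show False using X(4) by (auto simp: eventually_sequentially not_less[symmetric])
qed

end

section \<open>From Laplace transforms to distribution functions\<close>

text \<open>If \<open>X\<close> is exponentially distributed with parameter \<open>e\<close>, then \<open>exp (- e X)\<close> is uniformly
  distributed on \<open>[0, 1]\<close>; hence the mean of \<open>g (exp (- X))\<close> takes the following form.\<close>

definition exp_mean :: "real \<Rightarrow> (real \<Rightarrow> real) \<Rightarrow> real" where
  "exp_mean e g = integral {0..1} (\<lambda>v. g (v powr (1 / e)))"

lemma powr_range: "v \<in> {0..1} \<Longrightarrow> e > 0 \<Longrightarrow> (v::real) powr (1 / e) \<in> {0..1}"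
  by (auto intro: powr_le1)

lemma exp_mean_integrable:
  fixes g :: "real \<Rightarrow> real"
  assumes "e > 0" "continuous_on {0..1} g"
  shows "(\<lambda>v. g (v powr (1 / e))) integrable_on {0..1}"
proof (rule integrable_continuous_real)
  have "continuous_on {0..1} (\<lambda>v::real. v powr (1 / e))"
    using assms(1) by (intro continuous_on_powr' continuous_intros) auto
  then show "continuous_on {0..1} (\<lambda>v. g (v powr (1 / e)))"
    by (rule continuous_on_compose2[OF assms(2)]) (use powr_range assms(1) in blast)
qed

lemma exp_mean_power:
  assumes "e > 0"
  shows "exp_mean e (\<lambda>u. u ^ i) = e / (e + real i)"
proof -
  have "((\<lambda>v::real. v powr (real i / e)) has_integral (1 powr (real i / e + 1) / (real i / e + 1))) {0..1}"
  proof (rule has_integral_powr_from_0)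
    have "0 \<le> real i / e" using assms by simp
    then show "- 1 < real i / e" by linarith
  qed simp
  \<comment> \<open>The integrands differ at \<open>v = 0\<close> when \<open>i = 0\<close>, because
    \<open>0 powr 0 = 0\<close> but \<open>0 ^ 0 = 1\<close>; one point does not matter.\<close>
  then have "((\<lambda>v::real. (v powr (1 / e)) ^ i) has_integral (1 powr (real i / e + 1) / (real i / e + 1))) {0..1}"
  proof (rule has_integral_spike_finite[rotated 2])
    show "(v powr (1 / e)) ^ i = v powr (real i / e)" if "v \<in> {0..1} - {0}" for v :: real
      using that by (simp add: powr_realpow[symmetric] powr_powr)
  qed simp
  then have "exp_mean e (\<lambda>u. u ^ i) = 1 / (real i / e + 1)"
    unfolding exp_mean_def by (simp add: integral_unique)
  also have "\<dots> = e / (e + real i)" using assms by (simp add: field_simps)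
  finally show ?thesis .
qed

lemma exp_mean_sum:
  assumes "e > 0"
  shows "exp_mean e (\<lambda>u. \<Sum>i\<le>n. a i * u ^ i) = (\<Sum>i\<le>n::nat. a i * (e / (e + real i)))"
proof -
  have "exp_mean e (\<lambda>u. \<Sum>i\<le>n. a i * u ^ i) = (\<Sum>i\<le>n. integral {0..1} (\<lambda>v. a i * (v powr (1 / e)) ^ i))"
    unfolding exp_mean_def
    by (rule integral_sum) (use assms in \<open>auto intro!: exp_mean_integrable[of e "\<lambda>u. a _ * u ^ _"] continuous_intros\<close>)
  then show ?thesis using exp_mean_power[OF assms] unfolding exp_mean_def by simp
qed

lemma exp_mean_mono:
  assumes "e > 0" "continuous_on {0..1} g" "continuous_on {0..1} h" "\<And>u. u \<in> {0..1} \<Longrightarrow> g u \<le> h u"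
  shows "exp_mean e g \<le> exp_mean e h"
  unfolding exp_mean_def
  by (rule integral_le[OF exp_mean_integrable exp_mean_integrable]) (use assms powr_range in auto)

lemma exp_mean_close:
  assumes "e > 0" "continuous_on {0..1} g" "continuous_on {0..1} h" "\<And>u. u \<in> {0..1} \<Longrightarrow> \<bar>g u - h u\<bar> \<le> r"
  shows "\<bar>exp_mean e g - exp_mean e h\<bar> \<le> r"
proof -
  have shift: "exp_mean e (\<lambda>u. f u + d) = exp_mean e f + d" if "continuous_on {0..1} f" for f d
    unfolding exp_mean_def using exp_mean_integrable[OF assms(1) that] by (subst integral_add) auto
  have "exp_mean e g \<le> exp_mean e (\<lambda>u. h u + r)"
    by (rule exp_mean_mono[OF assms(1)]) (use assms in \<open>auto intro!: continuous_intros simp: abs_le_iff algebra_simps\<close>)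
  moreover have "exp_mean e h \<le> exp_mean e (\<lambda>u. g u + r)"
    by (rule exp_mean_mono[OF assms(1)]) (use assms in \<open>auto intro!: continuous_intros simp: abs_le_iff algebra_simps\<close>)
  ultimately show ?thesis using shift assms(2,3) by (simp add: abs_le_iff)
qed

text \<open>The bounds compare \<open>g\<close> with the indicator of X \<le> a for exponential X.
  In the uniform variable the event is the interval from \<open>exp (- (e * a))\<close> to
  1.\<close>

lemma exp_mean_tail:
  assumes e: "e > 0" and g: "continuous_on {0..1} g" and a: "a \<ge> 0"
  shows "(\<And>u. u \<in> {0..1} \<Longrightarrow> g u \<le> (if exp (- a) \<le> u then 1 else 0)) \<Longrightarrow> exp_mean e g \<le> 1 - exp (- (e * a))"
    and "(\<And>u. u \<in> {0..1} \<Longrightarrow> (if exp (- a) \<le> u then 1 else 0) \<le> g u) \<Longrightarrow> 1 - exp (- (e * a)) \<le> exp_mean e g"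
proof -
  define w where "w = exp (- (e * a))"
  have w: "0 \<le> w" "w \<le> 1" unfolding w_def using e a by auto
  have "((\<lambda>v. if v \<in> {w..1} then 1 else 0) has_integral (1 - w)) {0..1::real}"
    using has_integral_const_real[of "1::real" w 1] w by (subst has_integral_restrict) auto
  then have I: "(\<lambda>v. if v \<in> {w..1} then 1 else (0::real)) integrable_on {0..1}"
    "integral {0..1} (\<lambda>v. if v \<in> {w..1} then 1 else (0::real)) = 1 - w"
    by (auto simp: integral_unique has_integral_integrable)
  have iff: "exp (- a) \<le> v powr (1 / e) \<longleftrightarrow> v \<in> {w..1}" if "v \<in> {0..1}" for v
  proof (cases "v = 0")
    case True
    then show ?thesis by (simp add: w_def)
  next
    case False
    then have "exp (- a) \<le> v powr (1 / e) \<longleftrightarrow> - a \<le> ln v / e"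
      using that by (simp add: powr_def)
    also have "\<dots> \<longleftrightarrow> - (e * a) \<le> ln v" using e by (simp add: field_simps)
    also have "\<dots> \<longleftrightarrow> w \<le> v" unfolding w_def using that False by (simp add: ln_ge_iff)
    finally show ?thesis using that by simp
  qed
  note int = exp_mean_integrable[OF e g]
  show "exp_mean e g \<le> 1 - exp (- (e * a))"
    if "\<And>u. u \<in> {0..1} \<Longrightarrow> g u \<le> (if exp (- a) \<le> u then 1 else 0)"
    unfolding exp_mean_def w_def[symmetric] I(2)[symmetric]
  proof (rule integral_le[OF int I(1)])
    fix v :: real assume v: "v \<in> {0..1}"
    show "g (v powr (1 / e)) \<le> (if v \<in> {w..1} then 1 else 0)"
      using that[OF powr_range[OF v e]] unfolding iff[OF v] .
  qed
  show "1 - exp (- (e * a)) \<le> exp_mean e g"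
    if "\<And>u. u \<in> {0..1} \<Longrightarrow> (if exp (- a) \<le> u then 1 else 0) \<le> g u"
    unfolding exp_mean_def w_def[symmetric] I(2)[symmetric]
  proof (rule integral_le[OF I(1) int])
    fix v :: real assume v: "v \<in> {0..1}"
    show "(if v \<in> {w..1} then 1 else 0) \<le> g (v powr (1 / e))"
      using that[OF powr_range[OF v e]] unfolding iff[OF v] .
  qed
qed

text \<open>Integer arguments \<open>j\<close> are enough: they are the moments of the variable
  \<open>exp (- (\<delta> * N x))\<close> in [0, 1], and polynomials are dense there. The event
  \<open>A\<close> rides along, and \<open>c\<close> is its limiting probability
  (\<open>j = 0\<close>).\<close>

locale laplace_convergence =
  fixes P :: "real \<Rightarrow> 's pmf" and N :: "'s \<Rightarrow> real" and A :: "'s set" and e c :: real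
  assumes N: "\<And>x. N x \<ge> 0" and e: "e > 0"
    and lim: "\<And>j::nat. ((\<lambda>\<delta>. mean (P \<delta>) (\<lambda>x. exp (- (real j * \<delta> * N x)) * indicator A x))
      \<longlongrightarrow> e / (e + real j) * c) (at_right 0)"
begin

definition emp_mean :: "(real \<Rightarrow> real) \<Rightarrow> real \<Rightarrow> real" where
  "emp_mean g \<delta> = mean (P \<delta>) (\<lambda>x. g (exp (- (\<delta> * N x))) * indicator A x)"

lemma U_range: "\<delta> > 0 \<Longrightarrow> exp (- (\<delta> * N x)) \<in> {0..1}"
  using N[of x] by simp

lemma bounded_cont:
  fixes g :: "real \<Rightarrow> real"
  assumes "continuous_on {0..1} g"
  obtains C where "\<And>u. u \<in> {0..1} \<Longrightarrow> \<bar>g u\<bar> \<le> C"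
proof -
  have "bounded (g ` {0..1})" by (intro compact_imp_bounded compact_continuous_image assms) simp
  then obtain C where "\<forall>y\<in>g ` {0..1}. norm y \<le> C" unfolding bounded_iff by blast
  then show ?thesis by (intro that[of C]) auto
qed

lemma emp_mean_integrable:
  fixes g :: "real \<Rightarrow> real"
  assumes "\<delta> > 0" "continuous_on {0..1} g"
  shows "integrable (measure_pmf (P \<delta>)) (\<lambda>x. g (exp (- (\<delta> * N x))) * indicator A x)"
proof -
  obtain C where C: "\<And>u. u \<in> {0..1} \<Longrightarrow> \<bar>g u\<bar> \<le> C" using bounded_cont[OF assms(2)] by blast
  have "C \<ge> 0" using C[of 0] by simp
  then show ?thesis
    by (intro integrable_pmf_bounded[of _ _ C]) (use C[OF U_range[OF assms(1)]] in \<open>auto simp: indicator_def\<close>)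
qed

lemma emp_mean_close:
  assumes d: "\<delta> > 0" and c: "continuous_on {0..1} g" "continuous_on {0..1} h"
    and r: "\<And>u. u \<in> {0..1} \<Longrightarrow> \<bar>g u - h u\<bar> \<le> r"
  shows "\<bar>emp_mean g \<delta> - emp_mean h \<delta>\<bar> \<le> r"
proof -
  have "emp_mean g \<delta> - emp_mean h \<delta> = mean (P \<delta>)
      (\<lambda>x. g (exp (- (\<delta> * N x))) * indicator A x - h (exp (- (\<delta> * N x))) * indicator A x)"
    unfolding emp_mean_def by (rule Bochner_Integration.integral_diff[OF emp_mean_integrable emp_mean_integrable, symmetric]) fact+
  also have "\<bar>\<dots>\<bar> \<le> r"
  proof (rule pmf_expectation_bounded)
    fix x
    have "r \<ge> 0" using r[of 0] by simp
    then show "\<bar>g (exp (- (\<delta> * N x))) * indicator A x - h (exp (- (\<delta> * N x))) * indicator A x\<bar> \<le> r"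
      using r[OF U_range[OF d]] by (simp add: indicator_def)
  qed
  finally show ?thesis .
qed

lemma c_bounds: "0 \<le> c" "c \<le> 1"
proof -
  have l: "((\<lambda>\<delta>. mean (P \<delta>) (indicator A)) \<longlongrightarrow> c) (at_right 0)"
    using lim[of 0] e by simp
  show "0 \<le> c" by (rule tendsto_lowerbound[OF l]) auto
  show "c \<le> 1" by (rule tendsto_upperbound[OF l]) (auto simp: measure_pmf.prob_le_1)
qed

lemma pos: "\<forall>\<^sub>F \<delta> in at_right 0. (0::real) < \<delta>"
  by (simp add: eventually_at_right_less)

lemma emp_mean_polynomial:
  "((emp_mean (\<lambda>u. \<Sum>i\<le>n. a i * u ^ i)) \<longlongrightarrow> c * exp_mean e (\<lambda>u. \<Sum>i\<le>n. a i * u ^ i)) (at_right 0)"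
proof (rule Lim_transform_eventually)
  define h where "h j \<delta> = mean (P \<delta>) (\<lambda>x. exp (- (real j * \<delta> * N x)) * indicator A x)" for j and \<delta>
  have "((\<lambda>\<delta>. \<Sum>i\<le>n. a i * h i \<delta>) \<longlongrightarrow> (\<Sum>i\<le>n. a i * (e / (e + real i) * c))) (at_right 0)"
    unfolding h_def by (intro tendsto_intros lim)
  then show "((\<lambda>\<delta>. \<Sum>i\<le>n. a i * h i \<delta>) \<longlongrightarrow> c * exp_mean e (\<lambda>u. \<Sum>i\<le>n. a i * u ^ i)) (at_right 0)"
    unfolding exp_mean_sum[OF e] sum_distrib_left by (simp add: mult_ac)
  show "\<forall>\<^sub>F \<delta> in at_right 0. (\<Sum>i\<le>n. a i * h i \<delta>) = emp_mean (\<lambda>u. \<Sum>i\<le>n. a i * u ^ i) \<delta>"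
    using pos
  proof eventually_elim
    case (elim \<delta>)
    have int: "integrable (measure_pmf (P \<delta>)) (\<lambda>x. exp (- (real j * \<delta> * N x)) * indicator A x)" for j :: nat
      by (rule integrable_pmf_bounded[of _ _ 1]) (use elim N in \<open>auto simp: indicator_def\<close>)
    have "(\<Sum>i\<le>n. a i * h i \<delta>) = (\<Sum>i\<le>n. mean (P \<delta>) (\<lambda>x. a i * (exp (- (real i * \<delta> * N x)) * indicator A x)))"
      unfolding h_def by simp
    also have "\<dots> = mean (P \<delta>) (\<lambda>x. \<Sum>i\<le>n. a i * (exp (- (real i * \<delta> * N x)) * indicator A x))"
      by (rule Bochner_Integration.integral_sum[symmetric]) (use int in auto)
    also have "\<dots> = emp_mean (\<lambda>u. \<Sum>i\<le>n. a i * u ^ i) \<delta>"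
      unfolding emp_mean_def
      by (rule pmf_expectation_cong) (simp add: sum_distrib_right mult.assoc flip: exp_of_nat_mult)
    finally show ?case .
  qed
qed

lemma emp_mean_continuous:
  assumes g: "continuous_on {0..1} g"
  shows "(emp_mean g \<longlongrightarrow> c * exp_mean e g) (at_right 0)"
proof (rule tendstoI)
  fix r :: real assume r: "r > 0"
  obtain q where q: "real_polynomial_function q" "\<And>u. u \<in> {0..1} \<Longrightarrow> \<bar>g u - q u\<bar> < r / 4"
    using Stone_Weierstrass_real_polynomial_function[OF _ g, of "r / 4"] r by auto
  obtain a n where qe: "q = (\<lambda>u. \<Sum>i\<le>n::nat. a i * u ^ i)"
    using real_polynomial_function_imp_sum[OF q(1)] by blast
  have cq: "continuous_on {0..1} q" unfolding qe by (intro continuous_intros)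
  have le: "\<bar>g u - q u\<bar> \<le> r / 4" if "u \<in> {0..1}" for u using q(2)[OF that] by simp
  have "\<bar>c * exp_mean e g - c * exp_mean e q\<bar> \<le> 1 * (r / 4)"
    unfolding right_diff_distrib[symmetric] abs_mult
    using c_bounds exp_mean_close[OF e g cq le] by (intro mult_mono) auto
  then have 1: "\<bar>c * exp_mean e g - c * exp_mean e q\<bar> \<le> r / 4" by simp
  have "(emp_mean q \<longlongrightarrow> c * exp_mean e q) (at_right 0)" unfolding qe by (rule emp_mean_polynomial)
  then have "\<forall>\<^sub>F \<delta> in at_right 0. dist (emp_mean q \<delta>) (c * exp_mean e q) < r / 4" using r by (intro tendstoD) auto
  with pos show "\<forall>\<^sub>F \<delta> in at_right 0. dist (emp_mean g \<delta>) (c * exp_mean e g) < r"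
  proof eventually_elim
    case (elim \<delta>)
    then show ?case
      using 1 emp_mean_close[OF elim(1) g cq le] r unfolding dist_real_def by linarith
  qed
qed

text \<open>A linear ramp from \<open>exp (- b)\<close> to \<open>exp (- a)\<close>; the order is
  reversed because large values of \<open>N\<close> correspond to small values of the
  exponential.\<close>

lemma cutoff:
  assumes ab: "0 \<le> a" "a < (b::real)"
  obtains g where "continuous_on {0..1} g"
    "\<forall>u\<in>{0..1}. (if exp (- a) \<le> u then 1 else 0) \<le> g u"
    "\<forall>u\<in>{0..1}. g u \<le> (if exp (- b) \<le> u then 1 else (0::real))"
proof
  define g where "g u = max 0 (min 1 ((u - exp (- b)) / (exp (- a) - exp (- b))))" for u
  have d: "exp (- a) - exp (- b) > 0" using ab by simp
  show "continuous_on {0..1} g" unfolding g_def using d by (intro continuous_intros) auto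
  show "\<forall>u\<in>{0..1}. (if exp (- a) \<le> u then 1 else 0) \<le> g u"
    unfolding g_def using d by (auto simp: pos_le_divide_eq)
  have "g u \<le> (if exp (- b) \<le> u then 1 else 0)" for u
  proof (cases "exp (- b) \<le> u")
    case False
    then have "(u - exp (- b)) / (exp (- a) - exp (- b)) \<le> 0" using d by (intro divide_nonpos_pos) auto
    then show ?thesis using False by (simp add: g_def)
  qed (simp add: g_def)
  then show "\<forall>u\<in>{0..1}. g u \<le> (if exp (- b) \<le> u then 1 else 0)" by blast
qed

lemma cdf_as_mean:
  "measure_pmf.prob (P \<delta>) {x. x \<in> A \<and> \<delta> * N x \<le> a}
    = mean (P \<delta>) (\<lambda>x. (if exp (- a) \<le> exp (- (\<delta> * N x)) then 1 else 0) * indicator A x)"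
proof -
  have "measure_pmf.prob (P \<delta>) {x. x \<in> A \<and> \<delta> * N x \<le> a}
      = mean (P \<delta>) (indicator {x. x \<in> A \<and> \<delta> * N x \<le> a})" by simp
  also have "\<dots> = mean (P \<delta>) (\<lambda>x. (if exp (- a) \<le> exp (- (\<delta> * N x)) then 1 else 0) * indicator A x)"
    by (rule pmf_expectation_cong) (auto simp: indicator_def)
  finally show ?thesis .
qed

lemma cdf_integrable:
  "integrable (measure_pmf (P \<delta>)) (\<lambda>x. (if exp (- a) \<le> exp (- (\<delta> * N x)) then 1 else 0) * indicator A x :: real)"
  by (rule integrable_pmf_bounded[of _ _ 1]) (auto simp: indicator_def)

text \<open>The indicator of the event is sandwiched between ramps ending at levels slightly below
  and slightly above \<xi>; continuity of the exponential distribution function closes the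
  gap.\<close>

lemma exponential_limit:
  assumes xi: "\<xi> \<ge> 0"
  shows "((\<lambda>\<delta>. measure_pmf.prob (P \<delta>) {x. x \<in> A \<and> \<delta> * N x \<le> \<xi>}) \<longlongrightarrow> c * (1 - exp (- e * \<xi>))) (at_right 0)"
proof (rule order_tendstoI)
  fix y assume y: "y < c * (1 - exp (- e * \<xi>))"
  show "\<forall>\<^sub>F \<delta> in at_right 0. y < measure_pmf.prob (P \<delta>) {x. x \<in> A \<and> \<delta> * N x \<le> \<xi>}"
  \<comment> \<open>At \<xi> = 0 there is no smaller nonnegative level for a ramp, but the asserted
    limit is then 0.\<close>
  proof (cases "\<xi> = 0")
    case True
    then have "y < measure_pmf.prob (P \<delta>) {x. x \<in> A \<and> \<delta> * N x \<le> \<xi>}" for \<delta>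
      using y by (intro less_le_trans[OF _ measure_nonneg]) simp
    then show ?thesis by simp
  next
    case False
    have "((\<lambda>a. c * (1 - exp (- e * a))) \<longlongrightarrow> c * (1 - exp (- e * \<xi>))) (at_left \<xi>)"
      by (intro tendsto_intros)
    from order_tendstoD(1)[OF this y] obtain a0 where a0: "a0 < \<xi>" "\<And>a. a0 < a \<Longrightarrow> a < \<xi> \<Longrightarrow> y < c * (1 - exp (- e * a))"
      unfolding eventually_at_left_field by blast
    define a where "a = max 0 ((a0 + \<xi>) / 2)"
    have a: "0 \<le> a" "a < \<xi>" "y < c * (1 - exp (- e * a))"
      using a0 xi False by (auto simp: a_def max_def intro!: a0(2))
    obtain g :: "real \<Rightarrow> real" where g: "continuous_on {0..1} g"
      "\<forall>u\<in>{0..1}. (if exp (- a) \<le> u then 1 else 0) \<le> g u"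
      "\<forall>u\<in>{0..1}. g u \<le> (if exp (- \<xi>) \<le> u then 1 else 0)"
      using cutoff[OF a(1,2)] by blast
    have "1 - exp (- (e * a)) \<le> exp_mean e g" by (rule exp_mean_tail(2)[OF e g(1) a(1) g(2)[rule_format]])
    then have "c * (1 - exp (- e * a)) \<le> c * exp_mean e g" using c_bounds by (intro mult_left_mono) auto
    with a(3) have "y < c * exp_mean e g" by linarith
    from order_tendstoD(1)[OF emp_mean_continuous[OF g(1)] this] pos
    show ?thesis
    proof eventually_elim
      case (elim \<delta>)
      have "emp_mean g \<delta> \<le> measure_pmf.prob (P \<delta>) {x. x \<in> A \<and> \<delta> * N x \<le> \<xi>}"
        unfolding emp_mean_def cdf_as_mean
        by (intro pmf_expectation_mono emp_mean_integrable cdf_integrable mult_right_mono g(1) g(2)[rule_format] g(3)[rule_format] U_range elim) auto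
      with elim show ?case by linarith
    qed
  qed
next
  fix y assume y: "c * (1 - exp (- e * \<xi>)) < y"
  have "((\<lambda>a. c * (1 - exp (- e * a))) \<longlongrightarrow> c * (1 - exp (- e * \<xi>))) (at_right \<xi>)"
    by (intro tendsto_intros)
  from order_tendstoD(2)[OF this y] obtain b0 where b0: "b0 > \<xi>" "\<And>a. \<xi> < a \<Longrightarrow> a < b0 \<Longrightarrow> c * (1 - exp (- e * a)) < y"
    unfolding eventually_at_right_field by blast
  define b where "b = (b0 + \<xi>) / 2"
  have b: "\<xi> < b" "b < b0" using b0(1) by (auto simp: b_def)
  have b_lt: "c * (1 - exp (- e * b)) < y" by (rule b0(2)[OF b])
  obtain g :: "real \<Rightarrow> real" where g: "continuous_on {0..1} g"
    "\<forall>u\<in>{0..1}. (if exp (- \<xi>) \<le> u then 1 else 0) \<le> g u"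
    "\<forall>u\<in>{0..1}. g u \<le> (if exp (- b) \<le> u then 1 else 0)"
    using cutoff[OF xi b(1)] by blast
  have "exp_mean e g \<le> 1 - exp (- (e * b))"
    by (rule exp_mean_tail(1)[OF e g(1) _ g(3)[rule_format]]) (use xi b in linarith)
  then have "c * exp_mean e g \<le> c * (1 - exp (- e * b))" using c_bounds by (intro mult_left_mono) auto
  with b_lt have "c * exp_mean e g < y" by linarith
  from order_tendstoD(2)[OF emp_mean_continuous[OF g(1)] this] pos
  show "\<forall>\<^sub>F \<delta> in at_right 0. measure_pmf.prob (P \<delta>) {x. x \<in> A \<and> \<delta> * N x \<le> \<xi>} < y"
  proof eventually_elim
    case (elim \<delta>)
    have "measure_pmf.prob (P \<delta>) {x. x \<in> A \<and> \<delta> * N x \<le> \<xi>} \<le> emp_mean g \<delta>"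
      unfolding emp_mean_def cdf_as_mean
      by (intro pmf_expectation_mono emp_mean_integrable cdf_integrable mult_right_mono g(1) g(2)[rule_format] g(3)[rule_format] U_range elim) auto
    with elim show ?case by linarith
  qed
qed

end

theorem theorem3:
  fixes lam1 :: real
    and mu sig :: "queue \<Rightarrow> real"
    and k :: "queue \<Rightarrow> nat"
    and P :: "real \<Rightarrow> polling_state pmf"
    and V :: "vac_state pmf"
    and n1 :: nat
    and \<xi> :: real
  assumes lam1_pos: "lam1 > 0"
    and mu_pos: "\<And>q. mu q > 0"
    and sig_pos: "\<And>q. sig q > 0"
    and k_ge_1: "\<And>q. k q \<ge> 1"
    and load: "\<forall>\<^sub>F \<delta> in at_right 0.
      ht_lam lam1 mu sig k \<delta> Q1 / real (k Q1) < ht_lam lam1 mu sig k \<delta> Q2 / real (k Q2)"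
    and P_stationary: "\<forall>\<^sub>F \<delta> in at_right 0.
      polling_stationary (ht_lam lam1 mu sig k \<delta>) mu sig k (P \<delta>)"
    and V_stationary:
      "vac_stationary lam1 (mu Q1) (k Q1) (replicate (k Q2) (mu Q2) @ [sig Q1, sig Q2]) V"
    and xi_nonneg: "\<xi> \<ge> 0"
  shows "((\<lambda>\<delta>. measure_pmf.prob (P \<delta>)
            {s. queue_length Q1 s \<le> n1 \<and> \<delta> * real (queue_length Q2 s) \<le> \<xi>})
          \<longlongrightarrow> vac_length_cdf V n1 * (1 - exp (- eta lam1 mu sig k * \<xi>))) (at_right 0)"
proof -
  have "0 < mean_S sig" unfolding mean_S_def using sig_pos by (simp add: add_pos_pos)
  moreover have k2: "real (k Q2) > 0" and k1: "real (k Q1) > 0" using k_ge_1[of Q2] k_ge_1[of Q1] by auto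
  ultimately have B: "mean_B2' mu sig k > 0"
    unfolding mean_B2'_def using mu_pos[of Q2] by (simp add: add_pos_pos)
  have "\<forall>\<^sub>F \<delta> in at_right 0. (0::real) < \<delta>" by (simp add: eventually_at_right_less)
  \<comment> \<open>A single positive \<delta> that satisfies the load condition suffices: its own
    contribution leaves the strict slack at \<delta> = 0 that \<open>Q1_stable\<close>
    states.\<close>
  from eventually_happens'[OF _ eventually_conj[OF load this]]
  obtain \<delta> where \<delta>: "\<delta> > 0" "lam1 / real (k Q1) < (1 - lam1 / mu Q1 - \<delta>) / mean_B2' mu sig k / real (k Q2)"
    by (auto simp: ht_lam_def trivial_limit_at_right_real)
  have "lam1 * (real (k Q2) * mean_B2' mu sig k) < real (k Q1) * (1 - lam1 / mu Q1 - \<delta>)"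
    using \<delta>(2) k1 k2 B by (simp add: divide_less_eq less_divide_eq mult_ac)
  also have "\<dots> < real (k Q1) * (1 - lam1 / mu Q1)" using \<delta>(1) k1 by (intro mult_strict_left_mono) auto
  finally have stable: "lam1 * (real (k Q2) * mean_B2' mu sig k) < real (k Q1) * (1 - lam1 / mu Q1)" .
  interpret polling_limit lam1 mu sig k
    by unfold_locales (use lam1_pos mu_pos sig_pos k_ge_1 stable in auto)
  interpret laplace_convergence P "\<lambda>x. real (queue_length Q2 x)" "{x. queue_length Q1 x \<le> n1}"
    "eta lam1 mu sig k" "vac_length_cdf V n1"
  proof
    show "eta lam1 mu sig k > 0" unfolding eta_var_rate using var_rate0_pos B_pos by simp
    show "((\<lambda>\<delta>. mean (P \<delta>) (\<lambda>x. exp (- (real j * \<delta> * real (queue_length Q2 x)))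
        * indicator {x. queue_length Q1 x \<le> n1} x)) \<longlongrightarrow>
        eta lam1 mu sig k / (eta lam1 mu sig k + real j) * vac_length_cdf V n1) (at_right 0)" for j
      using joint_limit[of P "real j" V n1] P_stationary V_stationary
      by (simp add: polling_stationary_def vac_stationary_def weight_def)
  qed simp
  show ?thesis using exponential_limit[OF xi_nonneg] by simp
qed

end
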